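(* Let $A$ be a closed, densely defined $G$-symmetric operator in $\mathcal H$. Let $[a,b]$ be a compact interval in $\mathbb R$ with $[a,b]\cap\sigma_{ap}(A)\subset\sigma_{\pi_+}(A)$ (resp. $[a,b]\cap\sigma_{ap}(A)\subset\sigma_{\pi_-}(A)$). Then there exist an open neighborhood $\mathcal U$ of $[a,b]$ in $\mathbb C$, a finite set $\sigma\subset[a,b]\cap(\sigma_{\pi_+}(A)\setminus\sigma_+(A))$ (resp. $\sigma\subset[a,b]\cap(\sigma_{\pi_-}(A)\setminus\sigma_-(A))$) and a constant $\alpha\in\{0,1,2,\dots\}$ such that for all $\lambda\in\mathcal U\setminus\sigma$ we have $$\kappa_0(\ker(A-\lambda))=\alpha\le\min_{\mu\in\sigma}\kappa_0(\ker(A-\mu))$$ (the inequality being void if $\sigma=\varnothing$) and $$\kappa_-(\ker(A-\lambda))=0\quad(\text{resp. }\kappa_+(\ker(A-\lambda))=0).$$ If $\alpha=0$, then: (a) $\mathcal L_\lambda(A)$ is an Almost Pontryagin space for every $\lambda\in\mathcal U$. If $\lambda\in\mathcal U\setminus\sigma$, then $\ker(A-\lambda)=\mathcal L_\lambda(A)$ is a Hilbert space (resp. anti-Hilbert space) with respect to $[\cdot,\cdot]$ and there is no Jordan chain of $A$ at $\lambda$ of length greater than one. If $\lambda\in\sigma$, then every Jordan chain of $A$ at $\lambda$ is of finite length and, if $\mathcal N_+^\lambda\,[\dotplus]\,\mathcal N_-^\lambda\,[\dotplus]\,\mathcal N_0^\lambda$ is a fundamental decomposition of $\ker(A-\lambda)$,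 then there exists a finite-dimensional subspace $\mathcal L_1$ with $\mathcal L_\lambda(A)=\mathcal N_+^\lambda\,[\dotplus]\,\mathcal L_1$ (resp. $\mathcal L_\lambda(A)=\mathcal N_-^\lambda\,[\dotplus]\,\mathcal L_1$). (b) The set $\sigma$ can be chosen as $\sigma=([a,b]\cap\sigma_{ap}(A))\setminus\sigma_+(A)$ (resp. $\sigma=([a,b]\cap\sigma_{ap}(A))\setminus\sigma_-(A)$). (c) $\mathcal U\setminus\mathbb R\subset \mathrm r(A)$ and $\mathcal U\cap\sigma_{ap}(A)\subset\sigma_+(A)\cup\sigma$ (resp. $\mathcal U\cap\sigma_{ap}(A)\subset\sigma_-(A)\cup\sigma$). If $\alpha>0$, then: (d) $\mathcal U\subset\sigma_{\rm p}(A)$, with $(\ker(A-\lambda))^\circ\neq\{0\}$ for every $\lambda\in\mathcal U$. (e) For each $\lambda\in\mathcal U$ there exist at least $\alpha$ linearly independent Jordan chains of $A$ corresponding to $\lambda$ of infinite length. (f) $\mathcal U\subset\sigma_{\pi_+}(A)\setminus\sigma_+(A)$ (resp. $\mathcal U\subset\sigma_{\pi_-}(A)\setminus\sigma_-(A)$).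
   Context: $(\mathcal H,(\cdot,\cdot))$ is a Hilbert space, $G$ is a bounded selfadjoint operator in $\mathcal H$ (not assumed boundedly invertible or injective), and $[x,y]:=(Gx,y)$. A linear operator $A$ in $\mathcal H$ is $G$-symmetric if $[Ax,y]=[x,Ay]$ for all $x,y\in\operatorname{dom}A$. "Subspace" always means closed linear manifold. $\sigma_{\rm p}(A)$ is the set of eigenvalues of $A$. Inner product notions: a set is positive (negative, neutral) if $[x,x]>0$ ($<0$, $=0$) for all its nonzero vectors $x$. $\mathcal M^{[\perp]}=\{x\in\mathcal H:[x,y]=0\ \forall y\in\mathcal M\}$, and $\mathcal M^\circ=\mathcal M\cap\mathcal M^{[\perp]}$ is the isotropic part. $[\dotplus]$ denotes a direct sum which is orthogonal with respect to $[\cdot,\cdot]$. A fundamental decomposition of a subspace $\mathcal L$ is $\mathcal L=\mathcal L_+[\dotplus]\mathcal L_-[\dotplus]\mathcal L^\circ$ with a positive subspace $\mathcal L_+$ and a negative subspace $\mathcal L_-$ such that the corresponding projections in $\mathcal L$ are bounded; it always exists, and the numbers $\kappa_\pm(\mathcal L)=\dim\mathcal L_\pm$, $\kappa_0(\mathcal L)=\dim\mathcal L^\circ$ do not depend on its choice. A subspace $\mathcal L$ is an Almost Pontryagin space with finite rank of non-positivity (resp. non-negativity) if there is a subspace $\widetilde{\mathcal L}\subset\mathcal L$ of finite codimension in $\mathcal L$ and $\delta>0$ with $[x,x]\ge\delta\|x\|^2$ (resp. $-[x,x]\ge\delta\|x\|^2$) for all $x\in\widetilde{\mathcal L}$; it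 is an Almost Pontryagin space if one of the two holds. "Anti-Hilbert space" means a Hilbert space with respect to $-[\cdot,\cdot]$. Spectral notions for a closed, densely defined $A$: $\sigma_{ap}(A)$ is the set of all $\lambda\in\mathbb C$ for which there is $(x_n)$ in $\operatorname{dom}A$ with $\|x_n\|=1$, $(A-\lambda)x_n\to0$; $\mathrm r(A):=\mathbb C\setminus\sigma_{ap}(A)$. A point $\lambda\in\sigma_{ap}(A)$ belongs to $\sigma_{\pi_+}(A)$ (resp. $\sigma_{\pi_-}(A)$) if there is a linear manifold $\mathcal H_\lambda\subset\mathcal H$ of finite codimension such that for every sequence $(x_n)$ in $\mathcal H_\lambda\cap\operatorname{dom}A$ with $\|x_n\|=1$ and $(A-\lambda)x_n\to0$ one has $\liminf_n[x_n,x_n]>0$ (resp. $\limsup_n[x_n,x_n]<0$). It belongs to $\sigma_+(A)$ (resp. $\sigma_-(A)$) if $\mathcal H_\lambda$ can be chosen as $\mathcal H$. Jordan chains: a Jordan chain of $A$ at $\lambda\in\mathbb C$ of length $n$ is a finite ordered set of nonzero vectors $\{x_0,\dots,x_{n-1}\}$ in $\operatorname{dom}A$ with $(A-\lambda)x_0=0$ and $(A-\lambda)x_i=x_{i-1}$ for $i=1,\dots,n-1$; a Jordan chain of infinite length is an infinite sequence $(x_i)_{i\ge0}$ of nonzero vectors in $\operatorname{dom}A$ with $(A-\lambda)x_0=0$, $(A-\lambda)x_i=x_{i-1}$ for all $i\ge1$. "Every Jordan chain is of finite length" means there is no such infinite chain. Several Jordan chains at $\lambda$ are linearly independent if their union is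 linearly independent. $\mathcal L_\lambda(A):=\bigcup_{n\ge1}\ker(A-\lambda)^n$ is the algebraic eigenspace. *)

theory Defs
  imports "HOL-Analysis.Analysis" "HOL-Library.Extended_Nat" "HOL-Library.Set_Algebras"
begin

section \<open>Complex Hilbert spaces\<close>

text \<open>
  The norm and the topology are those of \<^class>\<open>real_inner\<close>, whose real inner product is required
  to be the real part of the complex one; the complex inner product is linear in its first argument.
\<close>

class scaleC =
  fixes scaleC :: "complex \<Rightarrow> 'a \<Rightarrow> 'a"  (infixr "*\<^sub>C" 75)

class chilbert_space = real_inner + complete_space + scaleC +
  fixes cinner :: "'a \<Rightarrow> 'a \<Rightarrow> complex"
  assumes scaleC_add_right: "c *\<^sub>C (x + y) = c *\<^sub>C x + c *\<^sub>C y"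
    and scaleC_add_left: "(c + d) *\<^sub>C x = c *\<^sub>C x + d *\<^sub>C x"
    and scaleC_scaleC: "c *\<^sub>C d *\<^sub>C x = (c * d) *\<^sub>C x"
    and scaleR_scaleC: "r *\<^sub>R x = complex_of_real r *\<^sub>C x"
    and cinner_add_left: "cinner (x + y) z = cinner x z + cinner y z"
    and cinner_scaleC_left: "cinner (c *\<^sub>C x) y = c * cinner x y"
    and cinner_commute: "cinner x y = cnj (cinner y x)"
    and Re_cinner: "Re (cinner x y) = inner x y"

lemma norm_eq_sqrt_cinner: "norm x = sqrt (Re (cinner x x))"
  for x :: "'a::chilbert_space"
  by (simp add: Re_cinner norm_eq_sqrt_inner)

lemma cinner_self_real: "cinner x x = complex_of_real ((norm x)\<^sup>2)"
  for x :: "'a::chilbert_space"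
  using cinner_commute[of x x]
  by (simp add: complex_eq_iff Re_cinner power2_norm_eq_inner)

instantiation complex :: chilbert_space
begin

definition scaleC_complex :: "complex \<Rightarrow> complex \<Rightarrow> complex"
  where "scaleC_complex c x = c * x"

definition cinner_complex :: "complex \<Rightarrow> complex \<Rightarrow> complex"
  where "cinner_complex x y = x * cnj y"

instance
  by standard
    (auto simp: scaleC_complex_def cinner_complex_def inner_complex_def scaleR_conv_of_real
      algebra_simps)

end

global_interpretation complex_vector: vector_space "scaleC :: complex \<Rightarrow> 'a \<Rightarrow> 'a::chilbert_space"
  defines cspan = complex_vector.span
    and csubspace = complex_vector.subspace
    and cdependent = complex_vector.dependent
    and cdim = complex_vector.dim
proof
  show "1 *\<^sub>C x = x" for x :: 'a
    using scaleR_scaleC[of 1 x] by simp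
qed (simp_all add: scaleC_add_right scaleC_add_left scaleC_scaleC)

definition closed_csubspace :: "'a::chilbert_space set \<Rightarrow> bool" where
  "closed_csubspace L \<longleftrightarrow> csubspace L \<and> closed L"

definition finite_dimensional :: "'a::chilbert_space set \<Rightarrow> bool" where
  "finite_dimensional L \<longleftrightarrow> (\<exists>B. finite B \<and> L \<subseteq> cspan B)"

text \<open>The library dimension of an infinite-dimensional space is not meaningful, hence \<open>\<infinity>\<close>.\<close>

definition edim :: "'a::chilbert_space set \<Rightarrow> enat" where
  "edim L = (if finite_dimensional L then enat (cdim L) else \<infinity>)"

definition finite_codim :: "'a::chilbert_space set \<Rightarrow> 'a set \<Rightarrow> bool" where
  "finite_codim M L \<longleftrightarrow> M \<subseteq> L \<and> (\<exists>B. finite B \<and> B \<subseteq> L \<and> L \<subseteq> cspan (M \<union> B))"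


section \<open>Indefinite inner products\<close>

text \<open>
  The notions of this section take the Hermitian form as a parameter \<open>f\<close>. Since \<open>f x x\<close> is real,
  its sign is the sign of its real part.
\<close>

definition bounded_selfadjoint :: "('a::chilbert_space \<Rightarrow> 'a) \<Rightarrow> bool" where
  "bounded_selfadjoint G \<longleftrightarrow> bounded_linear G \<and> (\<forall>c x. G (c *\<^sub>C x) = c *\<^sub>C G x) \<and>
     (\<forall>x y. cinner (G x) y = cinner x (G y))"

definition gip :: "('a::chilbert_space \<Rightarrow> 'a) \<Rightarrow> 'a \<Rightarrow> 'a \<Rightarrow> complex" where
  "gip G x y = cinner (G x) y"

definition positive_set :: "('a::chilbert_space \<Rightarrow> 'a \<Rightarrow> complex) \<Rightarrow> 'a set \<Rightarrow> bool" where
  "positive_set f M \<longleftrightarrow> (\<forall>x\<in>M. x \<noteq> 0 \<longrightarrow> Re (f x x) > 0)"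

definition negative_set :: "('a::chilbert_space \<Rightarrow> 'a \<Rightarrow> complex) \<Rightarrow> 'a set \<Rightarrow> bool" where
  "negative_set f M \<longleftrightarrow> (\<forall>x\<in>M. x \<noteq> 0 \<longrightarrow> Re (f x x) < 0)"

definition orth_companion :: "('a::chilbert_space \<Rightarrow> 'a \<Rightarrow> complex) \<Rightarrow> 'a set \<Rightarrow> 'a set" where
  "orth_companion f M = {x. \<forall>y\<in>M. f x y = 0}"

definition isotropic_part :: "('a::chilbert_space \<Rightarrow> 'a \<Rightarrow> complex) \<Rightarrow> 'a set \<Rightarrow> 'a set" where
  "isotropic_part f M = M \<inter> orth_companion f M"

definition orth_direct_sum ::
  "('a::chilbert_space \<Rightarrow> 'a \<Rightarrow> complex) \<Rightarrow> 'a set \<Rightarrow> 'a set \<Rightarrow> 'a set \<Rightarrow> bool" where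
  "orth_direct_sum f L M N \<longleftrightarrow> L = M + N \<and> M \<inter> N = {0} \<and> (\<forall>x\<in>M. \<forall>y\<in>N. f x y = 0)"

text \<open>
  The decomposition of \<open>L\<close> into \<open>Lp\<close>, \<open>Lm\<close> and the isotropic part of \<open>L\<close>; the last conjunct says
  that the three associated projections in \<open>L\<close> are bounded.
\<close>

definition fundamental_decomposition ::
  "('a::chilbert_space \<Rightarrow> 'a \<Rightarrow> complex) \<Rightarrow> 'a set \<Rightarrow> 'a set \<Rightarrow> 'a set \<Rightarrow> bool" where
  "fundamental_decomposition f L Lp Lm \<longleftrightarrow>
     closed_csubspace Lp \<and> positive_set f Lp \<and>
     closed_csubspace Lm \<and> negative_set f Lm \<and>
     orth_direct_sum f (Lp + Lm) Lp Lm \<and>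
     orth_direct_sum f L (Lp + Lm) (isotropic_part f L) \<and>
     (\<exists>C. \<forall>x\<in>Lp. \<forall>y\<in>Lm. \<forall>z\<in>isotropic_part f L.
        norm x \<le> C * norm (x + y + z) \<and>
        norm y \<le> C * norm (x + y + z) \<and>
        norm z \<le> C * norm (x + y + z))"

definition kappa_plus :: "('a::chilbert_space \<Rightarrow> 'a \<Rightarrow> complex) \<Rightarrow> 'a set \<Rightarrow> enat" where
  "kappa_plus f L = (THE k. \<exists>Lp Lm. fundamental_decomposition f L Lp Lm \<and> k = edim Lp)"

definition kappa_minus :: "('a::chilbert_space \<Rightarrow> 'a \<Rightarrow> complex) \<Rightarrow> 'a set \<Rightarrow> enat" where
  "kappa_minus f L = (THE k. \<exists>Lp Lm. fundamental_decomposition f L Lp Lm \<and> k = edim Lm)"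

definition kappa_zero :: "('a::chilbert_space \<Rightarrow> 'a \<Rightarrow> complex) \<Rightarrow> 'a set \<Rightarrow> enat" where
  "kappa_zero f L = edim (isotropic_part f L)"

definition almost_pontryagin :: "('a::chilbert_space \<Rightarrow> 'a \<Rightarrow> complex) \<Rightarrow> 'a set \<Rightarrow> bool" where
  "almost_pontryagin f L \<longleftrightarrow> closed_csubspace L \<and>
     ((\<exists>M \<delta>. closed_csubspace M \<and> finite_codim M L \<and> \<delta> > 0 \<and>
         (\<forall>x\<in>M. Re (f x x) \<ge> \<delta> * (norm x)\<^sup>2)) \<or>
      (\<exists>M \<delta>. closed_csubspace M \<and> finite_codim M L \<and> \<delta> > 0 \<and>
         (\<forall>x\<in>M. - Re (f x x) \<ge> \<delta> * (norm x)\<^sup>2)))"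

text \<open>Completeness refers to the norm induced by \<open>f\<close>, not to the norm of the ambient space.\<close>

definition hilbert_space_wrt :: "('a::chilbert_space \<Rightarrow> 'a \<Rightarrow> complex) \<Rightarrow> 'a set \<Rightarrow> bool" where
  "hilbert_space_wrt f L \<longleftrightarrow> csubspace L \<and> positive_set f L \<and>
     (\<forall>X::nat \<Rightarrow> 'a.
        (\<forall>n. X n \<in> L) \<and>
        (\<forall>e>0. \<exists>N. \<forall>m\<ge>N. \<forall>n\<ge>N. sqrt (Re (f (X m - X n) (X m - X n))) < e) \<longrightarrow>
        (\<exists>l\<in>L. (\<lambda>n. sqrt (Re (f (X n - l) (X n - l)))) \<longlonglongrightarrow> 0))"

definition anti_hilbert_space_wrt :: "('a::chilbert_space \<Rightarrow> 'a \<Rightarrow> complex) \<Rightarrow> 'a set \<Rightarrow> bool" where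
  "anti_hilbert_space_wrt f L \<longleftrightarrow> hilbert_space_wrt (\<lambda>x y. - f x y) L"


section \<open>Unbounded operators and their spectra\<close>

text \<open>
  An operator is given by its domain \<open>D\<close> and a function \<open>A\<close>, whose values outside \<open>D\<close> are irrelevant.
\<close>

definition linear_operator :: "'a::chilbert_space set \<Rightarrow> ('a \<Rightarrow> 'a) \<Rightarrow> bool" where
  "linear_operator D A \<longleftrightarrow> csubspace D \<and>
     (\<forall>x\<in>D. \<forall>y\<in>D. A (x + y) = A x + A y) \<and> (\<forall>c. \<forall>x\<in>D. A (c *\<^sub>C x) = c *\<^sub>C A x)"

definition closed_operator :: "'a::chilbert_space set \<Rightarrow> ('a \<Rightarrow> 'a) \<Rightarrow> bool" where
  "closed_operator D A \<longleftrightarrow> linear_operator D A \<and> closed ((\<lambda>x. (x, A x)) ` D)"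

definition densely_defined :: "'a::chilbert_space set \<Rightarrow> bool" where
  "densely_defined D \<longleftrightarrow> closure D = UNIV"

definition G_symmetric ::
  "('a::chilbert_space \<Rightarrow> 'a) \<Rightarrow> 'a set \<Rightarrow> ('a \<Rightarrow> 'a) \<Rightarrow> bool" where
  "G_symmetric G D A \<longleftrightarrow> (\<forall>x\<in>D. \<forall>y\<in>D. gip G (A x) y = gip G x (A y))"

definition op_kernel :: "'a::chilbert_space set \<Rightarrow> ('a \<Rightarrow> 'a) \<Rightarrow> complex \<Rightarrow> 'a set" where
  "op_kernel D A \<mu> = {x\<in>D. A x - \<mu> *\<^sub>C x = 0}"

text \<open>
  Domain and kernel of \<open>(A - \<mu>)\<^sup>n\<close>: all iterates before the \<open>n\<close>-th must again lie in \<open>D\<close>.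
\<close>

definition kernel_power ::
  "'a::chilbert_space set \<Rightarrow> ('a \<Rightarrow> 'a) \<Rightarrow> complex \<Rightarrow> nat \<Rightarrow> 'a set" where
  "kernel_power D A \<mu> n =
     {x. (\<forall>i<n. ((\<lambda>y. A y - \<mu> *\<^sub>C y) ^^ i) x \<in> D) \<and> ((\<lambda>y. A y - \<mu> *\<^sub>C y) ^^ n) x = 0}"

definition algebraic_eigenspace ::
  "'a::chilbert_space set \<Rightarrow> ('a \<Rightarrow> 'a) \<Rightarrow> complex \<Rightarrow> 'a set" where
  "algebraic_eigenspace D A \<mu> = (\<Union>n\<in>{1..}. kernel_power D A \<mu> n)"

definition point_spectrum :: "'a::chilbert_space set \<Rightarrow> ('a \<Rightarrow> 'a) \<Rightarrow> complex set" where
  "point_spectrum D A = {\<mu>. \<exists>x\<in>D. x \<noteq> 0 \<and> A x = \<mu> *\<^sub>C x}"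

definition approximate_eigensequence ::
  "'a::chilbert_space set \<Rightarrow> ('a \<Rightarrow> 'a) \<Rightarrow> complex \<Rightarrow> (nat \<Rightarrow> 'a) \<Rightarrow> bool" where
  "approximate_eigensequence D A \<mu> x \<longleftrightarrow>
     (\<forall>n. x n \<in> D \<and> norm (x n) = 1) \<and> (\<lambda>n. A (x n) - \<mu> *\<^sub>C x n) \<longlonglongrightarrow> 0"

definition sigma_ap :: "'a::chilbert_space set \<Rightarrow> ('a \<Rightarrow> 'a) \<Rightarrow> complex set" where
  "sigma_ap D A = {\<mu>. \<exists>x. approximate_eigensequence D A \<mu> x}"

definition r_set :: "'a::chilbert_space set \<Rightarrow> ('a \<Rightarrow> 'a) \<Rightarrow> complex set" where
  "r_set D A = - sigma_ap D A"

definition plus_condition ::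
  "('a::chilbert_space \<Rightarrow> 'a) \<Rightarrow> 'a set \<Rightarrow> ('a \<Rightarrow> 'a) \<Rightarrow> complex \<Rightarrow> 'a set \<Rightarrow> bool" where
  "plus_condition G D A \<mu> H \<longleftrightarrow>
     (\<forall>x. (\<forall>n. x n \<in> H) \<and> approximate_eigensequence D A \<mu> x \<longrightarrow>
        liminf (\<lambda>n. ereal (Re (gip G (x n) (x n)))) > 0)"

definition minus_condition ::
  "('a::chilbert_space \<Rightarrow> 'a) \<Rightarrow> 'a set \<Rightarrow> ('a \<Rightarrow> 'a) \<Rightarrow> complex \<Rightarrow> 'a set \<Rightarrow> bool" where
  "minus_condition G D A \<mu> H \<longleftrightarrow>
     (\<forall>x. (\<forall>n. x n \<in> H) \<and> approximate_eigensequence D A \<mu> x \<longrightarrow>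
        limsup (\<lambda>n. ereal (Re (gip G (x n) (x n)))) < 0)"

definition sigma_pi_plus ::
  "('a::chilbert_space \<Rightarrow> 'a) \<Rightarrow> 'a set \<Rightarrow> ('a \<Rightarrow> 'a) \<Rightarrow> complex set" where
  "sigma_pi_plus G D A =
     {\<mu>\<in>sigma_ap D A. \<exists>H. csubspace H \<and> finite_codim H UNIV \<and> plus_condition G D A \<mu> H}"

definition sigma_pi_minus ::
  "('a::chilbert_space \<Rightarrow> 'a) \<Rightarrow> 'a set \<Rightarrow> ('a \<Rightarrow> 'a) \<Rightarrow> complex set" where
  "sigma_pi_minus G D A =
     {\<mu>\<in>sigma_ap D A. \<exists>H. csubspace H \<and> finite_codim H UNIV \<and> minus_condition G D A \<mu> H}"

definition sigma_plus ::
  "('a::chilbert_space \<Rightarrow> 'a) \<Rightarrow> 'a set \<Rightarrow> ('a \<Rightarrow> 'a) \<Rightarrow> complex set" where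
  "sigma_plus G D A = {\<mu>\<in>sigma_ap D A. plus_condition G D A \<mu> UNIV}"

definition sigma_minus ::
  "('a::chilbert_space \<Rightarrow> 'a) \<Rightarrow> 'a set \<Rightarrow> ('a \<Rightarrow> 'a) \<Rightarrow> complex set" where
  "sigma_minus G D A = {\<mu>\<in>sigma_ap D A. minus_condition G D A \<mu> UNIV}"


section \<open>Jordan chains\<close>

definition jordan_chain ::
  "'a::chilbert_space set \<Rightarrow> ('a \<Rightarrow> 'a) \<Rightarrow> complex \<Rightarrow> 'a list \<Rightarrow> bool" where
  "jordan_chain D A \<mu> xs \<longleftrightarrow> xs \<noteq> [] \<and>
     (\<forall>i<length xs. xs ! i \<in> D \<and> xs ! i \<noteq> 0) \<and>
     A (xs ! 0) - \<mu> *\<^sub>C (xs ! 0) = 0 \<and>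
     (\<forall>i. 1 \<le> i \<and> i < length xs \<longrightarrow> A (xs ! i) - \<mu> *\<^sub>C (xs ! i) = xs ! (i - 1))"

definition infinite_jordan_chain ::
  "'a::chilbert_space set \<Rightarrow> ('a \<Rightarrow> 'a) \<Rightarrow> complex \<Rightarrow> (nat \<Rightarrow> 'a) \<Rightarrow> bool" where
  "infinite_jordan_chain D A \<mu> x \<longleftrightarrow>
     (\<forall>i. x i \<in> D \<and> x i \<noteq> 0) \<and>
     A (x 0) - \<mu> *\<^sub>C x 0 = 0 \<and>
     (\<forall>i\<ge>1. A (x i) - \<mu> *\<^sub>C x i = x (i - 1))"

text \<open>
  The union of the chains \<open>x 0, \<dots>, x (n - 1)\<close> is linearly independent as a family: the injectivity
  excludes that a vector is listed twice, in particular that one chain is counted repeatedly.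
\<close>

definition independent_chains :: "nat \<Rightarrow> (nat \<Rightarrow> nat \<Rightarrow> 'a::chilbert_space) \<Rightarrow> bool" where
  "independent_chains n x \<longleftrightarrow>
     inj_on (\<lambda>(j, i). x j i) ({..<n} \<times> UNIV) \<and>
     \<not> cdependent ((\<lambda>(j, i). x j i) ` ({..<n} \<times> UNIV))"

end

theory Submission
  imports Defs
begin

text \<open>
  If \<open>A - \<mu>\<close> is bounded below on the vectors of some finite-codimensional manifold where \<open>[x,x]\<close> is
  not uniformly positive, then an approximate eigensequence with \<open>limsup [x\<^sub>n,x\<^sub>n] \<le> 0\<close> forces a
  genuine eigenvector \<open>x\<close> with \<open>[x,x] \<le> 0\<close>: on cosets of the closure of that manifold (in the
  graph norm) a suitable quadratic form is convex, and nested bounded convex sets in a Hilbert space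
  admit strongly convergent selections. Hence on a nonpositive manifold \<open>V\<close> with \<open>TV = V\<close>,
  \<open>T = A - \<mu>\<^sub>0\<close>, the closure \<open>M\<close> is mapped onto itself by \<open>T\<close> with finite-dimensional kernel, so
  \<open>dim (M \<inter> ker (T - \<mu>))\<close> is constant near \<open>0\<close>, every eigenvector in \<open>M\<close> starts an infinite Jordan
  chain, and \<open>M\<close> is \<open>G\<close>-orthogonal to \<open>ker (T - \<mu>)\<close> for all small \<open>\<mu>\<close>. Applied to spans of
  nonpositive eigenvectors this yields, in a punctured neighbourhood, that nonpositive eigenvectors
  are isotropic and that the isotropic parts of the kernels have constant dimension. Applied to the
  span of an infinite Jordan chain, which is neutral, it excludes such chains when \<open>\<alpha> = 0\<close>.
\<close>

section \<open>Complex subspaces and dimension\<close>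

text \<open>Resolvents are of no help: \<open>G\<close> may fail to be injective and whole discs may
  consist of eigenvalues, so everything rests on the quadratic form and on lower bounds for
  \<open>T\<close>. An approximate eigensequence has only weak limit points, whose norm may drop to
  0; the convex selection yields strong limits, and subtracting \<open>\<delta> |x|^2\<close> from
  the form keeps the limit away from 0. Nonpositivity of \<open>M\<close> matters because
  near-kernel vectors of \<open>M\<close> orthogonal to its kernel would be uniformly positive; so
  there are none but 0, and \<open>T\<close> is bounded below there. With a right inverse of size
  \<open>c\<close>, moving \<open>T\<close> across the form \<open>n\<close> times leaves a factor
  \<open>(|\<mu>| c)^n\<close>, whence the \<open>G\<close>-orthogonality on the disc of radius
  \<open>1 / c\<close>. The spans must be nonpositive as a whole, so eigenvectors to different
  eigenvalues have to be orthogonal. Conjugate pairs obstruct this; therefore the construction is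
  run twice, first to obtain that orthogonality, then with all isotropic parts. Discs are centred at
  real points, since real shifts preserve \<open>G\<close>-symmetry; at the centre only one
  inclusion survives, hence the inequality for \<open>\<alpha>\<close> on \<sigma>.\<close>

lemma scaleC_complex_split: "c *\<^sub>C (x::'a::chilbert_space) = Re c *\<^sub>R x + Im c *\<^sub>R (\<i> *\<^sub>C x)"
  by (metis complex_eq mult.commute scaleC_add_left scaleC_scaleC scaleR_scaleC)

lemma scaleR_in_csubspace: "csubspace L \<Longrightarrow> x \<in> L \<Longrightarrow> r *\<^sub>R x \<in> L"
  for x :: "'a::chilbert_space"
  by (simp add: scaleR_scaleC complex_vector.subspace_scale)

lemma csubspace_imp_subspace: "csubspace L \<Longrightarrow> subspace L" for L :: "'a::chilbert_space set"
  by (simp add: subspace_def complex_vector.subspace_def scaleR_scaleC)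

text \<open>The class ties the norm only to the real part of \<open>cinner\<close>, so homogeneity
  for complex scalars is read off from \<open>cinner x x\<close>, which is the squared norm.\<close>

lemma norm_scaleC: "norm (c *\<^sub>C x) = cmod c * norm x" for x :: "'a::chilbert_space"
proof -
  have "cinner x (c *\<^sub>C x) = cnj c * cinner x x"
    using cinner_commute[of x "c *\<^sub>C x"] cinner_commute[of x x] by (simp add: cinner_scaleC_left)
  then have "complex_of_real ((norm (c *\<^sub>C x))\<^sup>2) = c * cnj c * cinner x x"
    unfolding cinner_self_real[symmetric] by (simp add: cinner_scaleC_left)
  also have "\<dots> = complex_of_real ((cmod c * norm x)\<^sup>2)"
    by (simp add: cinner_self_real power_mult_distrib complex_norm_square del: of_real_power)
  finally have "(norm (c *\<^sub>C x))\<^sup>2 = (cmod c * norm x)\<^sup>2" by (simp only: of_real_eq_iff)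
  then show ?thesis by (simp add: power2_eq_iff_nonneg)
qed

lemma bounded_linear_scaleC: "bounded_linear (\<lambda>x::'a::chilbert_space. c *\<^sub>C x)"
  by (rule bounded_linear_intro[where K="cmod c"])
    (simp_all add: scaleC_add_right scaleR_scaleC scaleC_scaleC norm_scaleC mult.commute)

lemmas tendsto_scaleC = bounded_linear.tendsto[OF bounded_linear_scaleC]

lemma cinner_add_right: "cinner x (y + z) = cinner x y + cinner x z" for x :: "'a::chilbert_space"
  by (metis cinner_add_left cinner_commute complex_cnj_add)

lemma cinner_scaleC_right: "cinner x (c *\<^sub>C y) = cnj c * cinner x y" for x :: "'a::chilbert_space"
  by (metis cinner_commute cinner_scaleC_left complex_cnj_mult)

lemma cinner_eq_inner: "cinner x y = Complex (inner x y) (inner x (\<i> *\<^sub>C y))"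
  for x :: "'a::chilbert_space"
proof -
  have "Re (cinner x (\<i> *\<^sub>C y)) = Im (cinner x y)" by (simp add: cinner_scaleC_right)
  then show ?thesis by (simp add: complex_eq_iff Re_cinner)
qed

lemma closed_csubspaceD: "closed_csubspace L \<Longrightarrow> csubspace L" "closed_csubspace L \<Longrightarrow> closed L"
  by (auto simp: closed_csubspace_def)

lemma subspace_closure: "subspace S \<Longrightarrow> subspace (closure S)" for S :: "'b::real_normed_vector set"
proof -
  assume S: "subspace S"
  have "c *\<^sub>R x \<in> closure S" if x: "x \<in> closure S" for c x
  proof -
    obtain u where "\<forall>n. u n \<in> S" "u \<longlonglongrightarrow> x" using x by (auto simp: closure_sequential)
    then show ?thesis unfolding closure_sequential using subspace_scale[OF S]
      by (intro exI[of _ "\<lambda>n. c *\<^sub>R u n"]) (simp add: tendsto_scaleR)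
  qed
  moreover have "x + y \<in> closure S" if xy: "x \<in> closure S" "y \<in> closure S" for x y
  proof -
    obtain u v where "\<forall>n. u n \<in> S" "u \<longlonglongrightarrow> x" "\<forall>n. v n \<in> S" "v \<longlonglongrightarrow> y"
      using xy by (auto simp: closure_sequential)
    then show ?thesis unfolding closure_sequential using subspace_add[OF S]
      by (intro exI[of _ "\<lambda>n. u n + v n"]) (simp add: tendsto_add)
  qed
  moreover have "0 \<in> closure S" using S closure_subset subspace_0 by blast
  ultimately show ?thesis by (simp add: subspace_def)
qed

lemma csubspace_closure:
  fixes L :: "'a::chilbert_space set"
  assumes L: "csubspace L" shows "csubspace (closure L)"
proof -
  have "c *\<^sub>C x \<in> closure L" if x: "x \<in> closure L" for c x
  proof -
    obtain u where "\<forall>n. u n \<in> L" "u \<longlonglongrightarrow> x" using x by (auto simp: closure_sequential)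
    then show ?thesis unfolding closure_sequential using complex_vector.subspace_scale[OF L]
      by (intro exI[of _ "\<lambda>n. c *\<^sub>C u n"]) (simp add: tendsto_scaleC)
  qed
  then show ?thesis using subspace_closure[OF csubspace_imp_subspace[OF L]]
    by (simp add: complex_vector.subspace_def subspace_def)
qed

section \<open>Finite dimension and finite codimension\<close>

lemma finite_dimensionalI: "finite B \<Longrightarrow> L \<subseteq> cspan B \<Longrightarrow> finite_dimensional L"
  by (auto simp: finite_dimensional_def)

lemma finite_dimensional_subset: "finite_dimensional L \<Longrightarrow> K \<subseteq> L \<Longrightarrow> finite_dimensional K"
  by (auto simp: finite_dimensional_def)

lemma finite_dimensional_basis:
  fixes L :: "'a::chilbert_space set"
  assumes "finite_dimensional L"
  obtains B where "finite B" "B \<subseteq> L" "\<not> cdependent B" "L \<subseteq> cspan B" "card B = cdim L"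
proof -
  obtain S where S: "finite S" "L \<subseteq> cspan S" using assms by (auto simp: finite_dimensional_def)
  obtain B where B: "B \<subseteq> L" "\<not> cdependent B" "L \<subseteq> cspan B" "card B = cdim L"
    using complex_vector.basis_exists by blast
  have "finite B" using complex_vector.independent_span_bound[OF S(1) B(2)] B(1) S(2) by auto
  then show thesis using B that by blast
qed

lemma edim_mono:
  fixes K :: "'a::chilbert_space set"
  assumes "K \<subseteq> L" shows "edim K \<le> edim L"
proof (cases "finite_dimensional L")
  case True
  obtain B where "finite B" "L \<subseteq> cspan B" "card B = cdim L" using finite_dimensional_basis[OF True] by metis
  then have "cdim K \<le> cdim L" by (metis assms complex_vector.dim_le_card subset_trans)
  then show ?thesis using True finite_dimensional_subset[OF True assms] by (simp add: edim_def)
qed (simp add: edim_def)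

lemma csubspace_cdim_equal:
  fixes K L :: "'a::chilbert_space set"
  assumes "csubspace K" "K \<subseteq> L" "finite_dimensional L" "cdim K = cdim L"
  shows "K = L"
proof (rule ccontr)
  assume "K \<noteq> L"
  then obtain x where x: "x \<in> L" "x \<notin> K" using assms by auto
  obtain B where B: "finite B" "B \<subseteq> K" "\<not> cdependent B" "K \<subseteq> cspan B" "card B = cdim K"
    using finite_dimensional_basis[OF finite_dimensional_subset[OF assms(3,2)]] by metis
  obtain C where C: "finite C" "L \<subseteq> cspan C" "card C = cdim L" using finite_dimensional_basis[OF assms(3)] by metis
  have nx: "x \<notin> cspan B" using x B(2) assms(1) complex_vector.span_minimal by blast
  then have "\<not> cdependent (insert x B)" by (simp add: complex_vector.independent_insertI B)
  moreover have "insert x B \<subseteq> cspan C" using x B(2) C(2) assms(2) by auto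
  ultimately have "card (insert x B) \<le> card C"
    using complex_vector.independent_span_bound[OF C(1)] by blast
  moreover have "x \<notin> B" using nx complex_vector.span_base by blast
  ultimately show False using B C assms(4) by simp
qed

lemma edim_singleton_0 [simp]: "edim {0::'a::chilbert_space} = 0"
proof -
  have "finite_dimensional {0::'a}" by (rule finite_dimensionalI[of "{}"]) auto
  moreover have "cdim {0::'a} = 0" 
    using complex_vector.dim_unique[of "{}" "{0::'a}" 0] complex_vector.independent_empty by simp
  ultimately show ?thesis by (simp add: edim_def zero_enat_def)
qed

lemma edim_eq_0_iff:
  fixes L :: "'a::chilbert_space set"
  assumes "csubspace L" shows "edim L = 0 \<longleftrightarrow> L = {0}"
proof
  assume "edim L = 0"
  then have fd: "finite_dimensional L" and "cdim L = 0"
    by (auto simp: edim_def zero_enat_def split: if_splits)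
  then obtain B where "finite B" "L \<subseteq> cspan B" "card B = 0" using finite_dimensional_basis[OF fd] by metis
  then show "L = {0}" using assms complex_vector.subspace_0 by fastforce
qed simp

text \<open>Linearity is asked on \<open>X\<close> only: the map to which this is applied comes from
  a choice and is unspecified elsewhere.\<close>

lemma edim_bij:
  fixes X Y :: "'a::chilbert_space set" and P :: "'a \<Rightarrow> 'a"
  assumes X: "csubspace X" and fX: "finite_dimensional X"
    and add: "\<And>x y. x \<in> X \<Longrightarrow> y \<in> X \<Longrightarrow> P (x + y) = P x + P y"
    and scale: "\<And>c x. x \<in> X \<Longrightarrow> P (c *\<^sub>C x) = c *\<^sub>C P x"
    and inj: "\<And>x. x \<in> X \<Longrightarrow> P x = 0 \<Longrightarrow> x = 0" and surj: "P ` X = Y"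
  shows "edim X = edim Y"
proof -
  obtain B where B: "finite B" "B \<subseteq> X" "\<not> cdependent B" "X \<subseteq> cspan B" "card B = cdim X"
    using finite_dimensional_basis[OF fX] by metis
  have sm: "(\<Sum>b\<in>S. u b *\<^sub>C b) \<in> X \<and> P (\<Sum>b\<in>S. u b *\<^sub>C b) = (\<Sum>b\<in>S. u b *\<^sub>C P b)"
    if "finite S" "S \<subseteq> X" for S u
    using that
  proof (induction S)
    case empty
    have "P 0 = 0" using scale[of 0 0] complex_vector.subspace_0[OF X] by simp
    then show ?case using complex_vector.subspace_0[OF X] by simp
  next
    case (insert s S)
    then show ?case by (simp add: X add complex_vector.subspace_add complex_vector.subspace_scale scale)
  qed
  have injP: "inj_on P X"
  proof (rule inj_onI)
    fix x y assume xy: "x \<in> X" "y \<in> X" "P x = P y"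
    have "P (x - y) = P x - P y"
      using add[of x "(-1) *\<^sub>C y"] scale[of y "-1"] xy X
      by (simp add: complex_vector.subspace_neg complex_vector.scale_minus_left)
    then show "x = y" using inj[of "x - y"] xy X complex_vector.subspace_diff by auto
  qed
  have injB: "inj_on P B" using injP B(2) inj_on_subset by blast
  have ind: "\<not> cdependent (P ` B)"
  proof (rule complex_vector.independent_if_scalars_zero)
    show "finite (P ` B)" using B by simp
    fix f x assume s: "(\<Sum>x\<in>P ` B. f x *\<^sub>C x) = 0" and x: "x \<in> P ` B"
    have "(\<Sum>b\<in>B. f (P b) *\<^sub>C P b) = 0" using s by (simp add: sum.reindex[OF injB])
    then have "P (\<Sum>b\<in>B. f (P b) *\<^sub>C b) = 0" using sm[OF B(1,2)] by simp
    then have "(\<Sum>b\<in>B. f (P b) *\<^sub>C b) = 0" using inj[of "\<Sum>b\<in>B. f (P b) *\<^sub>C b"] sm[OF B(1,2)] by simp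
    then have "f (P b) = 0" if "b \<in> B" for b
      using complex_vector.independentD[OF B(3,1) order_refl, of "\<lambda>b. f (P b)" b] that by simp
    then show "f x = 0" using x by auto
  qed
  have spY: "Y \<subseteq> cspan (P ` B)"
  proof
    fix y assume "y \<in> Y"
    then obtain x where x: "x \<in> X" "y = P x" using surj by auto
    then obtain u where "x = (\<Sum>b\<in>B. u b *\<^sub>C b)"
      using B(4) complex_vector.span_finite[OF B(1)] by auto
    then have "y = (\<Sum>b\<in>B. u b *\<^sub>C P b)" using sm[OF B(1,2)] x by simp
    then show "y \<in> cspan (P ` B)"
      by (simp add: complex_vector.span_base complex_vector.span_scale complex_vector.span_sum)
  qed
  have "P ` B \<subseteq> Y" using B(2) surj by auto
  then have "cdim Y = card (P ` B)" using complex_vector.basis_card_eq_dim[OF _ spY ind] by simp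
  also have "\<dots> = cdim X" using card_image[OF injB] B(5) by simp
  finally have "cdim Y = cdim X" .
  moreover have "finite_dimensional Y" using finite_dimensionalI[OF finite_imageI[OF B(1)] spY] .
  ultimately show ?thesis using fX by (simp add: edim_def)
qed

text \<open>Adjoining one vector to \<open>H\<close> enlarges its trace on \<open>W\<close> by at
  most one dimension; induction over \<open>B\<close> therefore collects finitely many complementary
  vectors, all taken from \<open>W\<close> itself.\<close>

lemma finite_relative_codim:
  fixes H W :: "'a::chilbert_space set"
  assumes "finite B" "csubspace H" "csubspace W" "W \<subseteq> cspan (H \<union> B)"
  shows "\<exists>C. finite C \<and> C \<subseteq> W \<and> W \<subseteq> cspan ((W \<inter> H) \<union> C)"
  using assms(1,2,4)
proof (induction B arbitrary: H rule: finite_induct)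
  case empty
  then have "W \<subseteq> H" by (simp add: complex_vector.span_eq_iff[THEN iffD2])
  then have "W \<inter> H = W" by auto
  then show ?case using complex_vector.span_superset[of W] by (intro exI[of _ "{}"]) simp
next
  case (insert b B)
  let ?H = "cspan (insert b H)"
  have "insert b H \<union> B \<subseteq> ?H \<union> B" using complex_vector.span_superset[of "insert b H"] by blast
  then have "W \<subseteq> cspan (?H \<union> B)"
    using insert.prems(2) complex_vector.span_mono[of "H \<union> insert b B" "?H \<union> B"] by auto
  then obtain C where C: "finite C" "C \<subseteq> W" "W \<subseteq> cspan ((W \<inter> ?H) \<union> C)"
    using insert.IH[of ?H] complex_vector.subspace_span by blast
  have spH: "cspan H = H" using insert.prems(1) by (simp add: complex_vector.span_eq_iff)
  \<comment> \<open>A single \<open>x0\<close> in \<open>W\<close> with nonzero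
    \<open>b\<close>-coordinate \<open>k0\<close> suffices: subtracting the multiple
    \<open>k / k0\<close> of it cancels the \<open>b\<close>-coordinate \<open>k\<close> of any
    other vector without leaving \<open>W\<close>.\<close>
  have "\<exists>F. finite F \<and> F \<subseteq> W \<and> W \<inter> ?H \<subseteq> cspan ((W \<inter> H) \<union> F)"
  proof (cases "W \<inter> ?H \<subseteq> H")
    case True
    then have "W \<inter> ?H \<subseteq> W \<inter> H" by auto
    then show ?thesis using complex_vector.span_superset[of "W \<inter> H"]
      by (intro exI[of _ "{}"]) auto
  next
    case False
    then obtain x0 where x0: "x0 \<in> W" "x0 \<in> ?H" "x0 \<notin> H" by auto
    then obtain k0 where k0: "x0 - k0 *\<^sub>C b \<in> H"
      using spH by (auto simp: complex_vector.span_breakdown_eq)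
    have "k0 \<noteq> 0" using k0 x0 by auto
    have "x \<in> cspan ((W \<inter> H) \<union> {x0})" if x: "x \<in> W" "x \<in> ?H" for x
    proof -
      obtain k where k: "x - k *\<^sub>C b \<in> H"
        using x spH by (auto simp: complex_vector.span_breakdown_eq)
      let ?t = "k / k0"
      have "?t *\<^sub>C (x0 - k0 *\<^sub>C b) = ?t *\<^sub>C x0 - k *\<^sub>C b"
        using \<open>k0 \<noteq> 0\<close> by (simp add: complex_vector.scale_right_diff_distrib scaleC_scaleC)
      then have eq: "(x - k *\<^sub>C b) - ?t *\<^sub>C (x0 - k0 *\<^sub>C b) = x - ?t *\<^sub>C x0"
        by (simp only:) simp
      have "x - ?t *\<^sub>C x0 \<in> H"
        using complex_vector.subspace_diff[OF insert.prems(1) k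
          complex_vector.subspace_scale[OF insert.prems(1) k0, of ?t]] eq by (simp only:)
      moreover have "x - ?t *\<^sub>C x0 \<in> W" using x x0 assms(3)
        by (simp add: complex_vector.subspace_diff complex_vector.subspace_scale)
      ultimately have "x - ?t *\<^sub>C x0 \<in> cspan (W \<inter> H)"
        by (intro complex_vector.span_base IntI)
      then show ?thesis by (auto simp: complex_vector.span_breakdown_eq)
    qed
    then show ?thesis using x0 by (intro exI[of _ "{x0}"]) auto
  qed
  then obtain F where F: "finite F" "F \<subseteq> W" "W \<inter> ?H \<subseteq> cspan ((W \<inter> H) \<union> F)" by auto
  have "(W \<inter> ?H) \<union> C \<subseteq> cspan ((W \<inter> H) \<union> (F \<union> C))"
    using F(3) complex_vector.span_mono[of "(W \<inter> H) \<union> F" "(W \<inter> H) \<union> (F \<union> C)"]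
      complex_vector.span_superset[of "(W \<inter> H) \<union> (F \<union> C)"] by auto
  then have "W \<subseteq> cspan ((W \<inter> H) \<union> (F \<union> C))"
    using C(3) complex_vector.span_minimal[OF _ complex_vector.subspace_span] by blast
  then show ?case using C F by (intro exI[of _ "F \<union> C"]) auto
qed

text \<open>This is how the manifold \<open>H\<close> of a spectral point of type pi-plus bounds
  kernels: nonpositive kernel vectors meet \<open>H\<close> only in 0.\<close>

lemma finite_dimensional_of_trivial_meet:
  fixes H W :: "'a::chilbert_space set"
  assumes "finite B" "csubspace H" "csubspace W" "W \<subseteq> cspan (H \<union> B)" "W \<inter> H \<subseteq> {0}"
  shows "finite_dimensional W"
proof -
  obtain C where C: "finite C" "W \<subseteq> cspan ((W \<inter> H) \<union> C)"
    using finite_relative_codim[OF assms(1-4)] by auto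
  have "cspan ((W \<inter> H) \<union> C) \<subseteq> cspan (insert 0 C)"
    using assms(5) by (intro complex_vector.span_mono) auto
  then have "W \<subseteq> cspan C" using C(2) complex_vector.span_insert_0[of C] by auto
  then show ?thesis by (rule finite_dimensionalI[OF C(1)])
qed

text \<open>Rank plus nullity without dimensions: preimages of a spanning set of the image, together
  with a spanning set of the kernel, span \<open>X\<close>.\<close>

lemma finite_dimensional_extension:
  fixes X :: "'a::chilbert_space set" and T :: "'a \<Rightarrow> 'a"
  assumes X: "csubspace X"
    and add: "\<And>x y. x \<in> X \<Longrightarrow> y \<in> X \<Longrightarrow> T (x + y) = T x + T y"
    and scale: "\<And>c x. x \<in> X \<Longrightarrow> T (c *\<^sub>C x) = c *\<^sub>C T x"
    and im: "finite_dimensional (T ` X)" and ker: "finite_dimensional {x\<in>X. T x = 0}"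
  shows "finite_dimensional X"
proof -
  obtain B where B: "finite B" "B \<subseteq> T ` X" "T ` X \<subseteq> cspan B"
    using finite_dimensional_basis[OF im] by metis
  obtain C where C: "finite C" "C \<subseteq> X" "B = T ` C" using B finite_subset_image by metis
  obtain K where K: "finite K" "{x\<in>X. T x = 0} \<subseteq> cspan K"
    using ker by (auto simp: finite_dimensional_def)
  have Tspan: "s \<in> X \<and> T s \<in> cspan B" if "s \<in> cspan C" for s
    using that C B X complex_vector.span_minimal by blast
  have "\<exists>s\<in>cspan C. T s = t" if "t \<in> cspan (T ` C)" for t
    using that
  proof (induction rule: complex_vector.span_induct_alt)
    case base
    have "T 0 = 0" using scale[of 0 0] complex_vector.subspace_0[OF X] by simp
    then show ?case using complex_vector.span_zero by blast
  next
    case (step c x y)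
    then obtain s b where s: "s \<in> cspan C" "T s = y" and b: "b \<in> C" "x = T b" by auto
    have "T (c *\<^sub>C b + s) = c *\<^sub>C x + y"
      using s b C X Tspan by (subst add) (auto simp: scale complex_vector.subspace_scale)
    moreover have "c *\<^sub>C b + s \<in> cspan C"
      using s b complex_vector.span_add complex_vector.span_base complex_vector.span_scale by blast
    ultimately show ?case by blast
  qed
  then have lift: "\<exists>s\<in>cspan C. T s = T x" if "x \<in> X" for x using that B(3) C(3) by blast
  have "X \<subseteq> cspan (C \<union> K)"
  proof
    fix x assume x: "x \<in> X"
    obtain s where s: "s \<in> cspan C" "T s = T x" using lift[OF x] by auto
    have sX: "s \<in> X" using Tspan s by blast
    have "T (x - s) = T x - T s"
      using add[of x "(-1) *\<^sub>C s"] scale[of s "-1"] x sX X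
      by (simp add: complex_vector.subspace_neg complex_vector.scale_minus_left)
    then have "x - s \<in> cspan K" using K x sX X s by (auto simp: complex_vector.subspace_diff)
    then have "s + (x - s) \<in> cspan (C \<union> K)" using s(1)
      by (metis complex_vector.span_add complex_vector.span_mono subsetD sup_ge1 sup_ge2)
    then show "x \<in> cspan (C \<union> K)" by simp
  qed
  then show ?thesis using C(1) K(1) finite_dimensionalI by blast
qed

section \<open>Convex sequences and finite extensions of closed subspaces\<close>

text \<open>Choose \<open>c n\<close> of almost minimal norm in \<open>C n\<close>. The minimal
  squared norms \<open>s n\<close> increase and are bounded, hence form a Cauchy sequence, and the
  parallelogram law passes this on to \<open>c\<close>. The limit need not lie in any
  \<open>C n\<close>; applications pass to the limit in closed conditions instead.\<close>

lemma nested_convex_convergent: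
  fixes C :: "nat \<Rightarrow> 'b::{real_inner,complete_space} set"
  assumes conv: "\<And>n. convex (C n)" and ne: "\<And>n. C n \<noteq> {}"
    and anti: "antimono C" and bound: "\<And>n. C n \<subseteq> cball 0 K"
  obtains c l where "\<And>n. c n \<in> C n" "c \<longlonglongrightarrow> l"
proof -
  note dec = antimonoD[OF anti]
  have bd: "norm x \<le> K" if "x \<in> C n" for n x using bound that by (auto simp: subset_iff)
  define s where "s n = (INF x\<in>C n. (norm x)\<^sup>2)" for n
  have bb: "bdd_below ((\<lambda>x. (norm x)\<^sup>2) ` C n)" for n by (rule bdd_belowI[of _ 0]) auto
  have s_le: "s n \<le> (norm x)\<^sup>2" if "x \<in> C n" for n x
    unfolding s_def using that by (intro cINF_lower[OF bb]) auto
  have "\<exists>x\<in>C n. (norm x)\<^sup>2 < s n + 1 / Suc n" for n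
  proof (rule ccontr)
    assume "\<not> (\<exists>x\<in>C n. (norm x)\<^sup>2 < s n + 1 / Suc n)"
    then have "s n + 1 / Suc n \<le> s n" unfolding s_def[of n]
      by (intro cINF_greatest[OF ne]) (auto simp: not_less s_def)
    moreover have "0 < 1 / real (Suc n)" by simp
    ultimately show False by linarith
  qed
  then obtain c where c: "\<And>n. c n \<in> C n" "\<And>n. (norm (c n))\<^sup>2 < s n + 1 / Suc n" by metis
  have s_mono: "s m \<le> s n" if "m \<le> n" for m n
    unfolding s_def using dec[OF that] by (intro cINF_superset_mono[OF ne bb]) auto
  have "s n \<le> K\<^sup>2" for n
    using s_le[OF c(1)] bd[OF c(1)] by (meson norm_ge_zero order_trans power_mono)
  then have "bdd_above (range s)" by (intro bdd_aboveI) auto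
  then have "convergent s"
    using s_mono LIMSEQ_incseq_SUP[of s] by (auto simp: convergent_def incseq_def)
  then have Cs: "Cauchy s" by (rule convergent_Cauchy)
  have key: "(norm (c m - c n))\<^sup>2 \<le> 2 * (s n - s m) + 2 * (1 / Suc m) + 2 * (1 / Suc n)" if mn: "m \<le> n" for m n
  proof -
    \<comment> \<open>Both points lie in the larger set \<open>C m\<close>, so their midpoint has
      squared norm at least \<open>s m\<close>; the parallelogram law turns this into a bound for
      the difference.\<close>
    have "(1/2) *\<^sub>R c m + (1/2) *\<^sub>R c n \<in> C m"
      using conv[of m] c(1) dec[OF mn] by (intro convexD) auto
    then have "s m \<le> (norm ((1/2) *\<^sub>R c m + (1/2) *\<^sub>R c n))\<^sup>2" by (rule s_le)
    also have "\<dots> = (norm (c m + c n))\<^sup>2 / 4"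
      unfolding scaleR_add_right[symmetric] by (simp add: power_divide)
    finally have "4 * s m \<le> (norm (c m + c n))\<^sup>2" by simp
    moreover have "(norm (c m + c n))\<^sup>2 + (norm (c m - c n))\<^sup>2 = 2 * (norm (c m))\<^sup>2 + 2 * (norm (c n))\<^sup>2"
      by (simp add: power2_norm_eq_inner inner_add_left inner_add_right inner_diff_left inner_diff_right inner_commute)
    moreover have "(norm (c m))\<^sup>2 \<le> s m + 1 / Suc m" "(norm (c n))\<^sup>2 \<le> s n + 1 / Suc n"
      using c(2)[of m] c(2)[of n] by auto
    ultimately show ?thesis by argo
  qed
  have "Cauchy c"
  proof (rule metric_CauchyI)
    fix e :: real assume e: "0 < e"
    \<comment> \<open>The bound in \<open>key\<close> is a sum of three quantities, each with weight
      2, so each is made smaller than \<open>e\<^sup>2 / 6\<close>.\<close>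
    then have e2: "0 < e\<^sup>2 / 6" by simp
    obtain N1 where N1: "\<And>m n. m \<ge> N1 \<Longrightarrow> n \<ge> N1 \<Longrightarrow> dist (s m) (s n) < e\<^sup>2 / 6"
      using Cs e2 unfolding Cauchy_def by metis
    obtain N2 where N2: "inverse (real (Suc N2)) < e\<^sup>2 / 6" using reals_Archimedean[OF e2] by auto
    have less: "dist (c m) (c n) < e" if mn: "m \<le> n" "m \<ge> max N1 N2" for m n
    proof -
      have "1 / real (Suc m) \<le> inverse (real (Suc N2))" "1 / real (Suc n) \<le> inverse (real (Suc N2))"
        using mn by (auto simp: field_simps)
      moreover have "s n - s m < e\<^sup>2 / 6" using N1[of m n] mn unfolding dist_real_def by linarith
      moreover have "a < e\<^sup>2"
        if "x \<le> z" "y \<le> z" "z < e\<^sup>2 / 6" "t < e\<^sup>2 / 6" "a \<le> 2 * t + 2 * x + 2 * y" for a t x y z :: real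
        using that by linarith
      ultimately have "(norm (c m - c n))\<^sup>2 < e\<^sup>2" using key[OF mn(1)] N2 by metis
      then show ?thesis using e by (simp add: dist_norm power_less_imp_less_base)
    qed
    show "\<exists>M. \<forall>m\<ge>M. \<forall>n\<ge>M. dist (c m) (c n) < e"
    proof (intro exI[of _ "max N1 N2"] allI impI)
      fix m n assume "max N1 N2 \<le> m" "max N1 N2 \<le> n"
      then show "dist (c m) (c n) < e"
        using less[of m n] less[of n m] by (cases "m \<le> n") (auto simp: dist_commute)
    qed
  qed
  then obtain l where "c \<longlonglongrightarrow> l" using Cauchy_convergent convergent_def by blast
  then show thesis using that c(1) by blast
qed

text \<open>Convergence is carried back along a lower bound: \<open>f\<close> is the image sequence
  of \<open>x\<close> under a map bounded below, or \<open>x\<close> the image of \<open>f\<close>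
  under a bounded one.\<close>

lemma convergent_if_dist_le:
  fixes x :: "nat \<Rightarrow> 'b::complete_space" and f :: "nat \<Rightarrow> 'c::metric_space"
  assumes f: "Cauchy f" and C: "C > 0" and le: "\<And>m n. dist (x m) (x n) \<le> C * dist (f m) (f n)"
  obtains l where "x \<longlonglongrightarrow> l"
proof -
  have "Cauchy x"
  proof (rule metric_CauchyI)
    fix e :: real assume "0 < e"
    then obtain N where N: "\<And>m n. m \<ge> N \<Longrightarrow> n \<ge> N \<Longrightarrow> dist (f m) (f n) < e / C"
      using f C unfolding Cauchy_def by (metis divide_pos_pos)
    have "dist (x m) (x n) < e" if mn: "m \<ge> N" "n \<ge> N" for m n
    proof -
      have "C * dist (f m) (f n) < e" using N[OF mn] C by (simp add: field_simps)
      then show ?thesis using le[of m n] by linarith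
    qed
    then show "\<exists>N. \<forall>m\<ge>N. \<forall>n\<ge>N. dist (x m) (x n) < e" by blast
  qed
  then show thesis using that Cauchy_convergent convergent_def by blast
qed

text \<open>Some ball of radius \<open>d\<close> around \<open>b\<close> misses \<open>E\<close>;
  dividing \<open>e + t *\<^sub>R b\<close> by \<open>t\<close> shows that \<open>M = 1 / d\<close>
  works.\<close>

lemma bounded_coefficients:
  fixes E :: "'b::real_normed_vector set"
  assumes E: "subspace E" "closed E" and b: "b \<notin> E"
  obtains M where "\<And>e t. e \<in> E \<Longrightarrow> \<bar>t\<bar> \<le> M * norm (e + t *\<^sub>R b)"
proof -
  have "open (- E)" "b \<in> - E" using E b by (auto simp: open_Compl)
  then obtain d where d: "d > 0" "ball b d \<subseteq> - E" by (metis open_contains_ball)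
  have "\<bar>t\<bar> \<le> (1/d) * norm (e + t *\<^sub>R b)" if e: "e \<in> E" for e t
  proof (cases "t = 0")
    case False
    have "(-1/t) *\<^sub>R e \<in> E" using e E subspace_scale by blast
    then have "(-1/t) *\<^sub>R e \<notin> ball b d" using d by blast
    then have "d \<le> norm (b - (-1/t) *\<^sub>R e)" by (simp add: dist_norm not_less)
    also have "b - (-1/t) *\<^sub>R e = (1/t) *\<^sub>R (e + t *\<^sub>R b)" using False by (simp add: scaleR_add_right)
    also have "norm \<dots> = norm (e + t *\<^sub>R b) / \<bar>t\<bar>" by simp
    finally show ?thesis using False d by (simp add: field_simps)
  qed (use d in simp)
  then show thesis using that by blast
qed

lemma closed_span_insert:
  fixes E :: "'b::real_normed_vector set"
  assumes E: "subspace E" "closed E"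
  shows "closed (span (insert b E))"
proof (cases "b \<in> E")
  case True
  then show ?thesis using E by (simp add: insert_absorb span_eq_iff[THEN iffD2])
next
  case False
  obtain M where M: "\<And>e t. e \<in> E \<Longrightarrow> \<bar>t\<bar> \<le> M * norm (e + t *\<^sub>R b)"
    using bounded_coefficients[OF E False] by blast
  have spE: "span E = E" using E by (simp add: span_eq_iff)
  have "M \<ge> 0" using M[of 0 1] E(1) by (smt (verit) mult_nonpos_nonneg norm_ge_zero subspace_0)
  show ?thesis unfolding closed_sequential_limits
  proof (intro allI impI, elim conjE)
    fix x l assume x: "\<forall>n. x n \<in> span (insert b E)" and l: "x \<longlonglongrightarrow> l"
    then have "\<exists>k. x n - k *\<^sub>R b \<in> E" for n by (simp add: span_breakdown_eq spE)
    then obtain t where t: "\<And>n. x n - t n *\<^sub>R b \<in> E" by metis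
    obtain R where R: "\<And>n. norm (x n) \<le> R"
      using convergent_imp_Bseq[of x] l by (auto simp: convergent_def Bseq_def)
    have "\<bar>t n\<bar> \<le> M * R" for n
      using M[OF t[of n], of "t n"] mult_left_mono[OF R \<open>M \<ge> 0\<close>, of n] by (simp add: order_trans)
    then have "bounded (range t)" by (auto simp: bounded_iff)
    then obtain r k where r: "strict_mono r" "(t \<circ> r) \<longlonglongrightarrow> k"
      using bounded_imp_convergent_subsequence by metis
    have "(\<lambda>n. x (r n) - t (r n) *\<^sub>R b) \<longlonglongrightarrow> l - k *\<^sub>R b"
      using LIMSEQ_subseq_LIMSEQ[OF l r(1)] r(2) by (intro tendsto_intros) (auto simp: o_def)
    then have "l - k *\<^sub>R b \<in> E" using t[of "r _"] by (rule closed_sequentially[OF E(2), rotated])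
    then show "l \<in> span (insert b E)" by (auto simp: span_breakdown_eq spE)
  qed
qed

text \<open>Bolzano-Weierstrass modulo a closed subspace: the finitely many coordinates outside
  \<open>E\<close> converge along a subsequence, so that the sequence asymptotically stays in one
  coset \<open>l + E\<close>.\<close>

lemma bounded_sequence_mod_finite:
  fixes E :: "'b::real_normed_vector set" and x :: "nat \<Rightarrow> 'b"
  assumes "finite B" "subspace E" "closed E" "\<And>n. x n \<in> span (E \<union> B)" "\<And>n. norm (x n) \<le> R"
  shows "\<exists>r g l. strict_mono (r::nat\<Rightarrow>nat) \<and> g \<longlonglongrightarrow> l \<and> (\<forall>n. x (r n) - g n \<in> E)"
  using assms
proof (induction B arbitrary: E rule: finite_induct)
  case empty
  then have "\<forall>n. x (id n) - 0 \<in> E" by (simp add: span_eq_iff[THEN iffD2])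
  then show ?case
    by (intro exI[of _ id] exI[of _ "\<lambda>_. 0"] exI[of _ 0]) (auto simp: strict_mono_def)
next
  case (insert b B)
  \<comment> \<open>The induction hypothesis is used with \<open>E\<close> enlarged by
    \<open>b\<close>; what remains is the scalar coordinate of \<open>b\<close>, which is bounded
    and yields one more subsequence.\<close>
  let ?E = "span (insert b E)"
  have spE: "span E = E" using insert.prems by (simp add: span_eq_iff)
  have "insert b E \<union> B \<subseteq> ?E \<union> B" using span_superset[of "insert b E"] by blast
  then have "span (E \<union> insert b B) \<subseteq> span (?E \<union> B)" by (intro span_mono) auto
  then have 1: "x n \<in> span (?E \<union> B)" for n using insert.prems(3) by blast
  obtain r g l where r: "strict_mono (r::nat\<Rightarrow>nat)" "g \<longlonglongrightarrow> l" "\<And>n. x (r n) - g n \<in> ?E"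
    using insert.IH[OF subspace_span closed_span_insert[OF insert.prems(1,2)] 1 insert.prems(4)] by blast
  show ?case
  proof (cases "b \<in> E")
    case True
    then have "?E = E" using spE by (simp add: insert_absorb)
    then show ?thesis using r by auto
  next
    case False
    obtain M where M: "\<And>e t. e \<in> E \<Longrightarrow> \<bar>t\<bar> \<le> M * norm (e + t *\<^sub>R b)"
      using bounded_coefficients[OF insert.prems(1,2) False] by blast
    have "M \<ge> 0" using M[of 0 1] insert.prems(1) by (smt (verit) mult_nonpos_nonneg norm_ge_zero subspace_0)
    have "\<exists>k. (x (r n) - g n) - k *\<^sub>R b \<in> E" for n using r(3)[of n] spE by (simp add: span_breakdown_eq)
    then obtain t where t: "\<And>n. (x (r n) - g n) - t n *\<^sub>R b \<in> E" by metis
    obtain R' where R': "\<And>n. norm (g n) \<le> R'"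
      using convergent_imp_Bseq[of g] r(2) by (auto simp: convergent_def Bseq_def)
    have "\<bar>t n\<bar> \<le> M * (R + R')" for n
    proof -
      have "norm (x (r n) - g n) \<le> R + R'"
        using norm_triangle_ineq4[of "x (r n)" "g n"] R'[of n] insert.prems(4)[of "r n"] by linarith
      then show ?thesis using M[OF t[of n], of "t n"] mult_left_mono[OF _ \<open>M \<ge> 0\<close>] by fastforce
    qed
    then have "bounded (range t)" by (auto simp: bounded_iff)
    then obtain q k where q: "strict_mono q" "(t \<circ> q) \<longlonglongrightarrow> k"
      using bounded_imp_convergent_subsequence by metis
    have "(\<lambda>n. g (q n) + t (q n) *\<^sub>R b) \<longlonglongrightarrow> l + k *\<^sub>R b"
      using LIMSEQ_subseq_LIMSEQ[OF r(2) q(1)] q(2) by (intro tendsto_intros) (auto simp: o_def)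
    moreover have "x ((r \<circ> q) n) - (g (q n) + t (q n) *\<^sub>R b) \<in> E" for n
      using t[of "q n"] by (simp add: diff_diff_eq)
    ultimately show ?thesis using strict_mono_o[OF r(1) q(1)] by blast
  qed
qed

text \<open>The complex span of \<open>B\<close> is the real span of \<open>B\<close> and its
  multiples by \<i>, so the real statement on adjoining one vector applies repeatedly.\<close>

lemma finite_dimensional_closed:
  fixes L :: "'a::chilbert_space set"
  assumes "csubspace L" "finite_dimensional L"
  shows "closed L"
proof -
  obtain B where B: "finite B" "B \<subseteq> L" "L \<subseteq> cspan B"
    using finite_dimensional_basis[OF assms(2)] by metis
  have "closed (span S)" if "finite S" for S :: "'a set"
    using that
  proof (induction S)
    case (insert b S)
    have "span (insert b S) = span (insert b (span S))"
      by (auto simp: span_breakdown_eq span_span)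
    then show ?case using closed_span_insert[OF subspace_span insert.IH] by simp
  qed simp
  then have "closed (span (B \<union> (*\<^sub>C) \<i> ` B))" using B(1) by simp
  moreover have "span (B \<union> (*\<^sub>C) \<i> ` B) = L"
  proof
    have "B \<union> (*\<^sub>C) \<i> ` B \<subseteq> L" 
      using B(2) by (auto intro: complex_vector.subspace_scale[OF assms(1)])
    then show "span (B \<union> (*\<^sub>C) \<i> ` B) \<subseteq> L"
      by (rule span_minimal[OF _ csubspace_imp_subspace[OF assms(1)]])
    have "x \<in> span (B \<union> (*\<^sub>C) \<i> ` B)" if "x \<in> cspan B" for x
      using that
    proof (induction rule: complex_vector.span_induct_alt)
      case (step c x y)
      then have "x \<in> span (B \<union> (*\<^sub>C) \<i> ` B)" "\<i> *\<^sub>C x \<in> span (B \<union> (*\<^sub>C) \<i> ` B)"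
        by (auto intro: span_base)
      then show ?case using step by (subst scaleC_complex_split) (intro span_add span_scale)
    qed (rule span_zero)
    then show "L \<subseteq> span (B \<union> (*\<^sub>C) \<i> ` B)" using B(3) by blast
  qed
  ultimately show ?thesis by simp
qed

section \<open>The indefinite inner product\<close>

text \<open>The factor 2 comes from estimating real and imaginary part separately; it suffices for
  continuity of the form.\<close>

lemma norm_cinner_le: "cmod (cinner x y) \<le> norm x * norm y * 2" for x :: "'a::chilbert_space"
proof -
  have "\<bar>Re (cinner x y)\<bar> \<le> norm x * norm y" "\<bar>Im (cinner x y)\<bar> \<le> norm x * norm y"
    using Cauchy_Schwarz_ineq2[of x y] Cauchy_Schwarz_ineq2[of x "\<i> *\<^sub>C y"]
    by (simp_all add: cinner_eq_inner norm_scaleC)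
  then show ?thesis using cmod_le[of "cinner x y"] by linarith
qed

lemma bounded_bilinear_cinner: "bounded_bilinear (cinner :: 'a::chilbert_space \<Rightarrow> 'a \<Rightarrow> complex)"
  by (rule bounded_bilinear.intro)
    (auto simp: cinner_add_left cinner_add_right scaleR_scaleC[where 'a='a] cinner_scaleC_left
      cinner_scaleC_right scaleR_conv_of_real intro!: norm_cinner_le)

text \<open>Neither sequence has to converge. Expanding in \<open>y n - x n\<close>, every term has
  this null sequence as a factor and a bounded second factor.\<close>

lemma bilinear_diagonal_tendsto:
  fixes b :: "'a::real_normed_vector \<Rightarrow> 'a \<Rightarrow> 'b::real_normed_vector"
  assumes b: "bounded_bilinear b" and x: "\<And>n. norm (x n) \<le> R" and yx: "(\<lambda>n. y n - x n) \<longlonglongrightarrow> 0"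
  shows "(\<lambda>n. b (y n) (y n) - b (x n) (x n)) \<longlonglongrightarrow> 0"
proof -
  interpret bounded_bilinear b by (rule b)
  have Z: "Zfun (\<lambda>n. y n - x n) sequentially" using yx by (simp add: tendsto_Zfun_iff)
  have Bx: "Bfun x sequentially" using x by (intro BfunI[where K=R]) auto
  have "Zfun (\<lambda>n. b (x n) (y n - x n) + (b (y n - x n) (y n - x n) + b (y n - x n) (x n))) sequentially"
    by (intro Zfun_add Bfun_prod_Zfun[OF Bx Z] Zfun_prod_Bfun[OF Z Bx] Zfun[OF Z Z])
  moreover have "(\<lambda>n. b (x n) (y n - x n) + (b (y n - x n) (y n - x n) + b (y n - x n) (x n))) =
      (\<lambda>n. b (y n) (y n) - b (x n) (x n))"
    by (simp add: diff_left diff_right)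
  ultimately show ?thesis by (simp add: tendsto_Zfun_iff)
qed

lemma quadratic_bound:
  fixes a b c u :: real
  assumes "a > 0" "b \<ge> 0" "c \<ge> 0" "a * u\<^sup>2 \<le> b + c * u"
  shows "u \<le> (b + c) / a + 1"
proof (rule ccontr)
  assume "\<not> u \<le> (b + c) / a + 1"
  then have u: "u > (b + c) / a + 1" by simp
  then have u1: "u \<ge> 1" using assms by (smt (verit) divide_nonneg_pos)
  have "b \<le> b * u" using u1 assms by (simp add: mult_le_cancel_left1)
  then have "(a * u) * u \<le> (b + c) * u" using assms(4) by (simp add: power2_eq_square algebra_simps)
  then have "a * u \<le> b + c" using u1 by simp
  then have "u \<le> (b + c) / a" using assms by (simp add: field_simps)
  then show False using u by simp
qed

text \<open>First-order condition at a minimum. With \<open>t = s * a\<close> and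
  \<open>s * \<bar>b\<bar> \<le> 1\<close> the quadratic term can absorb at most half of the linear
  one.\<close>

lemma linear_term_zero:
  fixes a b :: real
  assumes "\<And>t. 2 * t * a \<le> t\<^sup>2 * b"
  shows "a = 0"
proof -
  define s where "s = 1 / (\<bar>b\<bar> + 1)"
  have s: "s > 0" "s * \<bar>b\<bar> \<le> 1" by (auto simp: s_def field_simps)
  have "2 * (s * a) * a \<le> (s * a)\<^sup>2 * b" by (rule assms)
  also have "\<dots> \<le> (s * a)\<^sup>2 * \<bar>b\<bar>" by (intro mult_left_mono) auto
  also have "\<dots> = (s * \<bar>b\<bar>) * (s * a\<^sup>2)" by (simp add: power2_eq_square)
  also have "\<dots> \<le> 1 * (s * a\<^sup>2)" using s by (intro mult_right_mono) auto
  finally have "s * a\<^sup>2 \<le> 0" by (simp add: power2_eq_square mult.commute mult.left_commute)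
  then show ?thesis using s by (simp add: mult_le_0_iff)
qed

lemma linear_operatorD:
  assumes "linear_operator D T"
  shows "csubspace D" "\<And>x y. x \<in> D \<Longrightarrow> y \<in> D \<Longrightarrow> T (x + y) = T x + T y"
    "\<And>c x. x \<in> D \<Longrightarrow> T (c *\<^sub>C x) = c *\<^sub>C T x" "T 0 = 0"
    "\<And>x y. x \<in> D \<Longrightarrow> y \<in> D \<Longrightarrow> T (x - y) = T x - T y"
    "\<And>r x. x \<in> D \<Longrightarrow> T (r *\<^sub>R x) = r *\<^sub>R T x"
proof -
  show D: "csubspace D" and add: "\<And>x y. x \<in> D \<Longrightarrow> y \<in> D \<Longrightarrow> T (x + y) = T x + T y"
    and sc: "\<And>c x. x \<in> D \<Longrightarrow> T (c *\<^sub>C x) = c *\<^sub>C T x"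
    using assms by (auto simp: linear_operator_def)
  show "T 0 = 0" using sc[of 0 0] complex_vector.subspace_0[OF D] by simp
  show "T (x - y) = T x - T y" if "x \<in> D" "y \<in> D" for x y
    using add[of x "(-1) *\<^sub>C y"] sc[of y "-1"] that D
    by (simp add: complex_vector.subspace_neg complex_vector.scale_minus_left)
  show "T (r *\<^sub>R x) = r *\<^sub>R T x" if "x \<in> D" for r x using sc[OF that] by (simp add: scaleR_scaleC)
qed

lemma closed_operatorD:
  assumes "closed_operator D T" "\<And>n. x n \<in> D" "x \<longlonglongrightarrow> l" "(\<lambda>n. T (x n)) \<longlonglongrightarrow> m"
  shows "l \<in> D" "T l = m"
proof -
  have "(l, m) \<in> (\<lambda>x. (x, T x)) ` D"
    using assms(1,2) unfolding closed_operator_def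
    by (intro closed_sequentially[OF _ _ tendsto_Pair[OF assms(3,4)]]) auto
  then show "l \<in> D" "T l = m" by auto
qed

lemma closed_operator_restrict:
  assumes "closed_operator D T" "closed_csubspace W"
  shows "closed_operator (D \<inter> W) T"
  unfolding closed_operator_def
proof
  have lin: "linear_operator D T" using assms(1) by (simp add: closed_operator_def)
  then show "linear_operator (D \<inter> W) T"
    using complex_vector.subspace_inter[of D W] assms(2)
    by (auto simp: linear_operator_def closed_csubspace_def)
  have "(\<lambda>x. (x, T x)) ` (D \<inter> W) = (\<lambda>x. (x, T x)) ` D \<inter> (W \<times> UNIV)" by auto
  then show "closed ((\<lambda>x. (x, T x)) ` (D \<inter> W))"
    using assms by (auto simp: closed_operator_def closed_csubspace_def intro!: closed_Int closed_Times)
qed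

section \<open>The form \<open>[x,y] = (Gx,y)\<close> and projections onto uniformly positive
  subspaces\<close>

locale indefinite =
  fixes G :: "'a::chilbert_space \<Rightarrow> 'a"
  assumes sa: "bounded_selfadjoint G"
begin

abbreviation q :: "'a \<Rightarrow> real" where "q x \<equiv> Re (gip G x x)"

lemma bounded_bilinear_gip: "bounded_bilinear (gip G)"
  using bounded_bilinear.comp1[OF bounded_bilinear_cinner, of G] sa
  by (simp add: gip_def[abs_def] bounded_selfadjoint_def)

sublocale gip: bounded_bilinear "gip G" by (rule bounded_bilinear_gip)

lemma gip_scale_left [simp]: "gip G (c *\<^sub>C x) y = c * gip G x y"
  using sa by (simp add: gip_def bounded_selfadjoint_def cinner_scaleC_left)

lemma gip_scale_right [simp]: "gip G x (c *\<^sub>C y) = cnj c * gip G x y"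
  by (simp add: gip_def cinner_scaleC_right)

lemma gip_cnj: "cnj (gip G x y) = gip G y x"
  using sa unfolding gip_def bounded_selfadjoint_def by (metis cinner_commute)

lemma gip_zero_commute: "gip G x y = 0 \<longleftrightarrow> gip G y x = 0"
  using gip_cnj[of x y] by (auto simp: complex_eq_iff)

lemma gip_self: "gip G x x = complex_of_real (q x)"
  using gip_cnj[of x x] by (simp add: complex_eq_iff)

lemma Re_gip_commute: "Re (gip G x y) = Re (gip G y x)"
  using gip_cnj[of x y] by (simp add: complex_eq_iff)

lemma q_add: "q (x + y) = q x + 2 * Re (gip G x y) + q y"
  using Re_gip_commute[of x y] by (simp add: gip.add_left gip.add_right)

lemma q_diff: "q (x - y) = q x - 2 * Re (gip G x y) + q y"
  using Re_gip_commute[of x y] by (simp add: gip.diff_left gip.diff_right)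

lemma q_scaleR [simp]: "q (r *\<^sub>R x) = r\<^sup>2 * q x"
  by (simp add: gip.scaleR_left gip.scaleR_right power2_eq_square)

lemma q_scaleC: "q (c *\<^sub>C x) = (cmod c)\<^sup>2 * q x"
proof -
  have "gip G (c *\<^sub>C x) (c *\<^sub>C x) = (c * cnj c) * gip G x x" by simp
  also have "c * cnj c = complex_of_real ((cmod c)\<^sup>2)" by (rule complex_norm_square[symmetric])
  finally show ?thesis by (simp only: Re_complex_of_real times_complex.sel Im_complex_of_real)
qed

lemma q_zero [simp]: "q 0 = 0" by (simp add: gip.zero_left)

lemma q_bound: obtains K where "K > 0" "\<And>x y. cmod (gip G x y) \<le> norm x * norm y * K"
  using gip.pos_bounded by metis

lemma tendsto_q: "(f \<longlongrightarrow> l) F \<Longrightarrow> ((\<lambda>x. q (f x)) \<longlongrightarrow> q l) F"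
  by (intro tendsto_Re gip.tendsto)

text \<open>Minimise \<open>h p = q (x - p)\<close> over \<open>P\<close>. Uniform positivity on
  \<open>P\<close> makes \<open>h\<close> convex and coercive there, so its sublevel sets are
  nested, bounded and convex and a minimising sequence can be chosen convergent; the vanishing first
  variation is the orthogonality.\<close>

lemma gip_projection:
  assumes P: "closed_csubspace P" and d: "d > 0" "\<And>x. x \<in> P \<Longrightarrow> d * (norm x)\<^sup>2 \<le> q x"
  shows "\<exists>p\<in>P. \<forall>n\<in>P. gip G (x - p) n = 0"
proof -
  obtain K where K: "K > 0" "\<And>x y. cmod (gip G x y) \<le> norm x * norm y * K" using q_bound by metis
  have cP: "csubspace P" and clP: "closed P" using P by (auto dest: closed_csubspaceD)
  define h where "h p = q (x - p)" for p
  define m where "m = Inf (h ` P)"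
  have est: "d * (norm p)\<^sup>2 \<le> h p + K * (norm x)\<^sup>2 + 2 * K * norm x * norm p" if "p \<in> P" for p
  proof -
    have "\<bar>Re (gip G x p)\<bar> \<le> norm x * norm p * K" "\<bar>q x\<bar> \<le> norm x * norm x * K"
      using K(2)[of x p] K(2)[of x x] abs_Re_le_cmod order_trans by blast+
    then show ?thesis using d(2)[OF that] unfolding h_def q_diff
      by (simp add: power2_eq_square algebra_simps abs_le_iff)
  qed
  \<comment> \<open>Completing the square in \<open>norm p\<close> in the estimate
    \<open>est\<close>.\<close>
  have lower: "- (K * (norm x)\<^sup>2 + (K * norm x)\<^sup>2 / d) \<le> h p" if "p \<in> P" for p
  proof -
    have "0 \<le> (d * norm p - K * norm x)\<^sup>2 / d" using d by simp
    also have "\<dots> = d * (norm p)\<^sup>2 - 2 * K * norm x * norm p + (K * norm x)\<^sup>2 / d"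
      using d by (simp add: power2_eq_square field_simps)
    finally show ?thesis using est[OF that] by linarith
  qed
  have bb: "bdd_below (h ` P)" using lower by (auto intro!: bdd_belowI)
  have P0: "0 \<in> P" by (rule complex_vector.subspace_0[OF cP])
  have m_le: "m \<le> h p" if "p \<in> P" for p unfolding m_def using bb that by (auto intro: cINF_lower)
  define C where "C n = {p \<in> P. h p \<le> m + 1 / real (Suc n)}" for n
  have "\<exists>p\<in>P. h p < m + 1 / real (Suc n)" for n
  proof (rule ccontr)
    assume "\<not> (\<exists>p\<in>P. h p < m + 1 / real (Suc n))"
    then have "m + 1 / real (Suc n) \<le> m" unfolding m_def
      using P0 by (intro cINF_greatest) (auto simp: not_less m_def)
    moreover have "0 < 1 / real (Suc n)" by simp
    ultimately show False by linarith
  qed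
  then have Cne: "C n \<noteq> {}" for n unfolding C_def by (fastforce intro: less_imp_le)
  have Cconv: "convex (C n)" for n
  proof (rule convexI)
    fix p p' and u v :: real assume p: "p \<in> C n" "p' \<in> C n" and uv: "0 \<le> u" "0 \<le> v" "u + v = 1"
    have inP: "u *\<^sub>R p + v *\<^sub>R p' \<in> P" "p - p' \<in> P"
      using p cP by (auto simp: C_def complex_vector.subspace_add scaleR_in_csubspace complex_vector.subspace_diff)
    have v: "v = 1 - u" using uv by simp
    \<comment> \<open>The convexity defect involves only \<open>p - p'\<close>, which lies in
      \<open>P\<close> although \<open>x\<close> does not; there \<open>q\<close> is
      nonnegative.\<close>
    have "h (u *\<^sub>R p + v *\<^sub>R p') = u * h p + v * h p' - u * v * q (p - p')"
      unfolding h_def q_diff q_add q_scaleR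
      unfolding gip.add_right gip.scaleR_left gip.scaleR_right v
      by (simp add: algebra_simps power2_eq_square)
    also have "\<dots> \<le> u * h p + v * h p'"
      using uv d(2)[OF inP(2)] by (smt (verit) d(1) mult_nonneg_nonneg zero_le_power2)
    also have "\<dots> \<le> u * (m + 1 / real (Suc n)) + v * (m + 1 / real (Suc n))"
      using p uv by (intro add_mono mult_left_mono) (auto simp: C_def)
    also have "\<dots> = m + 1 / real (Suc n)" using uv by (simp add: distrib_right[symmetric])
    finally show "u *\<^sub>R p + v *\<^sub>R p' \<in> C n" using inP by (simp add: C_def)
  qed
  have Cdec: "C n \<subseteq> C k" if "k \<le> n" for k n
  proof -
    have "1 / real (Suc n) \<le> 1 / real (Suc k)" using that by (intro divide_left_mono) auto
    then show ?thesis by (auto simp: C_def)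
  qed
  define b where "b = \<bar>m + 1\<bar> + K * (norm x)\<^sup>2"
  have Cbd: "norm p \<le> (b + 2 * K * norm x) / d + 1" if "p \<in> C n" for p n
  proof (rule quadratic_bound)
    have "h p \<le> m + 1" using Cdec[of 0 n] that by (auto simp: C_def)
    then show "d * (norm p)\<^sup>2 \<le> b + 2 * K * norm x * norm p"
      using est[of p] that unfolding b_def by (auto simp: C_def)
  qed (use d K b_def in auto)
  have "antimono C" using Cdec by (rule antimonoI)
  moreover have "C n \<subseteq> cball 0 ((b + 2 * K * norm x) / d + 1)" for n using Cbd by auto
  ultimately obtain c p where c: "\<And>n. c n \<in> C n" "c \<longlonglongrightarrow> p"
    using nested_convex_convergent[of C, OF Cconv Cne] by blast
  have pP: "p \<in> P" using c by (intro closed_sequentially[OF clP _ c(2)]) (auto simp: C_def)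
  have "(\<lambda>n. h (c n)) \<longlonglongrightarrow> h p" unfolding h_def by (intro tendsto_q tendsto_intros c(2))
  moreover have "(\<lambda>n. m + 1 / real (Suc n)) \<longlonglongrightarrow> m + 0"
    by (intro tendsto_intros LIMSEQ_Suc lim_1_over_n)
  moreover have "h (c n) \<le> m + 1 / real (Suc n)" for n using c(1)[of n] by (simp add: C_def)
  ultimately have hp: "h p \<le> m" by (intro LIMSEQ_le[where Y="\<lambda>n. m + 1 / real (Suc n)"]) auto
  define w where "w = x - p"
  have Re0: "Re (gip G w n) = 0" if n: "n \<in> P" for n
  proof (rule linear_term_zero)
    fix t :: real
    have "p + t *\<^sub>R n \<in> P" using pP n cP by (simp add: complex_vector.subspace_add scaleR_in_csubspace)
    then have "h p \<le> h (p + t *\<^sub>R n)" using m_le hp order_trans by blast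
    then have "q w \<le> q (w - t *\<^sub>R n)" by (simp add: h_def w_def diff_diff_eq)
    then show "2 * t * Re (gip G w n) \<le> t\<^sup>2 * q n"
      unfolding q_diff[of w] q_scaleR by (simp add: gip.scaleR_right)
  qed
  \<comment> \<open>The variation controls real parts only; testing with the multiple of
    \<open>n\<close> by \<i> supplies the imaginary part.\<close>
  have "gip G w n = 0" if n: "n \<in> P" for n
    using Re0[OF n] Re0[OF complex_vector.subspace_scale[OF cP n, of \<i>]] by (simp add: complex_eq_iff)
  then show ?thesis using pP w_def by blast
qed

end

lemma bounded_selfadjoint_id: "bounded_selfadjoint (\<lambda>x::'a::chilbert_space. x)"
  by (simp add: bounded_selfadjoint_def bounded_linear_ident)

text \<open>The identity in the role of \<open>G\<close> is uniformly positive with constant 1, so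
  the variational argument covers the Hilbert space projection too.\<close>

lemma orthogonal_projection:
  fixes P :: "'a::chilbert_space set"
  assumes "closed_csubspace P"
  shows "\<exists>p\<in>P. \<forall>n\<in>P. cinner (x - p) n = 0"
proof -
  interpret indefinite "\<lambda>x::'a. x" by standard (rule bounded_selfadjoint_id)
  show ?thesis using gip_projection[OF assms, of 1 x]
    by (simp add: gip_def Re_cinner power2_norm_eq_inner)
qed

section \<open>Positivity on vectors close to the kernel\<close>

context indefinite begin

text \<open>The negated statement is used with \<open>e = d = 1 / (n + 1)\<close>; by homogeneity
  the resulting vectors can be normalised.\<close>

lemma near_kernel_counterexample:
  assumes lin: "linear_operator D T"
    and contra: "\<not> (\<exists>e>0. \<exists>d>0. \<forall>x\<in>D. norm (T x) \<le> e * norm x \<longrightarrow> d * (norm x)\<^sup>2 \<le> q x)"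
  obtains u where "\<And>n. u n \<in> D" "\<And>n. norm (u n) = 1" "(\<lambda>n. T (u n)) \<longlonglongrightarrow> 0"
    "\<And>n. norm (T (u n)) \<le> 1 / real (Suc n)" "\<And>n. q (u n) \<le> 1 / real (Suc n)"
proof -
  have "\<exists>x\<in>D. norm x = 1 \<and> norm (T x) \<le> 1 / real (Suc n) \<and> q x \<le> 1 / real (Suc n)" for n
  proof -
    have "0 < 1 / real (Suc n)" by simp
    then obtain x where x: "x \<in> D" "norm (T x) \<le> 1 / real (Suc n) * norm x"
      "q x < 1 / real (Suc n) * (norm x)\<^sup>2"
      using contra not_less by metis
    have "x \<noteq> 0" using x(3) by auto
    then have nx: "norm x > 0" by simp
    let ?y = "(1 / norm x) *\<^sub>R x"
    have "?y \<in> D" using scaleR_in_csubspace[OF linear_operatorD(1)[OF lin] x(1)] .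
    moreover have "norm ?y = 1" using nx by simp
    moreover have "norm (T ?y) \<le> 1 / real (Suc n)" using x nx by (simp add: linear_operatorD(6)[OF lin] field_simps)
    moreover have "q ?y \<le> 1 / real (Suc n)" using x nx by (simp add: power_divide field_simps)
    ultimately show ?thesis by blast
  qed
  then obtain u where u: "\<And>n. u n \<in> D" "\<And>n. norm (u n) = 1"
    "\<And>n. norm (T (u n)) \<le> 1 / real (Suc n)" "\<And>n. q (u n) \<le> 1 / real (Suc n)" by metis
  have "(\<lambda>n. T (u n)) \<longlonglongrightarrow> 0"
    by (rule Lim_null_comparison[OF _ LIMSEQ_Suc[OF lim_1_over_n]]) (use u(3) in auto)
  then show thesis using that u by blast
qed

text \<open>Positivity on the kernel upgrades to uniform positivity near it. A counterexample
  sequence is moved into one coset of a subspace \<open>E\<close> of the graph on which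
  \<open>\<Phi>\<close> is nonnegative. On this coset \<open>\<Phi>\<close> is convex, so its
  sublevel sets admit a convergent selection, and the limit is a kernel vector with
  \<open>\<Phi> \<le> - \<delta>\<close>: it is nonzero and \<open>q\<close> is nonpositive at
  it.\<close>

lemma uniformly_positive_near_kernel:
  assumes T: "closed_operator D T" and H: "csubspace H" "finite_codim H UNIV"
    and e: "\<epsilon> > 0" and d: "\<delta> > 0"
    and pos: "\<And>x. x \<in> D \<Longrightarrow> x \<in> H \<Longrightarrow> norm (T x) \<le> \<epsilon> * norm x \<Longrightarrow> \<delta> * (norm x)\<^sup>2 \<le> q x"
    and ker: "\<And>x. x \<in> D \<Longrightarrow> T x = 0 \<Longrightarrow> x \<noteq> 0 \<Longrightarrow> 0 < q x"
  shows "\<exists>e>0. \<exists>d>0. \<forall>x\<in>D. norm (T x) \<le> e * norm x \<longrightarrow> d * (norm x)\<^sup>2 \<le> q x"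
proof (rule ccontr)
  assume contra: "\<not> ?thesis"
  have lin: "linear_operator D T" using T by (simp add: closed_operator_def)
  note D = linear_operatorD(1)[OF lin] and Tadd = linear_operatorD(2)[OF lin]
    and TC = linear_operatorD(3)[OF lin] and Tdiff = linear_operatorD(5)[OF lin]
    and TR = linear_operatorD(6)[OF lin]
  obtain u where u: "\<And>n. u n \<in> D" "\<And>n. norm (u n) = 1" and Tu: "(\<lambda>n. T (u n)) \<longlonglongrightarrow> 0"
    and u': "\<And>n. norm (T (u n)) \<le> 1 / real (Suc n)" "\<And>n. q (u n) \<le> 1 / real (Suc n)"
    using near_kernel_counterexample[OF lin contra] by metis
  have l1: "(\<lambda>n. 1 / real (Suc n)) \<longlonglongrightarrow> 0" by (rule LIMSEQ_Suc[OF lim_1_over_n])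
  define \<Gamma> where "\<Gamma> = (\<lambda>x. (x, T x)) ` D"
  \<comment> \<open>\<open>H\<close> need not be closed, so its trace is closed up in the graph
    norm; as the graph is closed, \<open>E\<close> still consists of graph points.\<close>
  define E where "E = closure ((\<lambda>x. (x, T x)) ` (D \<inter> H))"
  have cl\<Gamma>: "closed \<Gamma>" using T by (simp add: closed_operator_def \<Gamma>_def)
  have graph_subspace: "subspace ((\<lambda>x. (x, T x)) ` X)" if "csubspace X" "X \<subseteq> D" for X
    unfolding subspace_def
  proof (intro conjI ballI allI)
    have "T 0 = 0" by (rule linear_operatorD(4)[OF lin])
    then show "0 \<in> (\<lambda>x. (x, T x)) ` X"
      using complex_vector.subspace_0[OF that(1)] by (auto simp: zero_prod_def intro!: image_eqI[of _ _ 0])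
  next
    fix p p' assume "p \<in> (\<lambda>x. (x, T x)) ` X" "p' \<in> (\<lambda>x. (x, T x)) ` X"
    then obtain x y where "p = (x, T x)" "p' = (y, T y)" "x \<in> X" "y \<in> X" by auto
    then show "p + p' \<in> (\<lambda>x. (x, T x)) ` X"
      using subsetD[OF that(2)] complex_vector.subspace_add[OF that(1), of x y] Tadd[of x y]
      by (intro image_eqI[of _ _ "x + y"]) auto
  next
    fix p and c :: real assume "p \<in> (\<lambda>x. (x, T x)) ` X"
    then obtain x where "p = (x, T x)" "x \<in> X" by auto
    then show "c *\<^sub>R p \<in> (\<lambda>x. (x, T x)) ` X"
      using subsetD[OF that(2)] scaleR_in_csubspace[OF that(1), of x c] TR[of x c]
      by (intro image_eqI[of _ _ "c *\<^sub>R x"]) auto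
  qed
  have DH: "csubspace (D \<inter> H)" using D H(1) complex_vector.subspace_inter by blast
  have sub\<Gamma>: "subspace \<Gamma>" unfolding \<Gamma>_def by (rule graph_subspace[OF D order_refl])
  have subE: "subspace E" unfolding E_def by (intro subspace_closure graph_subspace[OF DH]) simp
  have E\<Gamma>: "E \<subseteq> \<Gamma>" unfolding E_def using cl\<Gamma> by (intro closure_minimal) (auto simp: \<Gamma>_def)
  obtain K where K: "K > 0" "\<And>x y. cmod (gip G x y) \<le> norm x * norm y * K"
    using q_bound by metis
  define C where "C = (K + \<delta>) / \<epsilon>\<^sup>2"
  \<comment> \<open>\<open>C\<close> is chosen so that \<open>\<Phi>\<close> is nonnegative on \<open>E\<close>, hence convex on the cosets of \<open>E\<close>;
    near the normalized sequence \<open>u\<close> it is asymptotically at most \<open>-\<delta>\<close>.\<close>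
  define \<Phi> where "\<Phi> p = q (fst p) - \<delta> * (norm (fst p))\<^sup>2 + C * (norm (snd p))\<^sup>2" for p :: "'a \<times> 'a"
  have \<Phi>lim: "((\<lambda>n. \<Phi> (f n)) \<longlongrightarrow> \<Phi> l) F" if "(f \<longlongrightarrow> l) F" for f l and F :: "nat filter"
    unfolding \<Phi>_def by (intro tendsto_intros tendsto_q that tendsto_fst tendsto_snd)
  have \<Phi>core: "0 \<le> \<Phi> (x, T x)" if "x \<in> D" "x \<in> H" for x
  proof (cases "norm (T x) \<le> \<epsilon> * norm x")
    case True
    moreover have "0 \<le> C" using K d e by (simp add: C_def)
    ultimately show ?thesis using pos[OF that] by (simp add: \<Phi>_def)
  next
    case False
    \<comment> \<open>Away from the kernel \<open>C * \<epsilon>\<^sup>2 = K + \<delta>\<close> pays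
      both for a negative \<open>q x\<close>, at least \<open>- K\<close> times the squared norm,
      and for the subtracted \<delta>.\<close>
    then have "(\<epsilon> * norm x)\<^sup>2 \<le> (norm (T x))\<^sup>2" using e by (intro power_mono) auto
    then have "C * (\<epsilon> * norm x)\<^sup>2 \<le> C * (norm (T x))\<^sup>2"
      using K(1) d by (intro mult_left_mono) (auto simp: C_def)
    moreover have "C * (\<epsilon> * norm x)\<^sup>2 = (K + \<delta>) * (norm x)\<^sup>2"
      using e by (simp add: C_def power_mult_distrib)
    moreover have "\<bar>q x\<bar> \<le> K * (norm x)\<^sup>2"
      using K(2)[of x x] abs_Re_le_cmod[of "gip G x x"] by (simp add: power2_eq_square mult.commute)
    ultimately show ?thesis unfolding \<Phi>_def fst_conv snd_conv distrib_right by linarith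
  qed
  have \<Phi>E: "0 \<le> \<Phi> p" if "p \<in> E" for p
  proof -
    from that[unfolded E_def closure_sequential]
    obtain f where f: "\<forall>n. f n \<in> (\<lambda>x. (x, T x)) ` (D \<inter> H)" "f \<longlonglongrightarrow> p"
      by (elim exE conjE)
    have "0 \<le> \<Phi> (f n)" for n
    proof -
      obtain x where "x \<in> D" "x \<in> H" "f n = (x, T x)" using f(1)[rule_format, of n] by auto
      then show ?thesis by (simp only: \<Phi>core)
    qed
    then show ?thesis by (intro LIMSEQ_le_const[OF \<Phi>lim[OF f(2)]] exI allI impI)
  qed
  have \<Phi>convex: "\<Phi> (s *\<^sub>R p + t *\<^sub>R p') = s * \<Phi> p + t * \<Phi> p' - s * t * \<Phi> (p - p')"
    if "s + t = 1" for s t :: real and p p'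
  proof -
    have t: "t = 1 - s" using that by simp
    show ?thesis
      unfolding \<Phi>_def fst_add snd_add fst_scaleR snd_scaleR fst_diff snd_diff q_diff q_add q_scaleR
      unfolding gip.add_right gip.scaleR_left gip.scaleR_right power2_norm_eq_inner inner_simps t
      by (simp add: algebra_simps power2_eq_square inner_commute)
  qed
  obtain B where B: "finite B" "UNIV \<subseteq> cspan (H \<union> B)" using H(2) by (auto simp: finite_codim_def)
  have "D \<subseteq> cspan (H \<union> B)" using B(2) by blast
  then obtain F where F: "finite F" "F \<subseteq> D" "D \<subseteq> cspan ((D \<inter> H) \<union> F)"
    using finite_relative_codim[OF B(1) H(1) D] by metis
  \<comment> \<open>The graph is treated as a real space, so every complex generator enters together
    with its multiple by \<i>.\<close>
  define B' where "B' = (\<lambda>x. (x, T x)) ` (F \<union> (*\<^sub>C) \<i> ` F)"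
  have "x \<in> D \<and> (x, T x) \<in> span (E \<union> B')" if "x \<in> cspan ((D \<inter> H) \<union> F)" for x
    using that
  proof (induction rule: complex_vector.span_induct_alt)
    case base
    have "(0, T 0) = (0 :: 'a \<times> 'a)" by (simp add: linear_operatorD(4)[OF lin] zero_prod_def)
    then show ?case using complex_vector.subspace_0[OF D] by (simp only: span_zero)
  next
    case (step c s y)
    have sD: "s \<in> D" using step F by auto
    have csD: "c *\<^sub>C s \<in> D" using sD D by (rule complex_vector.subspace_scale[rotated])
    have "(c *\<^sub>C s, T (c *\<^sub>C s)) \<in> span (E \<union> B')"
    proof (cases "s \<in> H")
      case True
      then have "c *\<^sub>C s \<in> D \<inter> H" using sD complex_vector.subspace_scale[OF DH] by blast
      then have "(c *\<^sub>C s, T (c *\<^sub>C s)) \<in> E" unfolding E_def by (intro subsetD[OF closure_subset] imageI)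
      then show ?thesis by (intro span_base) simp
    next
      case False
      then have "s \<in> F" using step by auto
      then have "(s, T s) \<in> B'" "(\<i> *\<^sub>C s, T (\<i> *\<^sub>C s)) \<in> B'" by (auto simp: B'_def)
      moreover have "(c *\<^sub>C s, T (c *\<^sub>C s)) = Re c *\<^sub>R (s, T s) + Im c *\<^sub>R (\<i> *\<^sub>C s, T (\<i> *\<^sub>C s))"
        unfolding TC[OF sD] by (simp add: scaleC_complex_split[of c])
      ultimately show ?thesis by (simp only:) (intro span_add span_scale span_base, auto)
    qed
    moreover have "(c *\<^sub>C s + y, T (c *\<^sub>C s + y)) = (c *\<^sub>C s, T (c *\<^sub>C s)) + (y, T y)"
      using Tadd csD step by simp
    moreover have "c *\<^sub>C s + y \<in> D" using csD step D by (simp add: complex_vector.subspace_add)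
    ultimately show ?case using step by (metis span_add)
  qed
  then have span\<Gamma>: "(u n, T (u n)) \<in> span (E \<union> B')" for n using F(3) u(1) by blast
  have nb: "norm (u n, T (u n)) \<le> 2" for n
  proof -
    have "norm (T (u n)) \<le> 1" using u'(1)[of n] by (rule order_trans) simp
    then show ?thesis using norm_Pair_le[of "u n" "T (u n)"] u(2)[of n] by linarith
  qed
  have finB': "finite B'" using F(1) by (simp add: B'_def)
  obtain r g l where r: "strict_mono (r::nat\<Rightarrow>nat)" and gl: "g \<longlonglongrightarrow> l"
    and gE: "\<And>n. (u (r n), T (u (r n))) - g n \<in> E"
    using bounded_sequence_mod_finite[of B' E "\<lambda>n. (u n, T (u n))", OF finB' subE _ span\<Gamma> nb]
    unfolding E_def by auto
  define p where "p n = (u (r n), T (u (r n)))" for n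
  \<comment> \<open>Replacing \<open>g n\<close> by its limit puts all \<open>w n\<close> into the
    single coset \<open>l + E\<close> and changes \<open>p n\<close> only by a null
    sequence.\<close>
  define w where "w n = p n - g n + l" for n
  have p\<Gamma>: "p n \<in> \<Gamma>" for n using u(1) by (simp add: p_def \<Gamma>_def)
  have "g n \<in> \<Gamma>" for n
    using subspace_diff[OF sub\<Gamma> p\<Gamma> subsetD[OF E\<Gamma> gE], of n n] by (simp add: p_def)
  then have l\<Gamma>: "l \<in> \<Gamma>" by (intro closed_sequentially[OF cl\<Gamma> _ gl])
  have wl: "w n - l \<in> E" for n using gE by (simp add: w_def p_def)
  have w\<Gamma>: "w n \<in> \<Gamma>" for n
    using subspace_add[OF sub\<Gamma> subsetD[OF E\<Gamma> wl] l\<Gamma>, of n] by simp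
  have wp: "(\<lambda>n. w n - p n) \<longlonglongrightarrow> 0"
    using tendsto_diff[OF tendsto_const[of l] gl] by (simp add: w_def)
  have r1: "(\<lambda>n. 1 / real (Suc (r n))) \<longlonglongrightarrow> 0"
    using LIMSEQ_subseq_LIMSEQ[OF l1 r] by (simp add: o_def)
  have wp1: "(\<lambda>n. fst (w n) - u (r n)) \<longlonglongrightarrow> 0"
    using tendsto_fst[OF wp] by (simp add: p_def)
  have snd_w: "(\<lambda>n. snd (w n)) \<longlonglongrightarrow> 0"
    using tendsto_add[OF tendsto_snd[OF wp] LIMSEQ_subseq_LIMSEQ[OF Tu r]] by (simp add: p_def o_def)
  have "(\<lambda>n. (fst (w n) \<bullet> fst (w n)) - (u (r n) \<bullet> u (r n))) \<longlonglongrightarrow> 0"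
    by (rule bilinear_diagonal_tendsto[OF bounded_bilinear_inner _ wp1, of 1]) (simp add: u)
  then have fst_w: "(\<lambda>n. (norm (fst (w n)))\<^sup>2) \<longlonglongrightarrow> 1"
    using u(2) by (subst LIM_zero_iff[symmetric]) (simp add: power2_norm_eq_inner[symmetric])
  have qw: "(\<lambda>n. q (fst (w n)) - q (u (r n))) \<longlonglongrightarrow> 0"
    using tendsto_Re[OF bilinear_diagonal_tendsto[OF bounded_bilinear_gip _ wp1, of 1]] u(2) by simp
  \<comment> \<open>The last bound serves twice: it keeps the sets bounded, and in the limit it
    gives \<open>norm (fst z) \<le> 1\<close>.\<close>
  define X where "X k = {p \<in> \<Gamma>. p - l \<in> E \<and> norm (snd p) \<le> 1 / real (Suc k) \<and>
      \<Phi> p \<le> - \<delta> + 1 / real (Suc k) \<and> norm (fst p) \<le> 1 + 1 / real (Suc k)}" for k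
  have Xne: "X k \<noteq> {}" for k
  proof -
    have k0: "0 < 1 / real (Suc k)" by simp
    \<comment> \<open>Here \<open>q (u (r n))\<close> has been replaced by its upper bound
      \<open>1 / (r n + 1)\<close>, so that the expression dominates \<open>\<Phi> (w n)\<close> and
      converges to \<open>- \<delta>\<close>.\<close>
    have "(\<lambda>n. (q (fst (w n)) - q (u (r n))) + 1 / real (Suc (r n)) - \<delta> * (norm (fst (w n)))\<^sup>2
        + C * (norm (snd (w n)))\<^sup>2) \<longlonglongrightarrow> 0 + 0 - \<delta> * 1 + C * (norm (0::'a))\<^sup>2"
      by (intro tendsto_intros qw r1 fst_w snd_w)
    then have 1: "\<forall>\<^sub>F n in sequentially. (q (fst (w n)) - q (u (r n))) + 1 / real (Suc (r n))
        - \<delta> * (norm (fst (w n)))\<^sup>2 + C * (norm (snd (w n)))\<^sup>2 < - \<delta> + 1 / real (Suc k)"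
      by (rule order_tendstoD) (use k0 in simp)
    have 2: "\<forall>\<^sub>F n in sequentially. norm (snd (w n)) < 1 / real (Suc k)"
      using order_tendstoD(2)[OF tendsto_norm[OF snd_w]] k0 by simp
    have "(1::real) < (1 + 1 / real (Suc k))\<^sup>2" using k0 by (intro one_less_power) auto
    then have 3: "\<forall>\<^sub>F n in sequentially. (norm (fst (w n)))\<^sup>2 < (1 + 1 / real (Suc k))\<^sup>2"
      by (rule order_tendstoD(2)[OF fst_w])
    obtain n where n: "(q (fst (w n)) - q (u (r n))) + 1 / real (Suc (r n))
        - \<delta> * (norm (fst (w n)))\<^sup>2 + C * (norm (snd (w n)))\<^sup>2 < - \<delta> + 1 / real (Suc k)"
      "norm (snd (w n)) < 1 / real (Suc k)" "(norm (fst (w n)))\<^sup>2 < (1 + 1 / real (Suc k))\<^sup>2"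
      using eventually_happens[OF eventually_conj[OF 1 eventually_conj[OF 2 3]]] by auto
    have "norm (fst (w n)) < 1 + 1 / real (Suc k)" using n(3) k0 by (auto intro: power_less_imp_less_base)
    moreover have "\<Phi> (w n) \<le> - \<delta> + 1 / real (Suc k)"
      using n(1) u'(2)[of "r n"] unfolding \<Phi>_def by linarith
    ultimately have "w n \<in> X k" using w\<Gamma> wl n(2) by (simp add: X_def)
    then show ?thesis by blast
  qed
  have Xconv: "convex (X k)" for k
  proof (rule convexI)
    fix p p' and s t :: real assume p: "p \<in> X k" "p' \<in> X k" and st: "0 \<le> s" "0 \<le> t" "s + t = 1"
    let ?z = "s *\<^sub>R p + t *\<^sub>R p'"
    have comb: "s * x + t * y \<le> z" if "x \<le> z" "y \<le> z" for x y z :: real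
      using convex_bound_le[OF that st] by simp
    have "?z \<in> \<Gamma>" using p sub\<Gamma> by (simp add: X_def subspace_add subspace_scale)
    moreover have "?z - l = s *\<^sub>R (p - l) + t *\<^sub>R (p' - l)"
      using st(3) by (simp add: algebra_simps scaleR_add_left[symmetric])
    then have "?z - l \<in> E" using p subE by (simp add: X_def subspace_add subspace_scale)
    moreover have "norm (snd ?z) \<le> s * norm (snd p) + t * norm (snd p')"
      using norm_triangle_ineq[of "s *\<^sub>R snd p" "t *\<^sub>R snd p'"] st by simp
    then have "norm (snd ?z) \<le> 1 / real (Suc k)"
      using p by (auto simp: X_def intro: order_trans[OF _ comb])
    moreover have "norm (fst ?z) \<le> s * norm (fst p) + t * norm (fst p')"
      using norm_triangle_ineq[of "s *\<^sub>R fst p" "t *\<^sub>R fst p'"] st by simp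
    then have "norm (fst ?z) \<le> 1 + 1 / real (Suc k)"
      using p by (auto simp: X_def intro: order_trans[OF _ comb])
    moreover have "p - p' = (p - l) - (p' - l)" by simp
    then have "0 \<le> \<Phi> (p - p')" using \<Phi>E subspace_diff[OF subE] p by (metis (no_types, lifting) X_def mem_Collect_eq)
    then have "\<Phi> ?z \<le> s * \<Phi> p + t * \<Phi> p'" using \<Phi>convex[OF st(3)] st by simp
    then have "\<Phi> ?z \<le> - \<delta> + 1 / real (Suc k)"
      using p by (auto simp: X_def intro: order_trans[OF _ comb])
    ultimately show "?z \<in> X k" by (simp add: X_def)
  qed
  have Xdec: "X n \<subseteq> X m" if "m \<le> n" for m n
  proof -
    have "1 / real (Suc n) \<le> 1 / real (Suc m)" using that by (intro divide_left_mono) auto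
    then show ?thesis by (auto simp: X_def intro: order_trans)
  qed
  have "X n \<subseteq> cball 0 3" for n
  proof
    fix x assume "x \<in> X n"
    then have "x \<in> X 0" using Xdec[of 0 n] by auto
    then show "x \<in> cball 0 3" using norm_Pair_le[of "fst x" "snd x"] by (simp add: X_def)
  qed
  moreover have "antimono X" using Xdec by (rule antimonoI)
  ultimately obtain c z where c: "\<And>n. c n \<in> X n" "c \<longlonglongrightarrow> z"
    using nested_convex_convergent[of X, OF Xconv Xne] by blast
  have z\<Gamma>: "z \<in> \<Gamma>" using c(1) by (intro closed_sequentially[OF cl\<Gamma> _ c(2)]) (simp add: X_def)
  have "norm (snd z) \<le> 0"
    using c(1) by (intro LIMSEQ_le[OF tendsto_norm[OF tendsto_snd[OF c(2)]] l1]) (auto simp: X_def)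
  moreover have "\<Phi> z \<le> - \<delta> + 0"
    using c(1) by (intro LIMSEQ_le[OF \<Phi>lim[OF c(2)] tendsto_add[OF tendsto_const l1]]) (auto simp: X_def)
  moreover have "norm (fst z) \<le> 1 + 0"
    using c(1) by (intro LIMSEQ_le[OF tendsto_norm[OF tendsto_fst[OF c(2)]] tendsto_add[OF tendsto_const l1]])
      (auto simp: X_def)
  ultimately have z: "snd z = 0" "q (fst z) \<le> \<delta> * (norm (fst z))\<^sup>2 - \<delta>" "norm (fst z) \<le> 1"
    by (auto simp: \<Phi>_def)
  \<comment> \<open>The inequality for \<open>q (fst z)\<close> is used twice: norm at most 1 makes
    its right side nonpositive, and \<open>fst z = 0\<close> would turn it into
    \<open>0 \<le> - \<delta>\<close>.\<close>
  have "(norm (fst z))\<^sup>2 \<le> 1" using z(3) by (simp add: power_le_one)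
  then have "\<delta> * (norm (fst z))\<^sup>2 \<le> \<delta>" using d mult_left_le by auto
  then have "q (fst z) \<le> 0" using z(2) by simp
  moreover have "fst z \<in> D" "T (fst z) = 0" using z\<Gamma> z(1) by (auto simp: \<Gamma>_def)
  moreover have "fst z \<noteq> 0" using z(2) d by auto
  ultimately show False using ker[of "fst z"] by simp
qed

end

section \<open>Surjective parts of an operator\<close>

text \<open>\<open>T\<close> maps its part in \<open>M\<close> onto \<open>M\<close> and,
  orthogonally to the kernel \<open>Z\<close> of this part, is bounded below by
  \<open>1 / c\<close>. This number is the radius of the disc of \<mu> in which the eigenvectors in
  \<open>M\<close> can be followed.\<close>

locale surjective_part =
  fixes D :: "'a::chilbert_space set" and T :: "'a \<Rightarrow> 'a" and M Z :: "'a set" and c :: real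
  defines "Z \<equiv> {x \<in> D \<inter> M. T x = 0}"
  assumes linT: "linear_operator D T" and clM: "closed_csubspace M" and clZ: "closed Z"
    and onto: "\<And>v. v \<in> M \<Longrightarrow> \<exists>x\<in>D \<inter> M. T x = v"
    and c: "c > 0"
    and bounded_below: "\<And>x. x \<in> D \<Longrightarrow> x \<in> M \<Longrightarrow> T x \<in> M \<Longrightarrow> (\<And>z. z \<in> Z \<Longrightarrow> cinner x z = 0) \<Longrightarrow>
      norm x \<le> c * norm (T x)"
begin

lemmas D = linear_operatorD(1)[OF linT] and Tadd = linear_operatorD(2)[OF linT]
  and TC = linear_operatorD(3)[OF linT] and Tdiff = linear_operatorD(5)[OF linT]

lemma M: "csubspace M" "closed M" using clM by (auto dest: closed_csubspaceD)

lemma DM: "csubspace (D \<inter> M)" by (intro complex_vector.subspace_inter D M)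

lemma Z: "csubspace Z"
  unfolding complex_vector.subspace_def
proof (intro conjI ballI allI)
  show "0 \<in> Z" using complex_vector.subspace_0[OF DM] linear_operatorD(4)[OF linT] by (simp add: Z_def)
  show "x + y \<in> Z" if "x \<in> Z" "y \<in> Z" for x y
    using that complex_vector.subspace_add[OF DM, of x y] by (simp add: Z_def Tadd)
  show "k *\<^sub>C x \<in> Z" if "x \<in> Z" for k x
    using that complex_vector.subspace_scale[OF DM, of x k] by (simp add: Z_def TC)
qed

lemma Z_subset: "Z \<subseteq> D" "Z \<subseteq> M" by (auto simp: Z_def)

definition perp :: "'a \<Rightarrow> bool" where "perp x \<longleftrightarrow> (\<forall>z\<in>Z. cinner x z = 0)"

lemma perp_add: "perp x \<Longrightarrow> perp y \<Longrightarrow> perp (x + y)" by (simp add: perp_def cinner_add_left)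
lemma perp_scale: "perp x \<Longrightarrow> perp (k *\<^sub>C x)" by (simp add: perp_def cinner_scaleC_left)
lemma perp_diff: "perp x \<Longrightarrow> perp y \<Longrightarrow> perp (x - y)"
  by (simp add: perp_def bounded_bilinear.diff_left[OF bounded_bilinear_cinner])

lemma perp_Z: "perp z \<Longrightarrow> z \<in> Z \<Longrightarrow> z = 0"
  by (auto simp: perp_def cinner_self_real)

lemma perp_decomposition: "\<exists>p\<in>Z. perp (x - p)"
  using orthogonal_projection[of Z x] Z clZ by (simp add: perp_def closed_csubspace_def)

lemma bound: "x \<in> D \<Longrightarrow> x \<in> M \<Longrightarrow> T x \<in> M \<Longrightarrow> perp x \<Longrightarrow> norm x \<le> c * norm (T x)"
  by (rule bounded_below) (auto simp: perp_def)

lemma right_inverse_exists: "v \<in> M \<Longrightarrow> \<exists>x\<in>D \<inter> M. T x = v \<and> perp x"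
proof -
  assume "v \<in> M"
  then obtain x where x: "x \<in> D \<inter> M" "T x = v" using onto by blast
  obtain p where p: "p \<in> Z" "perp (x - p)" using perp_decomposition by blast
  have "x - p \<in> D \<inter> M" using x p Z_subset by (intro complex_vector.subspace_diff DM) auto
  moreover have "T (x - p) = v" using x p by (simp add: Tdiff Z_def)
  ultimately show ?thesis using p by blast
qed

text \<open>The right inverse with values orthogonal to \<open>Z\<close>. The lower bound makes the
  chosen vector unique, so \<open>B\<close> is Lipschitz with constant \<open>c\<close>.\<close>

definition B :: "'a \<Rightarrow> 'a" where "B v = (SOME x. x \<in> D \<inter> M \<and> T x = v \<and> perp x)"

lemma B: assumes "v \<in> M" shows "B v \<in> D" "B v \<in> M" "T (B v) = v" "perp (B v)"
proof -
  have "\<exists>x. x \<in> D \<inter> M \<and> T x = v \<and> perp x" using right_inverse_exists[OF assms] by blast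
  from someI_ex[OF this] show "B v \<in> D" "B v \<in> M" "T (B v) = v" "perp (B v)"
    unfolding B_def by blast+
qed

lemma B_lipschitz: assumes "v \<in> M" "w \<in> M" shows "norm (B v - B w) \<le> c * norm (v - w)"
proof -
  have "T (B v - B w) = v - w" using B assms by (simp add: Tdiff)
  moreover have "B v - B w \<in> D \<inter> M" using B assms by (intro complex_vector.subspace_diff DM) auto
  moreover have "v - w \<in> M" using assms M by (simp add: complex_vector.subspace_diff)
  ultimately show ?thesis using bound[of "B v - B w"] perp_diff[OF B(4) B(4)] assms by simp
qed

lemma norm_B: assumes "v \<in> M" shows "norm (B v) \<le> c * norm v"
  using bound[OF B(1,2)[OF assms]] B[OF assms] assms by simp

text \<open>Neumann series in the guise of Banach's fixed point theorem.\<close>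

lemma resolvent_equation:
  assumes l: "cmod \<mu> * c < 1" and v: "v \<in> M" and z: "z \<in> Z"
  shows "\<exists>x\<in>D \<inter> M. T x = \<mu> *\<^sub>C x + v \<and> perp (x - z)"
proof -
  \<comment> \<open>At a fixed point \<open>T x = T z + \<mu> *\<^sub>C x + v\<close> with
    \<open>T z = 0\<close>, while \<open>x - z\<close> is a value of \<open>B\<close> and hence
    orthogonal to \<open>Z\<close>; thus \<open>z\<close> prescribes the component of
    \<open>x\<close> in \<open>Z\<close>.\<close>
  define f where "f x = z + B (\<mu> *\<^sub>C x + v)" for x
  have arg: "\<mu> *\<^sub>C x + v \<in> M" if "x \<in> M" for x
    using that v M by (simp add: complex_vector.subspace_add complex_vector.subspace_scale)
  have fM: "f x \<in> D \<inter> M" if "x \<in> M" for x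
    unfolding f_def using z Z_subset B[OF arg[OF that]] by (intro complex_vector.subspace_add DM) auto
  have "\<exists>!x. x \<in> M \<and> f x = x"
  proof (rule Banach_fix[of M "cmod \<mu> * c"])
    show "complete M" using M(2) by (simp add: complete_eq_closed)
    show "M \<noteq> {}" using v by blast
    show "0 \<le> cmod \<mu> * c" using c by simp
    show "f ` M \<subseteq> M" using fM by blast
    fix x y assume xy: "x \<in> M" "y \<in> M"
    have "dist (f x) (f y) = norm (B (\<mu> *\<^sub>C x + v) - B (\<mu> *\<^sub>C y + v))" by (simp add: f_def dist_norm)
    also have "\<dots> \<le> c * norm ((\<mu> *\<^sub>C x + v) - (\<mu> *\<^sub>C y + v))" by (intro B_lipschitz arg xy)
    also have "\<dots> = cmod \<mu> * c * dist x y"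
      by (simp add: dist_norm norm_scaleC complex_vector.scale_right_diff_distrib[symmetric])
    finally show "dist (f x) (f y) \<le> cmod \<mu> * c * dist x y" .
  qed (use l in auto)
  then obtain x where x: "x \<in> M" "f x = x" by blast
  then have xD: "x \<in> D \<inter> M" using fM by metis
  have "T x = T z + T (B (\<mu> *\<^sub>C x + v))"
    using Tadd[of z "B (\<mu> *\<^sub>C x + v)"] z Z_subset B(1)[OF arg[OF x(1)]] x(2) by (auto simp: f_def)
  then have "T x = \<mu> *\<^sub>C x + v" using z B(3)[OF arg[OF x(1)]] by (simp add: Z_def)
  moreover have "x - z = B (\<mu> *\<^sub>C x + v)" using x(2) by (simp add: f_def algebra_simps)
  ultimately show ?thesis using xD B(4)[OF arg[OF x(1)]] by metis
qed

definition eig :: "complex \<Rightarrow> 'a set" where "eig \<mu> = {x \<in> D \<inter> M. T x = \<mu> *\<^sub>C x}"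

lemma eig: "csubspace (eig \<mu>)"
  unfolding complex_vector.subspace_def
proof (intro conjI ballI allI)
  show "0 \<in> eig \<mu>" using complex_vector.subspace_0[OF DM] linear_operatorD(4)[OF linT] by (simp add: eig_def)
  show "x + y \<in> eig \<mu>" if "x \<in> eig \<mu>" "y \<in> eig \<mu>" for x y
    using that complex_vector.subspace_add[OF DM, of x y] by (simp add: eig_def Tadd scaleC_add_right)
  show "k *\<^sub>C x \<in> eig \<mu>" if "x \<in> eig \<mu>" for k x
    using that complex_vector.subspace_scale[OF DM, of x k] by (simp add: eig_def TC scaleC_scaleC mult.commute)
qed

lemma eig_perp: assumes l: "cmod \<mu> * c < 1" and x: "x \<in> eig \<mu>" "perp x" shows "x = 0"
proof (rule ccontr)
  assume "x \<noteq> 0"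
  have "norm x \<le> c * norm (T x)"
    using x M by (intro bound) (auto simp: eig_def complex_vector.subspace_scale)
  also have "\<dots> = (cmod \<mu> * c) * norm x" using x by (simp add: eig_def norm_scaleC)
  also have "\<dots> < 1 * norm x" using l \<open>x \<noteq> 0\<close> by (intro mult_strict_right_mono) auto
  finally show False by simp
qed

text \<open>\<open>S\<close> inverts the orthogonal projection from \<open>eig \<mu>\<close> to
  \<open>Z\<close>: \<open>resolvent_equation\<close> with \<open>v = 0\<close> produces an
  eigenvector with given component in \<open>Z\<close>, and by \<open>eig_perp\<close> it is unique,
  which also makes \<open>S\<close> linear.\<close>

lemma edim_eig:
  assumes l: "cmod \<mu> * c < 1" and fd: "finite_dimensional Z"
  shows "edim (eig \<mu>) = edim Z"
proof -
  define S where "S z = (SOME x. x \<in> eig \<mu> \<and> perp (x - z))" for z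
  have S: "S z \<in> eig \<mu>" "perp (S z - z)" if z: "z \<in> Z" for z
  proof -
    have "\<exists>x. x \<in> eig \<mu> \<and> perp (x - z)"
      using resolvent_equation[OF l complex_vector.subspace_0[OF M(1)] z] by (auto simp: eig_def)
    from someI_ex[OF this] show "S z \<in> eig \<mu>" "perp (S z - z)" unfolding S_def by blast+
  qed
  have uniq: "S z = x" if z: "z \<in> Z" and x: "x \<in> eig \<mu>" "perp (x - z)" for x z
  proof -
    have "perp ((S z - z) - (x - z))" by (intro perp_diff S z x)
    moreover have "S z - x \<in> eig \<mu>" by (intro complex_vector.subspace_diff eig S z x)
    ultimately show ?thesis using eig_perp[OF l, of "S z - x"] by simp
  qed
  have "edim Z = edim (eig \<mu>)"
  proof (rule edim_bij[where P=S, OF Z fd])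
    fix x y assume xy: "x \<in> Z" "y \<in> Z"
    have "perp ((S x - x) + (S y - y))" by (intro perp_add S xy)
    then show "S (x + y) = S x + S y"
      using xy by (intro uniq complex_vector.subspace_add Z eig S) (auto simp: algebra_simps)
  next
    fix k x assume x: "x \<in> Z"
    have "perp (k *\<^sub>C (S x - x))" by (intro perp_scale S x)
    then show "S (k *\<^sub>C x) = k *\<^sub>C S x"
      using x by (intro uniq complex_vector.subspace_scale Z eig S)
        (auto simp: complex_vector.scale_right_diff_distrib)
  next
    fix x assume x: "x \<in> Z" "S x = 0"
    then have "perp (0 - x)" using S(2) by metis
    then have "perp x" by (simp add: perp_def bounded_bilinear.minus_left[OF bounded_bilinear_cinner])
    then show "x = 0" using x perp_Z by simp
  next
    show "S ` Z = eig \<mu>"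
    proof
      show "S ` Z \<subseteq> eig \<mu>" using S by blast
      show "eig \<mu> \<subseteq> S ` Z"
      proof
        fix x assume x: "x \<in> eig \<mu>"
        obtain p where "p \<in> Z" "perp (x - p)" using perp_decomposition by blast
        then show "x \<in> S ` Z" using uniq[of p x] x by (metis imageI)
      qed
    qed
  qed
  then show ?thesis by simp
qed

text \<open>On \<open>M\<close> the equation for \<open>T - \<mu>\<close> can be solved again and
  again, starting from the eigenvector; no member vanishes because its image does not.\<close>

lemma infinite_chain_from:
  assumes l: "cmod \<mu> * c < 1" and e: "e \<in> eig \<mu>" "e \<noteq> 0"
  shows "\<exists>x. infinite_jordan_chain D T \<mu> x \<and> x 0 = e"
proof -
  have "\<exists>y. y \<in> D \<inter> M \<and> T y - \<mu> *\<^sub>C y = v" if "v \<in> D \<inter> M" for v n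
    using resolvent_equation[OF l, of v 0] complex_vector.subspace_0[OF Z] that by auto
  then obtain f where f: "\<And>v. v \<in> D \<inter> M \<Longrightarrow> f v \<in> D \<inter> M \<and> T (f v) - \<mu> *\<^sub>C f v = v" by metis
  define x where "x n = (f ^^ n) e" for n
  have xD: "x n \<in> D \<inter> M" for n
  proof (induction n)
    case 0 then show ?case using e by (simp add: x_def eig_def)
  next
    case (Suc n) then show ?case using f by (simp add: x_def)
  qed
  have step: "T (x (Suc n)) - \<mu> *\<^sub>C x (Suc n) = x n" for n using f[OF xD[of n]] by (simp add: x_def)
  have nz: "x n \<noteq> 0" for n
  proof (induction n)
    case 0 then show ?case using e by (simp add: x_def)
  next
    case (Suc n) then show ?case using step[of n] linear_operatorD(4)[OF linT] by auto
  qed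
  have "T (x i) - \<mu> *\<^sub>C x i = x (i - 1)" if "i \<ge> 1" for i
    using step[of "i - 1"] that by simp
  then have "infinite_jordan_chain D T \<mu> x"
    unfolding infinite_jordan_chain_def using xD nz e by (auto simp: x_def eig_def)
  then show ?thesis by (intro exI[of _ x]) (simp add: x_def)
qed

text \<open>Writing \<open>x = T (B x)\<close> and moving \<open>T\<close> to the eigenvector costs
  a factor of modulus \<open>|\<mu>|\<close>, and passing from \<open>x\<close> to
  \<open>B x\<close> costs \<open>c\<close>; repeated \<open>n\<close> times this leaves
  \<open>(|\<mu>| c)^n\<close>. The eigenvector \<open>y\<close> ranges over the whole kernel, not
  only over \<open>M\<close>, so that \<open>eig \<mu>\<close> becomes isotropic in it.\<close>

lemma gip_eigenvector_zero:
  assumes G: "bounded_selfadjoint G" and sym: "G_symmetric G D T"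
    and l: "cmod \<mu> * c < 1" and y: "y \<in> D" "T y = \<mu> *\<^sub>C y" and x: "x \<in> M"
  shows "gip G x y = 0"
proof -
  interpret indefinite G by standard (rule G)
  obtain K where K: "K > 0" "\<And>x y. cmod (gip G x y) \<le> norm x * norm y * K" using q_bound by metis
  let ?r = "cmod \<mu> * c"
  have iter: "cmod (gip G x y) \<le> ?r ^ n * (norm x * norm y * K)" if "x \<in> M" for n x
    using that
  proof (induction n arbitrary: x)
    case 0 then show ?case using K(2) by simp
  next
    case (Suc n)
    have "gip G x y = gip G (T (B x)) y" using B[OF Suc.prems] by simp
    also have "\<dots> = gip G (B x) (T y)"
      using sym[unfolded G_symmetric_def] B(1)[OF Suc.prems] y(1) by blast
    finally have "cmod (gip G x y) = cmod \<mu> * cmod (gip G (B x) y)" using y by (simp add: norm_mult)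
    also have "\<dots> \<le> cmod \<mu> * (?r ^ n * (norm (B x) * norm y * K))"
      by (intro mult_left_mono Suc.IH B Suc.prems) auto
    also have "\<dots> \<le> cmod \<mu> * (?r ^ n * ((c * norm x) * norm y * K))"
      using norm_B[OF Suc.prems] K c by (intro mult_left_mono mult_right_mono) auto
    finally show ?case by (simp add: mult_ac)
  qed
  have "(\<lambda>n. ?r ^ n * (norm x * norm y * K)) \<longlonglongrightarrow> 0 * (norm x * norm y * K)"
    using l c by (intro tendsto_intros LIMSEQ_power_zero) simp
  then have "cmod (gip G x y) \<le> 0 * (norm x * norm y * K)"
    using iter[OF x] by (intro LIMSEQ_le_const) auto
  then show ?thesis by simp
qed

end

text \<open>\<open>S\<close> is a backward shift on the chains. Applied to a vanishing combination
  it deletes the bottom vectors and lowers the rest by one level, so by induction all higher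
  coefficients vanish, and the independent bottom vectors settle the remaining ones.\<close>

lemma independent_chainsI:
  fixes x :: "nat \<Rightarrow> nat \<Rightarrow> 'a::chilbert_space"
  assumes lin: "linear_operator D S" and xD: "\<And>j i. j < n \<Longrightarrow> x j i \<in> D"
    and S0: "\<And>j. j < n \<Longrightarrow> S (x j 0) = 0" and SS: "\<And>j i. j < n \<Longrightarrow> S (x j (Suc i)) = x j i"
    and inj: "inj_on (\<lambda>j. x j 0) {..<n}" and ind: "\<not> cdependent ((\<lambda>j. x j 0) ` {..<n})"
  shows "independent_chains n x"
proof -
  note D = linear_operatorD(1)[OF lin]
  have S_sum: "(\<Sum>p\<in>P. k p *\<^sub>C f p) \<in> D \<and> S (\<Sum>p\<in>P. k p *\<^sub>C f p) = (\<Sum>p\<in>P. k p *\<^sub>C S (f p))"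
    if "finite P" "\<And>p. p \<in> P \<Longrightarrow> f p \<in> D" for P :: "'c set" and k f
    using that
  proof (induction P)
    case empty
    then show ?case using complex_vector.subspace_0[OF D] linear_operatorD(4)[OF lin] by simp
  next
    case (insert p P)
    then show ?case
      by (simp add: linear_operatorD[OF lin] complex_vector.subspace_add complex_vector.subspace_scale)
  qed
  \<comment> \<open>Independence is a property of a set of vectors; the inverse of the indexing
    turns it into one of the indexed family.\<close>
  have base: "k j = 0" if "(\<Sum>j<n. k j *\<^sub>C x j 0) = 0" "j < n" for k j
  proof -
    let ?X = "(\<lambda>j. x j 0) ` {..<n}"
    let ?u = "\<lambda>v. k (the_inv_into {..<n} (\<lambda>j. x j 0) v)"
    have "(\<Sum>v\<in>?X. ?u v *\<^sub>C v) = (\<Sum>j<n. k j *\<^sub>C x j 0)"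
      by (subst sum.reindex[OF inj]) (auto intro!: sum.cong simp: the_inv_into_f_f[OF inj])
    then have "?u (x j 0) = 0"
      using complex_vector.independentD[OF ind _ order_refl, of ?u "x j 0"] that by simp
    then show ?thesis using that(2) by (simp add: the_inv_into_f_f[OF inj])
  qed
  have main: "(\<Sum>j<n. \<Sum>i<m. k j i *\<^sub>C x j i) = 0 \<Longrightarrow> \<forall>j<n. \<forall>i<m. k j i = 0" for m k
  proof (induction m arbitrary: k)
    case (Suc m)
    have sum_D: "(\<Sum>i<m'. k j i *\<^sub>C x j i) \<in> D" if "j < n" for j m'
      using S_sum[of "{..<m'}" "x j" "k j"] xD that by simp
    have "S (\<Sum>i<Suc m. k j i *\<^sub>C x j i) = (\<Sum>i<m. k j (Suc i) *\<^sub>C x j i)" if "j < n" for j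
    proof -
      have "S (\<Sum>i<Suc m. k j i *\<^sub>C x j i) = (\<Sum>i<Suc m. k j i *\<^sub>C S (x j i))"
        using S_sum[of "{..<Suc m}" "x j" "k j"] xD that by simp
      then show ?thesis using S0[OF that] SS[OF that] by (simp add: sum.lessThan_Suc_shift del: sum.lessThan_Suc)
    qed
    then have "(\<Sum>j<n. \<Sum>i<m. k j (Suc i) *\<^sub>C x j i) = (\<Sum>j<n. 1 *\<^sub>C S (\<Sum>i<Suc m. k j i *\<^sub>C x j i))"
      by (simp del: sum.lessThan_Suc)
    also have "\<dots> = S (\<Sum>j<n. 1 *\<^sub>C (\<Sum>i<Suc m. k j i *\<^sub>C x j i))"
      using S_sum[of "{..<n}" "\<lambda>j. \<Sum>i<Suc m. k j i *\<^sub>C x j i" "\<lambda>_. 1"] sum_D by (simp del: sum.lessThan_Suc)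
    also have "\<dots> = 0" using Suc.prems linear_operatorD(4)[OF lin] by (simp del: sum.lessThan_Suc)
    finally have k1: "\<forall>j<n. \<forall>i<m. k j (Suc i) = 0" by (rule Suc.IH)
    then have "(\<Sum>j<n. \<Sum>i<Suc m. k j i *\<^sub>C x j i) = (\<Sum>j<n. k j 0 *\<^sub>C x j 0)"
      by (intro sum.cong refl) (simp add: sum.lessThan_Suc_shift del: sum.lessThan_Suc)
    then have "\<forall>j<n. k j 0 = 0" using base Suc.prems by metis
    then show ?case using k1 less_Suc_eq_0_disj by metis
  qed simp
  define F where "F = (\<lambda>(j, i). x j i)"
  let ?I = "{..<n} \<times> (UNIV :: nat set)"
  \<comment> \<open>Coefficients on a finite index set are extended by 0 to a rectangle of height
    \<open>m\<close>, to which \<open>main\<close> applies.\<close>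
  have fam: "k p = 0" if P: "finite P" "P \<subseteq> ?I" and s: "(\<Sum>p\<in>P. k p *\<^sub>C F p) = 0" and p: "p \<in> P" for P k p
  proof -
    obtain m where m: "\<And>i. i \<in> snd ` P \<Longrightarrow> i < m"
      using finite_nat_set_iff_bounded[of "snd ` P"] P(1) by auto
    let ?k = "\<lambda>j i. if (j, i) \<in> P then k (j, i) else 0"
    have sub: "P \<subseteq> {..<n} \<times> {..<m}" using P(2) m by force
    have "(\<Sum>j<n. \<Sum>i<m. ?k j i *\<^sub>C x j i) = (\<Sum>p\<in>{..<n} \<times> {..<m}. (if p \<in> P then k p else 0) *\<^sub>C F p)"
      by (auto simp: sum.cartesian_product F_def intro!: sum.cong)
    also have "\<dots> = (\<Sum>p\<in>P. (if p \<in> P then k p else 0) *\<^sub>C F p)"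
      using sub by (intro sum.mono_neutral_right) auto
    also have "\<dots> = 0" using s by simp
    finally have "\<forall>j<n. \<forall>i<m. ?k j i = 0" by (rule main)
    then show ?thesis using sub p by (cases p) (auto split: if_splits)
  qed
  have injF: "inj_on F ?I"
  proof (rule inj_onI, rule ccontr)
    fix p p' assume p: "p \<in> ?I" "p' \<in> ?I" "F p = F p'" "p \<noteq> p'"
    \<comment> \<open>Equal vectors at different indices would give a nontrivial relation with
      coefficients 1 and -1.\<close>
    have "(\<Sum>r\<in>{p, p'}. (if r = p then 1 else -1) *\<^sub>C F r) = 0" using p(3,4) by simp
    then show False using fam[of "{p, p'}" "\<lambda>r. if r = p then 1 else -1" p] p by auto
  qed
  have "\<not> cdependent (F ` ?I)"
    unfolding complex_vector.independent_explicit_module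
  proof (intro allI impI)
    fix t u v assume t: "finite t" "t \<subseteq> F ` ?I" "(\<Sum>v\<in>t. u v *\<^sub>C v) = 0" "v \<in> t"
    obtain P where P: "P \<subseteq> ?I" "finite P" "t = F ` P" using finite_subset_image[OF t(1,2)] by auto
    have "inj_on F P" using injF P(1) by (rule inj_on_subset)
    then have "(\<Sum>p\<in>P. u (F p) *\<^sub>C F p) = 0" using t(3) P(3) by (simp add: sum.reindex)
    then have "u (F p) = 0" if "p \<in> P" for p by (rule fam[OF P(2,1)]) (rule that)
    then show "u v = 0" using t(4) P(3) by auto
  qed
  then show ?thesis using injF by (simp add: independent_chains_def F_def)
qed

text \<open>The sequential condition behind \<open>sigma_pi_plus\<close>, for
  \<open>T = A - \<mu>\<close> at 0, as an inequality. It includes points outside the approximate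
  point spectrum and is visibly stable under small shifts.\<close>

definition pi_type :: "('a::chilbert_space \<Rightarrow> 'a) \<Rightarrow> 'a set \<Rightarrow> ('a \<Rightarrow> 'a) \<Rightarrow> bool" where
  "pi_type G D T \<longleftrightarrow> (\<exists>H \<epsilon> \<delta>. csubspace H \<and> finite_codim H UNIV \<and> \<epsilon> > 0 \<and> \<delta> > 0 \<and>
     (\<forall>x\<in>D \<inter> H. norm (T x) \<le> \<epsilon> * norm x \<longrightarrow> \<delta> * (norm x)\<^sup>2 \<le> Re (gip G x x)))"

lemma op_kernelD: "x \<in> op_kernel D T \<mu> \<Longrightarrow> x \<in> D" "x \<in> op_kernel D T \<mu> \<Longrightarrow> T x = \<mu> *\<^sub>C x"
  by (auto simp: op_kernel_def)

lemma csubspace_op_kernel: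
  assumes "linear_operator D T" shows "csubspace (op_kernel D T \<mu>)"
  using linear_operatorD[OF assms]
  by (auto simp: complex_vector.subspace_def op_kernel_def scaleC_add_right scaleC_scaleC mult.commute)

section \<open>Surjective parts generated by nonpositive manifolds\<close>

context indefinite begin

lemma uniformly_positive_near_kernel_in:
  assumes T: "closed_operator D T" and pi: "pi_type G D T" and W: "closed_csubspace W"
    and ker: "\<And>x. x \<in> D \<Longrightarrow> x \<in> W \<Longrightarrow> T x = 0 \<Longrightarrow> x \<noteq> 0 \<Longrightarrow> 0 < q x"
  obtains e d where "e > 0" "d > 0"
    "\<And>x. x \<in> D \<Longrightarrow> x \<in> W \<Longrightarrow> norm (T x) \<le> e * norm x \<Longrightarrow> d * (norm x)\<^sup>2 \<le> q x"
proof -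
  obtain H \<epsilon> \<delta> where H: "csubspace H" "finite_codim H UNIV" "\<epsilon> > 0" "\<delta> > 0"
    "\<forall>x\<in>D \<inter> H. norm (T x) \<le> \<epsilon> * norm x \<longrightarrow> \<delta> * (norm x)\<^sup>2 \<le> q x"
    using pi by (auto simp: pi_type_def)
  have "\<exists>e>0. \<exists>d>0. \<forall>x\<in>D \<inter> W. norm (T x) \<le> e * norm x \<longrightarrow> d * (norm x)\<^sup>2 \<le> q x"
    by (rule uniformly_positive_near_kernel[OF closed_operator_restrict[OF T W] H(1-4)])
      (use H(5) ker in auto)
  then show thesis using that by blast
qed

lemma nonpositive_kernel_finite_dimensional:
  assumes pi: "pi_type G D T" and X: "csubspace X" "X \<subseteq> D"
    and ker: "\<And>x. x \<in> X \<Longrightarrow> T x = 0" and nonpos: "\<And>x. x \<in> X \<Longrightarrow> q x \<le> 0"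
  shows "finite_dimensional X"
proof -
  obtain H \<epsilon> \<delta> where H: "csubspace H" "finite_codim H UNIV" "\<epsilon> > 0" "\<delta> > 0"
    "\<forall>x\<in>D \<inter> H. norm (T x) \<le> \<epsilon> * norm x \<longrightarrow> \<delta> * (norm x)\<^sup>2 \<le> q x"
    using pi by (auto simp: pi_type_def)
  obtain B where B: "finite B" "UNIV \<subseteq> cspan (H \<union> B)" using H(2) by (auto simp: finite_codim_def)
  have "x = 0" if "x \<in> X" "x \<in> H" for x
  proof -
    have "norm (T x) \<le> \<epsilon> * norm x" using ker[OF that(1)] H(3) by simp
    then have "\<delta> * (norm x)\<^sup>2 \<le> 0" using H(5) nonpos[OF that(1)] that X(2) by force
    then show ?thesis using H(4) by (simp add: mult_le_0_iff)
  qed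
  then have "X \<inter> H \<subseteq> {0}" by blast
  moreover have "X \<subseteq> cspan (H \<union> B)" using B(2) by blast
  ultimately show ?thesis using finite_dimensional_of_trivial_meet[OF B(1) H(1) X(1)] by blast
qed

text \<open>On the part \<open>W\<close> of \<open>M\<close> orthogonal to \<open>Z\<close> there
  are no kernel vectors, so near-kernel vectors of \<open>W\<close> are uniformly positive; but
  \<open>q\<close> is nonpositive on \<open>M\<close>, so the only such vector is 0. Hence
  \<open>T\<close> is bounded below on \<open>W\<close>, and with preimages taken in
  \<open>W\<close> surjectivity passes from \<open>V\<close> to its closure.\<close>

lemma surjective_part_exists:
  assumes T: "closed_operator D T" and pi: "pi_type G D T"
    and V: "csubspace V" "V \<subseteq> D" and TV: "V \<subseteq> T ` V" and nonpos: "\<And>v. v \<in> V \<Longrightarrow> q v \<le> 0"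
  shows "\<exists>c. surjective_part D T (closure V) c"
proof -
  have lin: "linear_operator D T" using T by (simp add: closed_operator_def)
  note D = linear_operatorD(1)[OF lin] and Tdiff = linear_operatorD(5)[OF lin]
  define M where "M = closure V"
  have cM: "csubspace M" and clM: "closed M"
    unfolding M_def by (auto intro: csubspace_closure V(1))
  have VM: "V \<subseteq> M" unfolding M_def by (rule closure_subset)
  have nonposM: "q x \<le> 0" if "x \<in> M" for x
  proof -
    from that[unfolded M_def closure_sequential]
    obtain f where f: "\<forall>n. f n \<in> V" "f \<longlonglongrightarrow> x" by (elim exE conjE)
    then show ?thesis using nonpos by (intro LIMSEQ_le_const2[OF tendsto_q[OF f(2)]]) auto
  qed
  define Z where "Z = {x \<in> D \<inter> M. T x = 0}"
  have "op_kernel D T 0 \<inter> M = Z" by (auto simp: Z_def op_kernel_def)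
  then have cZ: "csubspace Z"
    using complex_vector.subspace_inter[OF csubspace_op_kernel[OF lin, of 0] cM] by simp
  have clZ: "closed Z"
    unfolding closed_sequential_limits
  proof (intro allI impI, elim conjE)
    fix f l assume f: "\<forall>n. f n \<in> Z" "f \<longlonglongrightarrow> l"
    then have "(\<lambda>n. T (f n)) \<longlonglongrightarrow> 0" by (simp add: Z_def)
    then have "l \<in> D" "T l = 0" using closed_operatorD[OF T _ f(2)] f(1) by (auto simp: Z_def)
    moreover have "l \<in> M" using f(1) by (intro closed_sequentially[OF clM _ f(2)]) (simp add: Z_def)
    ultimately show "l \<in> Z" by (simp add: Z_def)
  qed
  define W where "W = M \<inter> {x. \<forall>z\<in>Z. cinner x z = 0}"
  have cP: "csubspace {x. \<forall>z\<in>Z. cinner x z = 0}"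
    by (auto simp: complex_vector.subspace_def cinner_add_left cinner_scaleC_left
        bounded_bilinear.zero_left[OF bounded_bilinear_cinner])
  have "{x. \<forall>z\<in>Z. cinner x z = 0} = (\<Inter>z\<in>Z. (\<lambda>x. cinner x z) -` {0})" by auto
  moreover have "closed ((\<lambda>x. cinner x z) -` {0})" for z :: 'a
    by (intro continuous_closed_vimage closed_singleton)
      (auto intro!: linear_continuous_at bounded_bilinear.bounded_linear_left[OF bounded_bilinear_cinner])
  ultimately have "closed {x. \<forall>z\<in>Z. cinner x z = 0}" by auto
  then have W: "closed_csubspace W" unfolding W_def closed_csubspace_def
    using complex_vector.subspace_inter[OF cM cP] clM by auto
  have "x = 0" if "x \<in> D" "x \<in> W" "T x = 0" for x
  proof -
    have "x \<in> Z" using that by (simp add: W_def Z_def)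
    then have "cinner x x = 0" using that by (simp add: W_def)
    then show ?thesis by (simp add: cinner_self_real)
  qed
  then obtain e d where ed: "e > 0" "d > 0"
    "\<And>x. x \<in> D \<Longrightarrow> x \<in> W \<Longrightarrow> norm (T x) \<le> e * norm x \<Longrightarrow> d * (norm x)\<^sup>2 \<le> q x"
    using uniformly_positive_near_kernel_in[OF T pi W] by metis
  have lower: "norm x \<le> (1 / e) * norm (T x)" if x: "x \<in> D" "x \<in> W" for x
  proof (rule ccontr)
    assume n: "\<not> ?thesis"
    then have "norm (T x) \<le> e * norm x" using ed(1) by (simp add: field_simps)
    then have "d * (norm x)\<^sup>2 \<le> 0" using ed(3)[OF x] nonposM[of x] x by (simp add: W_def)
    then have "x = 0" using ed(2) by (simp add: mult_le_0_iff)
    then show False using n linear_operatorD(4)[OF lin] by simp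
  qed
  have onto: "\<exists>x\<in>D \<inter> M. T x = v" if "v \<in> M" for v
  proof -
    from that[unfolded M_def closure_sequential]
    obtain f where f: "\<forall>n. f n \<in> V" "f \<longlonglongrightarrow> v" by (elim exE conjE)
    \<comment> \<open>A preimage in \<open>V\<close> is corrected by its projection onto
      \<open>Z\<close>, which \<open>T\<close> annihilates, so that the lower bound on
      \<open>W\<close> applies to differences.\<close>
    have "\<exists>x. x \<in> D \<and> x \<in> W \<and> T x = f n" for n
    proof -
      obtain y where y: "y \<in> V" "T y = f n" using f(1) TV by (metis imageE subsetD)
      obtain p where p: "p \<in> Z" "\<forall>z\<in>Z. cinner (y - p) z = 0"
        using orthogonal_projection[of Z y] cZ clZ by (auto simp: closed_csubspace_def)
      have pD: "p \<in> D" "p \<in> M" "T p = 0" using p by (auto simp: Z_def)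
      have "y - p \<in> D" "y - p \<in> M" "T (y - p) = f n"
        using y pD V VM D cM by (auto simp: complex_vector.subspace_diff Tdiff subset_iff)
      then show ?thesis using p(2) by (intro exI[of _ "y - p"]) (simp add: W_def)
    qed
    then obtain x where x: "\<And>n. x n \<in> D" "\<And>n. x n \<in> W" "\<And>n. T (x n) = f n" by metis
    have dist_le: "dist (x m) (x n) \<le> (1 / e) * dist (f m) (f n)" for m n
      using lower[of "x m - x n"] x complex_vector.subspace_diff[OF D x(1) x(1)]
        complex_vector.subspace_diff[OF closed_csubspaceD(1)[OF W] x(2) x(2)]
      by (simp add: dist_norm Tdiff)
    have "0 < 1 / e" using ed(1) by simp
    from convergent_if_dist_le[OF LIMSEQ_imp_Cauchy[OF f(2)] this dist_le]
    obtain l where l: "x \<longlonglongrightarrow> l" .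
    have Tx: "(\<lambda>n. T (x n)) \<longlonglongrightarrow> v" using f(2) x(3) by simp
    have "l \<in> D" "T l = v" using closed_operatorD[OF T x(1) l Tx] by auto
    moreover have "l \<in> M" using x(2) by (intro closed_sequentially[OF clM _ l]) (simp add: W_def)
    ultimately show ?thesis by blast
  qed
  have "surjective_part D T M (1 / e)"
  proof (unfold_locales, goal_cases)
    case 1 show ?case by (rule lin)
  next
    case 2 show ?case using cM clM by (simp add: closed_csubspace_def)
  next
    case 3 show ?case using clZ by (simp add: Z_def)
  next
    case (4 v) then show ?case by (rule onto)
  next
    case 5 show ?case using ed(1) by simp
  next
    case (6 x)
    then have "x \<in> W" by (auto simp: W_def Z_def)
    then show ?case using lower[OF 6(1)] by simp
  qed
  then show ?thesis unfolding M_def by blast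
qed

lemma eigenvectors_orthogonal:
  assumes sym: "G_symmetric G D T" and ne: "\<mu> \<noteq> cnj \<nu>"
    and x: "x \<in> op_kernel D T \<mu>" and y: "y \<in> op_kernel D T \<nu>"
  shows "gip G x y = 0"
proof -
  have "gip G (T x) y = gip G x (T y)"
    using sym[unfolded G_symmetric_def] op_kernelD(1)[OF x] op_kernelD(1)[OF y] by blast
  then have "(\<mu> - cnj \<nu>) * gip G x y = 0"
    using op_kernelD(2)[OF x] op_kernelD(2)[OF y] by (simp add: left_diff_distrib)
  then show ?thesis using ne by simp
qed

text \<open>As 0 is excluded from \<Lambda>, division by the eigenvalue gives preimages inside
  \<open>V\<close>; orthogonality of different \<open>P \<mu>\<close> makes \<open>q\<close>
  additive, so the whole span is nonpositive and not merely each summand.\<close>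

lemma span_eigenvectors:
  assumes lin: "linear_operator D T"
    and P: "\<And>\<mu>. \<mu> \<in> \<Lambda> \<Longrightarrow> csubspace (P \<mu>)" "\<And>\<mu>. \<mu> \<in> \<Lambda> \<Longrightarrow> P \<mu> \<subseteq> op_kernel D T \<mu>"
    and nonpos: "\<And>\<mu> x. \<mu> \<in> \<Lambda> \<Longrightarrow> x \<in> P \<mu> \<Longrightarrow> q x \<le> 0"
    and nz: "0 \<notin> \<Lambda>"
    and orth: "\<And>\<mu> \<nu> x y. \<mu> \<in> \<Lambda> \<Longrightarrow> \<nu> \<in> \<Lambda> \<Longrightarrow> \<mu> \<noteq> \<nu> \<Longrightarrow> x \<in> P \<mu> \<Longrightarrow> y \<in> P \<nu> \<Longrightarrow> gip G x y = 0"
  defines "V \<equiv> cspan (\<Union>\<mu>\<in>\<Lambda>. P \<mu>)"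
  shows "V \<subseteq> D" "V \<subseteq> T ` V" "\<And>v. v \<in> V \<Longrightarrow> q v \<le> 0"
proof -
  note D = linear_operatorD(1)[OF lin]
  have cV: "csubspace V" unfolding V_def by (rule complex_vector.subspace_span)
  have PV: "P \<mu> \<subseteq> V" if "\<mu> \<in> \<Lambda>" for \<mu>
    using that unfolding V_def by (auto intro: complex_vector.span_base)
  have "(\<Union>\<mu>\<in>\<Lambda>. P \<mu>) \<subseteq> D" using P(2) op_kernelD(1) by blast
  then show VD: "V \<subseteq> D" unfolding V_def by (rule complex_vector.span_minimal[OF _ D])
  have "\<exists>y\<in>V. T y = v" if "v \<in> cspan (\<Union>\<mu>\<in>\<Lambda>. P \<mu>)" for v
    using that
  proof (induction rule: complex_vector.span_induct_alt)
    case base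
    show ?case using complex_vector.subspace_0[OF cV] linear_operatorD(4)[OF lin] by blast
  next
    case (step c s y)
    then obtain \<mu> z where \<mu>: "\<mu> \<in> \<Lambda>" "s \<in> P \<mu>" and z: "z \<in> V" "T z = y" by auto
    have s: "s \<in> D" "T s = \<mu> *\<^sub>C s" using op_kernelD subsetD[OF P(2)[OF \<mu>(1)] \<mu>(2)] by metis+
    have "\<mu> \<noteq> 0" using \<mu>(1) nz by auto
    have sV: "(c / \<mu>) *\<^sub>C s \<in> V"
      using subsetD[OF PV[OF \<mu>(1)] \<mu>(2)] by (rule complex_vector.subspace_scale[OF cV])
    have "T ((c / \<mu>) *\<^sub>C s + z) = c *\<^sub>C s + y"
      using subsetD[OF VD] sV z s \<open>\<mu> \<noteq> 0\<close> linear_operatorD(2,3)[OF lin] by (simp add: scaleC_scaleC)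
    then show ?case using complex_vector.subspace_add[OF cV sV z(1)] by blast
  qed
  then show "V \<subseteq> T ` V" unfolding V_def by force
  \<comment> \<open>One vector per eigenvalue, with \<open>g\<close> vanishing off \<open>F\<close>:
    a further term at an eigenvalue already present can be merged into its summand.\<close>
  have rep: "\<exists>F g. finite F \<and> F \<subseteq> \<Lambda> \<and> (\<forall>\<mu>\<in>\<Lambda>. g \<mu> \<in> P \<mu>) \<and> (\<forall>\<mu>. \<mu> \<notin> F \<longrightarrow> g \<mu> = 0) \<and> v = sum g F"
    if "v \<in> cspan (\<Union>\<mu>\<in>\<Lambda>. P \<mu>)" for v
    using that
  proof (induction rule: complex_vector.span_induct_alt)
    case base
    show ?case using complex_vector.subspace_0[OF P(1)]
      by (intro exI[of _ "{}"] exI[of _ "\<lambda>_. 0"]) auto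
  next
    case (step c s y)
    then obtain \<mu> F g where \<mu>: "\<mu> \<in> \<Lambda>" "s \<in> P \<mu>" and F: "finite F" "F \<subseteq> \<Lambda>"
      and g: "\<forall>\<mu>\<in>\<Lambda>. g \<mu> \<in> P \<mu>" "\<forall>\<mu>. \<mu> \<notin> F \<longrightarrow> g \<mu> = 0" "y = sum g F" by auto
    let ?g = "\<lambda>\<nu>. g \<nu> + (if \<nu> = \<mu> then c *\<^sub>C s else 0)"
    have "sum ?g (insert \<mu> F) = sum g (insert \<mu> F) + c *\<^sub>C s" using F(1) by (simp add: sum.distrib)
    also have "sum g (insert \<mu> F) = y"
      unfolding g(3) using F(1) g(2) by (intro sum.mono_neutral_right) auto
    finally have "c *\<^sub>C s + y = sum ?g (insert \<mu> F)" by (simp add: add.commute)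
    moreover have "\<forall>\<nu>\<in>\<Lambda>. ?g \<nu> \<in> P \<nu>"
      using g(1) \<mu> P(1) by (auto intro: complex_vector.subspace_add complex_vector.subspace_scale)
    ultimately show ?case using F g(2) \<mu>(1)
      by (intro exI[of _ "insert \<mu> F"] exI[of _ ?g]) auto
  qed
  have sum_nonpos: "q (sum g F) \<le> 0" if "finite F" "F \<subseteq> \<Lambda>" "\<forall>\<mu>\<in>\<Lambda>. g \<mu> \<in> P \<mu>" for F g
    using that
  proof (induction F)
    case (insert \<mu> F)
    have "gip G (g \<mu>) (sum g F) = (\<Sum>\<nu>\<in>F. gip G (g \<mu>) (g \<nu>))" by (rule gip.sum_right)
    also have "\<dots> = 0"
    proof (intro sum.neutral ballI)
      fix \<nu> assume "\<nu> \<in> F"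
      then show "gip G (g \<mu>) (g \<nu>) = 0" using insert by (intro orth[of \<mu> \<nu>]) auto
    qed
    finally have "q (sum g (insert \<mu> F)) = q (g \<mu>) + q (sum g F)" using insert by (simp add: q_add)
    then show ?case using insert nonpos[of \<mu> "g \<mu>"] by simp
  qed simp
  show "q v \<le> 0" if v: "v \<in> V" for v
    using rep[OF v[unfolded V_def]] sum_nonpos by blast
qed

end

section \<open>Local structure at an eigenvalue\<close>

context indefinite begin

lemma isotropic_part_op_kernel:
  assumes "x \<in> isotropic_part (gip G) (op_kernel D T \<mu>)"
  shows "x \<in> op_kernel D T \<mu>" "\<And>y. y \<in> op_kernel D T \<mu> \<Longrightarrow> gip G x y = 0"
  using assms by (auto simp: isotropic_part_def orth_companion_def)

lemma csubspace_isotropic_part: "csubspace L \<Longrightarrow> csubspace (isotropic_part (gip G) L)"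
  by (auto simp: complex_vector.subspace_def isotropic_part_def orth_companion_def
      gip.zero_left gip.add_left)

lemma isotropic_neutral: "x \<in> isotropic_part (gip G) L \<Longrightarrow> q x = 0"
  by (auto simp: isotropic_part_def orth_companion_def)

text \<open>The upper half plane suffices: eigenvectors to \<open>\<mu> \<noteq> cnj \<nu>\<close> are orthogonal, so the span below is
  nonpositive although eigenvectors to conjugate eigenvalues need not be orthogonal a priori.\<close>

lemma nonpositive_eigenvectors_isotropic:
  assumes T: "closed_operator D T" and sym: "G_symmetric G D T" and pi: "pi_type G D T"
  shows "\<exists>r>0. \<forall>\<mu>. \<mu> \<noteq> 0 \<longrightarrow> cmod \<mu> < r \<longrightarrow>
    (\<forall>x\<in>op_kernel D T \<mu>. q x \<le> 0 \<longrightarrow> x \<in> isotropic_part (gip G) (op_kernel D T \<mu>)) \<and>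
    (\<mu> \<noteq> cnj \<mu> \<longrightarrow> (\<forall>x\<in>op_kernel D T \<mu>. \<forall>y\<in>op_kernel D T (cnj \<mu>). gip G x y = 0))"
proof -
  have lin: "linear_operator D T" using T by (simp add: closed_operator_def)
  define bad where "bad \<mu> x \<longleftrightarrow> x \<in> op_kernel D T \<mu> \<and> q x \<le> 0 \<and>
    x \<notin> isotropic_part (gip G) (op_kernel D T \<mu>)" for \<mu> x
  \<comment> \<open>Nonreal eigenvectors are neutral, so the full kernel can be used there. At a
    real point the nonpositive vectors need not form a subspace; one nonpositive non-isotropic
    vector is enough for a contradiction.\<close>
  define \<Lambda> where "\<Lambda> = {\<mu>. Im \<mu> > 0} \<union> {\<mu>. \<mu> \<noteq> 0 \<and> Im \<mu> = 0 \<and> (\<exists>x. bad \<mu> x)}"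
  define y where "y \<mu> = (SOME x. bad \<mu> x)" for \<mu>
  define P where "P \<mu> = (if Im \<mu> > 0 then op_kernel D T \<mu> else cspan {y \<mu>})" for \<mu>
  have y: "bad \<mu> (y \<mu>)" if "\<mu> \<in> \<Lambda>" "\<not> Im \<mu> > 0" for \<mu>
  proof -
    have "\<exists>x. bad \<mu> x" using that by (auto simp: \<Lambda>_def)
    then show ?thesis unfolding y_def by (rule someI_ex)
  qed
  have cP: "csubspace (P \<mu>)" for \<mu>
    using csubspace_op_kernel[OF lin] complex_vector.subspace_span by (simp add: P_def)
  have PN: "P \<mu> \<subseteq> op_kernel D T \<mu>" if "\<mu> \<in> \<Lambda>" for \<mu>
  proof (cases "Im \<mu> > 0")
    case False
    then have "{y \<mu>} \<subseteq> op_kernel D T \<mu>" using y[OF that] by (simp add: bad_def)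
    then show ?thesis
      using False complex_vector.span_minimal[OF _ csubspace_op_kernel[OF lin]] by (simp add: P_def)
  qed (simp add: P_def)
  have nonpos: "q x \<le> 0" if "\<mu> \<in> \<Lambda>" "x \<in> P \<mu>" for \<mu> x
  proof (cases "Im \<mu> > 0")
    case True
    then have "\<mu> \<noteq> cnj \<mu>" by (auto simp: complex_eq_iff)
    then show ?thesis using eigenvectors_orthogonal[OF sym] subsetD[OF PN[OF that(1)] that(2)] by fastforce
  next
    case False
    then have "x \<in> range (\<lambda>k. k *\<^sub>C y \<mu>)"
      using that(2) complex_vector.span_singleton[of "y \<mu>"] by (simp add: P_def)
    then obtain k where k: "x = k *\<^sub>C y \<mu>" by auto
    show ?thesis unfolding k q_scaleC
      using y[OF that(1) False] by (intro mult_nonneg_nonpos) (auto simp: bad_def)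
  qed
  have orth: "gip G x z = 0" if "\<mu> \<in> \<Lambda>" "\<nu> \<in> \<Lambda>" "\<mu> \<noteq> \<nu>" "x \<in> P \<mu>" "z \<in> P \<nu>" for \<mu> \<nu> x z
  proof (rule eigenvectors_orthogonal[OF sym])
    show "\<mu> \<noteq> cnj \<nu>" using that(1-3) by (auto simp: \<Lambda>_def complex_eq_iff)
  qed (use PN that in blast)+
  have nz: "0 \<notin> \<Lambda>" by (auto simp: \<Lambda>_def)
  define V where "V = cspan (\<Union>\<mu>\<in>\<Lambda>. P \<mu>)"
  note spanV = span_eigenvectors[of D T \<Lambda> P, OF lin cP PN nonpos nz orth, folded V_def]
  have cV: "csubspace V" unfolding V_def by (rule complex_vector.subspace_span)
  have "V \<subseteq> D" "V \<subseteq> T ` V" "\<And>v. v \<in> V \<Longrightarrow> q v \<le> 0"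
    by (rule spanV; assumption)+
  from surjective_part_exists[OF T pi cV this]
  obtain c where "surjective_part D T (closure V) c" by blast
  then interpret S: surjective_part D T "closure V" "{x \<in> D \<inter> closure V. T x = 0}" c .
  have PV: "x \<in> closure V" if "\<mu> \<in> \<Lambda>" "x \<in> P \<mu>" for x \<mu>
  proof -
    have "x \<in> V" unfolding V_def using that by (intro complex_vector.span_base) auto
    then show ?thesis using closure_subset by blast
  qed
  \<comment> \<open>Only \<nu> has to be small. Taking \<open>\<nu> = \<mu>\<close> excludes bad
    vectors, and \<open>\<nu> = cnj \<mu>\<close> gives orthogonality across conjugate
    pairs.\<close>
  have zero: "gip G x z = 0" if "\<mu> \<in> \<Lambda>" "x \<in> P \<mu>" "cmod \<nu> < 1 / c" "z \<in> op_kernel D T \<nu>" for x z \<mu> \<nu>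
    using that S.c by (intro S.gip_eigenvector_zero[OF sa sym, of \<nu>] PV[of \<mu>])
      (auto simp: op_kernelD field_simps)
  have "x \<in> isotropic_part (gip G) (op_kernel D T \<mu>)"
    if \<mu>: "\<mu> \<noteq> 0" "cmod \<mu> < 1 / c" and x: "x \<in> op_kernel D T \<mu>" "q x \<le> 0" for \<mu> x
  proof (cases "\<mu> = cnj \<mu>")
    case False
    then show ?thesis using eigenvectors_orthogonal[OF sym False] x(1)
      by (auto simp: isotropic_part_def orth_companion_def)
  next
    case True
    then have re: "Im \<mu> = 0" by (simp add: complex_eq_iff)
    show ?thesis
    proof (rule ccontr)
      assume "\<not> ?thesis"
      then have "bad \<mu> x" using x by (simp add: bad_def)
      then have "\<mu> \<in> \<Lambda>" using re \<mu>(1) by (auto simp: \<Lambda>_def)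
      then have b: "bad \<mu> (y \<mu>)" "y \<mu> \<in> P \<mu>"
        using y re by (auto simp: P_def complex_vector.span_base)
      \<comment> \<open>The chosen bad vector belongs to the closed span and is therefore orthogonal
        to the whole kernel at \<mu>, contrary to its choice.\<close>
      have "y \<mu> \<in> isotropic_part (gip G) (op_kernel D T \<mu>)"
        using b zero[OF \<open>\<mu> \<in> \<Lambda>\<close> b(2) \<mu>(2)] by (auto simp: bad_def isotropic_part_def orth_companion_def)
      then show False using b(1) by (simp add: bad_def)
    qed
  qed
  moreover have "gip G x z = 0"
    if \<mu>: "\<mu> \<noteq> cnj \<mu>" "cmod \<mu> < 1 / c" and x: "x \<in> op_kernel D T \<mu>" "z \<in> op_kernel D T (cnj \<mu>)" for \<mu> x z
  proof (cases "Im \<mu> > 0")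
    case True
    then show ?thesis using zero[of \<mu> x "cnj \<mu>" z] \<mu> x by (simp add: \<Lambda>_def P_def)
  next
    case False
    then have "Im (cnj \<mu>) > 0" using \<mu>(1) by (auto simp: complex_eq_iff)
    then have "gip G z x = 0" using zero[of "cnj \<mu>" z \<mu> x] \<mu> x by (simp add: \<Lambda>_def P_def)
    then show ?thesis by (simp add: gip_zero_commute)
  qed
  moreover have "1 / c > 0" using S.c by simp
  ultimately show ?thesis by (intro exI[of _ "1 / c"]) blast
qed

text \<open>The number \<alpha> is the dimension of \<open>ker T\<close> within the closed span of
  all isotropic parts in the punctured disc. \<open>S.eig \<mu>\<close> has this dimension
  throughout the smaller disc and lies in the isotropic part; the two agree off 0, while at 0 only
  the inclusion is available.\<close>

lemma local_structure:
  assumes T: "closed_operator D T" and sym: "G_symmetric G D T" and pi: "pi_type G D T"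
  shows "\<exists>r>0. \<exists>\<alpha>.
    (\<forall>\<mu>. \<mu> \<noteq> 0 \<longrightarrow> cmod \<mu> < r \<longrightarrow> kappa_zero (gip G) (op_kernel D T \<mu>) = enat \<alpha> \<and>
      (\<forall>x\<in>op_kernel D T \<mu>. q x \<le> 0 \<longrightarrow> x \<in> isotropic_part (gip G) (op_kernel D T \<mu>))) \<and>
    enat \<alpha> \<le> kappa_zero (gip G) (op_kernel D T 0) \<and>
    (\<forall>\<mu>. cmod \<mu> < r \<longrightarrow>
      (\<exists>x. (\<forall>j<\<alpha>. infinite_jordan_chain D T \<mu> (x j)) \<and> independent_chains \<alpha> x)) \<and>
    (\<alpha> = 0 \<longrightarrow> \<not> (\<exists>x. infinite_jordan_chain D T 0 x))"
proof -
  have lin: "linear_operator D T" using T by (simp add: closed_operator_def)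
  let ?N = "op_kernel D T" and ?I = "\<lambda>\<mu>. isotropic_part (gip G) (op_kernel D T \<mu>)"
  have cN: "csubspace (?N \<mu>)" for \<mu> by (rule csubspace_op_kernel[OF lin])
  have cI: "csubspace (?I \<mu>)" for \<mu> by (rule csubspace_isotropic_part[OF cN])
  obtain r where r: "r > 0"
    and iso: "\<And>\<mu> x. \<mu> \<noteq> 0 \<Longrightarrow> cmod \<mu> < r \<Longrightarrow> x \<in> ?N \<mu> \<Longrightarrow> q x \<le> 0 \<Longrightarrow> x \<in> ?I \<mu>"
    and cross: "\<And>\<mu> x y. \<mu> \<noteq> cnj \<mu> \<Longrightarrow> cmod \<mu> < r \<Longrightarrow> x \<in> ?N \<mu> \<Longrightarrow> y \<in> ?N (cnj \<mu>) \<Longrightarrow> gip G x y = 0"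
    using nonpositive_eigenvectors_isotropic[OF T sym pi] by (metis complex_cnj_zero)
  define \<Lambda> where "\<Lambda> = {\<mu>. \<mu> \<noteq> 0 \<and> cmod \<mu> < r}"
  have orth: "gip G x z = 0" if "\<mu> \<in> \<Lambda>" "\<nu> \<in> \<Lambda>" "\<mu> \<noteq> \<nu>" "x \<in> ?I \<mu>" "z \<in> ?I \<nu>" for \<mu> \<nu> x z
  proof (cases "\<mu> = cnj \<nu>")
    case True
    then show ?thesis using cross[of \<mu> x z] that isotropic_part_op_kernel(1) by (auto simp: \<Lambda>_def)
  next
    case False
    then show ?thesis
      using eigenvectors_orthogonal[OF sym False] that(4,5) isotropic_part_op_kernel(1) by blast
  qed
  have IN: "?I \<mu> \<subseteq> ?N \<mu>" for \<mu> by (auto simp: isotropic_part_def)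
  have Inonpos: "q x \<le> 0" if "x \<in> ?I \<mu>" for x \<mu> using isotropic_neutral[OF that] by simp
  have nz: "0 \<notin> \<Lambda>" by (auto simp: \<Lambda>_def)
  \<comment> \<open>Unlike in the preceding lemma both half planes occur, because
    \<open>cross\<close> now covers conjugate eigenvalues.\<close>
  define V where "V = cspan (\<Union>\<mu>\<in>\<Lambda>. ?I \<mu>)"
  note spanV = span_eigenvectors[of D T \<Lambda> ?I, OF lin cI IN Inonpos nz orth, folded V_def]
  have cV: "csubspace V" unfolding V_def by (rule complex_vector.subspace_span)
  have "V \<subseteq> D" "V \<subseteq> T ` V" and Vnonpos: "\<And>v. v \<in> V \<Longrightarrow> q v \<le> 0"
    by (rule spanV; assumption)+
  from surjective_part_exists[OF T pi cV this]
  obtain c where "surjective_part D T (closure V) c" by blast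
  then interpret S: surjective_part D T "closure V" "{x \<in> D \<inter> closure V. T x = 0}" c .
  let ?Z = "{x \<in> D \<inter> closure V. T x = 0}"
  have ZN: "?Z \<subseteq> ?N 0" by (auto simp: op_kernel_def)
  have eigI: "S.eig \<mu> \<subseteq> ?I \<mu>" if "cmod \<mu> * c < 1" for \<mu>
    using S.gip_eigenvector_zero[OF sa sym that]
    by (auto simp: S.eig_def isotropic_part_def orth_companion_def op_kernel_def)
  have Z_eig: "?Z = S.eig 0" by (auto simp: S.eig_def)
  have fdZ: "finite_dimensional ?Z"
    using eigI[of 0] Inonpos
    by (intro nonpositive_kernel_finite_dimensional[OF pi S.Z]) (auto simp: Z_eig S.eig_def)
  define \<alpha> where "\<alpha> = cdim ?Z"
  have edZ: "edim ?Z = enat \<alpha>" using fdZ by (simp add: edim_def \<alpha>_def)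
  define r' where "r' = min r (1 / c)"
  have r': "r' > 0" "\<And>\<mu>. cmod \<mu> < r' \<Longrightarrow> cmod \<mu> * c < 1"
    using r S.c by (auto simp: r'_def field_simps)
  have edeig: "edim (S.eig \<mu>) = enat \<alpha>" if "cmod \<mu> < r'" for \<mu>
    using S.edim_eig[OF r'(2)[OF that] fdZ] edZ by simp
  \<comment> \<open>One inclusion is orthogonality to the closed span; the other holds because this
    isotropic part was put into \<open>V\<close>, which was not done at 0.\<close>
  have "S.eig \<mu> = ?I \<mu>" if \<mu>: "\<mu> \<noteq> 0" "cmod \<mu> < r'" for \<mu>
  proof
    show "S.eig \<mu> \<subseteq> ?I \<mu>" by (rule eigI[OF r'(2)[OF \<mu>(2)]])
    have "\<mu> \<in> \<Lambda>" using \<mu> by (simp add: \<Lambda>_def r'_def)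
    then have "?I \<mu> \<subseteq> V" unfolding V_def by (auto intro: complex_vector.span_base)
    then have "?I \<mu> \<subseteq> closure V" using closure_subset by (rule order_trans)
    then have "?I \<mu> \<subseteq> ?N \<mu> \<inter> closure V" using IN[of \<mu>] by simp
    also have "\<dots> \<subseteq> S.eig \<mu>" by (auto simp: S.eig_def op_kernel_def)
    finally show "?I \<mu> \<subseteq> S.eig \<mu>" .
  qed
  then have kz: "kappa_zero (gip G) (?N \<mu>) = enat \<alpha>" if "\<mu> \<noteq> 0" "cmod \<mu> < r'" for \<mu>
    using edeig[OF that(2)] that by (simp add: kappa_zero_def)
  have "enat \<alpha> \<le> kappa_zero (gip G) (?N 0)"
    unfolding kappa_zero_def edZ[symmetric] Z_eig using eigI[of 0] by (intro edim_mono) auto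
  moreover have "\<exists>x. (\<forall>j<\<alpha>. infinite_jordan_chain D T \<mu> (x j)) \<and> independent_chains \<alpha> x"
    if \<mu>: "cmod \<mu> < r'" for \<mu>
  proof -
    have fde: "finite_dimensional (S.eig \<mu>)" "cdim (S.eig \<mu>) = \<alpha>"
      using edeig[OF \<mu>] by (auto simp: edim_def split: if_splits)
    obtain E where E: "finite E" "E \<subseteq> S.eig \<mu>" "\<not> cdependent E" "card E = \<alpha>"
      using finite_dimensional_basis[OF fde(1)] fde(2) by metis
    obtain e where e: "bij_betw e {..<\<alpha>} E"
      using ex_bij_betw_nat_finite[OF E(1)] E(4) by (auto simp: atLeast0LessThan)
    have eE: "e j \<in> S.eig \<mu>" "e j \<noteq> 0" if "j < \<alpha>" for j
    proof -
      have "e j \<in> E" using e that by (auto simp: bij_betw_def)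
      then show "e j \<in> S.eig \<mu>" "e j \<noteq> 0"
        using subsetD[OF E(2)] E(3) complex_vector.dependent_zero[of E] by auto
    qed
    have "\<forall>j. \<exists>x. j < \<alpha> \<longrightarrow> infinite_jordan_chain D T \<mu> x \<and> x 0 = e j"
      using S.infinite_chain_from[OF r'(2)[OF \<mu>]] eE by blast
    then obtain x where x: "\<And>j. j < \<alpha> \<Longrightarrow> infinite_jordan_chain D T \<mu> (x j)" "\<And>j. j < \<alpha> \<Longrightarrow> x j 0 = e j"
      by metis
    have linS: "linear_operator D (\<lambda>y. T y - \<mu> *\<^sub>C y)"
      using linear_operatorD[OF lin] by (simp add: linear_operator_def scaleC_add_right scaleC_scaleC
          complex_vector.scale_right_diff_distrib mult.commute)
    have img: "(\<lambda>j. x j 0) ` {..<\<alpha>} = E" using x(2) e by (auto simp: bij_betw_def)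
    have "independent_chains \<alpha> x"
    proof (rule independent_chainsI[OF linS])
      show "inj_on (\<lambda>j. x j 0) {..<\<alpha>}" using x(2) e by (auto simp: bij_betw_def inj_on_def)
      show "\<not> cdependent ((\<lambda>j. x j 0) ` {..<\<alpha>})" using img E(3) by simp
      fix j i assume j: "j < \<alpha>"
      note ch = x(1)[OF j, unfolded infinite_jordan_chain_def]
      show "x j i \<in> D" "T (x j 0) - \<mu> *\<^sub>C x j 0 = 0" using ch by auto
      show "T (x j (Suc i)) - \<mu> *\<^sub>C x j (Suc i) = x j i"
        using conjunct2[OF conjunct2[OF ch], rule_format, of "Suc i"] by simp
    qed
    then show ?thesis using x(1) by blast
  qed
  moreover have "\<not> infinite_jordan_chain D T 0 x" if \<alpha>0: "\<alpha> = 0" for x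
  proof
    assume "infinite_jordan_chain D T 0 x"
    then have xD: "\<And>i. x i \<in> D" and x0: "x 0 \<noteq> 0" "T (x 0) = 0" and xS: "\<And>i. T (x (Suc i)) = x i"
      unfolding infinite_jordan_chain_def by (auto dest: spec[of _ "Suc _"])
    \<comment> \<open>Moving \<open>T\<close> across the form raises the first index and lowers the
      second, until it meets \<open>T (x 0) = 0\<close>.\<close>
    have shift: "gip G (x i) (x j) = 0" for i j
    proof (induction j arbitrary: i)
      case 0
      have "gip G (T (x (Suc i))) (x 0) = gip G (x (Suc i)) (T (x 0))"
        using sym[unfolded G_symmetric_def] xD by blast
      then show ?case by (simp add: xS x0 gip.zero_right)
    next
      case (Suc j)
      have "gip G (T (x (Suc i))) (x (Suc j)) = gip G (x (Suc i)) (T (x (Suc j)))"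
        using sym[unfolded G_symmetric_def] xD by blast
      then show ?case using Suc by (simp add: xS)
    qed
    define X where "X = cspan (range x)"
    have cX: "csubspace X" unfolding X_def by (rule complex_vector.subspace_span)
    have XD: "X \<subseteq> D" unfolding X_def
      using xD by (intro complex_vector.span_minimal linear_operatorD(1)[OF lin]) auto
    have "\<exists>y\<in>X. T y = v" if "v \<in> cspan (range x)" for v
      using that
    proof (induction rule: complex_vector.span_induct_alt)
      case base
      show ?case using complex_vector.subspace_0[OF cX] linear_operatorD(4)[OF lin] by blast
    next
      case (step k s y)
      then obtain i z where i: "s = x i" and z: "z \<in> X" "T z = y" by auto
      have xX: "x (Suc i) \<in> X" unfolding X_def by (intro complex_vector.span_base) simp
      have "T (k *\<^sub>C x (Suc i) + z) = k *\<^sub>C s + y"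
        using xD z XD xS i linear_operatorD(2,3)[OF lin]
          complex_vector.subspace_scale[OF linear_operatorD(1)[OF lin] xD] by (simp add: subset_iff)
      moreover have "k *\<^sub>C x (Suc i) + z \<in> X"
        using xX z cX by (simp add: complex_vector.subspace_add complex_vector.subspace_scale)
      ultimately show ?case by blast
    qed
    then have TX: "X \<subseteq> T ` X" unfolding X_def by force
    have x_orth: "gip G (x i) v = 0" if "v \<in> cspan (range x)" for v i
      using that
      by (induction rule: complex_vector.span_induct_alt) (auto simp: gip.zero_right gip.add_right shift)
    have "gip G v w = 0" if "v \<in> cspan (range x)" "w \<in> X" for v w
      using that(1)
      by (induction rule: complex_vector.span_induct_alt)
        (use that(2) in \<open>auto simp: gip.zero_left gip.add_left x_orth X_def\<close>)
    then have "q v \<le> 0" if "v \<in> X" for v using that by (simp add: X_def)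
    from surjective_part_exists[OF T pi cX XD TX this]
    obtain c' where "surjective_part D T (closure X) c'" by blast
    then interpret S': surjective_part D T "closure X" "{x \<in> D \<inter> closure X. T x = 0}" c' .
    have eigI': "S'.eig \<mu> \<subseteq> ?I \<mu>" if "cmod \<mu> * c' < 1" for \<mu>
      using S'.gip_eigenvector_zero[OF sa sym that]
      by (auto simp: S'.eig_def isotropic_part_def orth_companion_def op_kernel_def)
    have Z_eig': "{x \<in> D \<inter> closure X. T x = 0} = S'.eig 0" by (auto simp: S'.eig_def)
    have fdZ': "finite_dimensional {x \<in> D \<inter> closure X. T x = 0}"
      using eigI'[of 0] Inonpos
      by (intro nonpositive_kernel_finite_dimensional[OF pi S'.Z]) (auto simp: Z_eig' S'.eig_def)
    have "x 0 \<in> X" unfolding X_def by (intro complex_vector.span_base) simp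
    then have "x 0 \<in> {x \<in> D \<inter> closure X. T x = 0}" using xD x0 closure_subset by auto
    then have Z0: "edim {x \<in> D \<inter> closure X. T x = 0} \<noteq> 0" using edim_eq_0_iff[OF S'.Z] x0 by blast
    define t where "t = min r' (1 / c') / 2"
    define \<mu> where "\<mu> = complex_of_real t"
    have "0 < min r' (1 / c')" using r' S'.c by simp
    moreover have "0 < s / 2 \<and> s / 2 < s" if "0 < s" for s :: real using that by simp
    ultimately have t: "0 < t \<and> t < min r' (1 / c')" unfolding t_def by blast
    then have \<mu>: "\<mu> \<noteq> 0" "cmod \<mu> < r'" "cmod \<mu> < 1 / c'" by (auto simp: \<mu>_def)
    then have \<mu>c: "cmod \<mu> * c' < 1" using S'.c by (simp add: field_simps)
    \<comment> \<open>The kernel found at 0 persists, with its dimension, at the nearby nonzero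
      \<mu>, where it lies in an isotropic part of dimension \<open>\<alpha> = 0\<close>.\<close>
    have "edim (S'.eig \<mu>) \<le> edim (?I \<mu>)" by (intro edim_mono eigI' \<mu>c)
    also have "\<dots> = 0" using kz[OF \<mu>(1,2)] \<alpha>0 by (simp add: kappa_zero_def zero_enat_def)
    finally show False using S'.edim_eig[OF \<mu>c fdZ'] Z0 by simp
  qed
  moreover have "\<forall>x\<in>?N \<mu>. q x \<le> 0 \<longrightarrow> x \<in> ?I \<mu>" if "\<mu> \<noteq> 0" "cmod \<mu> < r'" for \<mu>
    using iso that by (simp add: r'_def)
  ultimately show ?thesis using r'(1) kz by (intro exI[of _ r'] exI[of _ \<alpha>] conjI) blast+
qed

end

section \<open>Nilpotent operators and spectral points of type pi-plus\<close>

text \<open>Pointwise nilpotency becomes uniform. The spaces \<open>Z k\<close> of kernel vectors in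
  the range of the \<open>k\<close>-th power decrease and are finite-dimensional, so they are
  constant from some \<open>p\<close> on. A nonzero vector in \<open>Z p\<close> would lie in all
  ranges and start an infinite chain; hence \<open>Z p\<close> is trivial, the \<open>p\<close>-th
  power vanishes, and its kernel is finite-dimensional.\<close>

lemma nilpotent_finite_dimensional:
  fixes W :: "'a::chilbert_space set" and T :: "'a \<Rightarrow> 'a"
  assumes W: "csubspace W" and TW: "\<And>x. x \<in> W \<Longrightarrow> T x \<in> W"
    and add: "\<And>x y. x \<in> W \<Longrightarrow> y \<in> W \<Longrightarrow> T (x + y) = T x + T y"
    and scale: "\<And>c x. x \<in> W \<Longrightarrow> T (c *\<^sub>C x) = c *\<^sub>C T x"
    and nil: "\<And>x. x \<in> W \<Longrightarrow> \<exists>n. (T ^^ n) x = 0"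
    and ker: "finite_dimensional {x\<in>W. T x = 0}"
    and no_chain: "\<not> (\<exists>x. (\<forall>i. x i \<in> W) \<and> x 0 \<noteq> 0 \<and> T (x 0) = 0 \<and> (\<forall>i. T (x (Suc i)) = x i))"
  shows "finite_dimensional W"
proof -
  have lin: "linear_operator W T" using W add scale by (simp add: linear_operator_def)
  note T0 = linear_operatorD(4)[OF lin] and Tdiff = linear_operatorD(5)[OF lin]
  have pow: "(T ^^ n) x \<in> W" if "x \<in> W" for n x using that TW by (induction n) auto
  have linpow: "linear_operator W (T ^^ n)" for n
  proof (induction n)
    case (Suc n)
    then show ?case using pow by (auto simp: linear_operator_def add scale)
  qed (simp add: linear_operator_def W)
  define R where "R k = (T ^^ k) ` W" for k
  have R_sub: "csubspace (R k)" for k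
    unfolding complex_vector.subspace_def
  proof (intro conjI ballI allI)
    show "0 \<in> R k" unfolding R_def
      using complex_vector.subspace_0[OF W] linear_operatorD(4)[OF linpow[of k]] by (metis imageI)
  next
    fix x y assume "x \<in> R k" "y \<in> R k"
    then obtain x' y' where "x' \<in> W" "y' \<in> W" "x = (T ^^ k) x'" "y = (T ^^ k) y'" by (auto simp: R_def)
    then show "x + y \<in> R k" unfolding R_def
      using linear_operatorD(2)[OF linpow[of k], of x' y'] complex_vector.subspace_add[OF W, of x' y'] by (metis imageI)
  next
    fix c x assume "x \<in> R k"
    then obtain x' where "x' \<in> W" "x = (T ^^ k) x'" by (auto simp: R_def)
    then show "c *\<^sub>C x \<in> R k" unfolding R_def
      using linear_operatorD(3)[OF linpow[of k], of x' c] complex_vector.subspace_scale[OF W, of x' c] by (metis imageI)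
  qed
  have RW: "R k \<subseteq> W" for k using pow by (auto simp: R_def)
  have R_Suc: "R (Suc k) = T ` R k" for k by (auto simp: R_def)
  have R_Suc_sub: "R (Suc k) \<subseteq> R k" for k
    using TW unfolding R_def by (auto simp: funpow_Suc_right simp del: funpow.simps)
  have R_dec: "R n \<subseteq> R m" if "m \<le> n" for m n using R_Suc_sub that by (rule lift_Suc_antimono_le)
  define Z where "Z k = {x\<in>W. T x = 0} \<inter> R k" for k
  have kW: "csubspace {x\<in>W. T x = 0}"
    using W T0 add scale by (auto simp: complex_vector.subspace_def)
  have Z_sub: "csubspace (Z k)" for k
    unfolding Z_def by (rule complex_vector.subspace_inter[OF kW R_sub])
  have Z_fd: "finite_dimensional (Z k)" for k
    by (rule finite_dimensional_subset[OF ker]) (auto simp: Z_def)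
  define p where "p = arg_min (\<lambda>k. cdim (Z k)) (\<lambda>_. True)"
  have p_min: "cdim (Z p) \<le> cdim (Z k)" for k unfolding p_def by (rule arg_min_nat_le) simp
  have Z_stable: "Z k = Z p" if "p \<le> k" for k
  proof (rule csubspace_cdim_equal[OF Z_sub _ Z_fd])
    show sub: "Z k \<subseteq> Z p" using R_dec[OF that] by (auto simp: Z_def)
    have "edim (Z k) \<le> edim (Z p)" by (rule edim_mono[OF sub])
    then show "cdim (Z k) = cdim (Z p)" using p_min[of k] Z_fd by (simp add: edim_def)
  qed
  have "Z p \<subseteq> {0}"
  proof (rule ccontr)
    assume "\<not> Z p \<subseteq> {0}"
    then obtain z where z: "z \<in> Z p" "z \<noteq> 0" by auto
    define N where "N = (\<Inter>k. R k)"
    have RN: "x \<in> N" if "\<And>k. p \<le> k \<Longrightarrow> x \<in> R k" for x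
      unfolding N_def using that R_dec by (metis INT_I linear subsetD)
    have "z \<in> R k" if "p \<le> k" for k using Z_stable[OF that] z(1) by (auto simp: Z_def)
    then have zN: "z \<in> N" by (rule RN)
    \<comment> \<open>\<open>T\<close> maps the intersection of all ranges onto itself: the preimage
      found in \<open>R p\<close> differs from the one in \<open>R k\<close> by an element of
      \<open>Z p = Z k\<close>, so it works for every \<open>k\<close>.\<close>
    have step: "\<exists>y. y \<in> N \<and> T y = x" if x: "x \<in> N" for x
    proof -
      have "\<exists>y\<in>R k. T y = x" for k
      proof -
        have "x \<in> T ` R k" using x R_Suc[of k] by (auto simp: N_def)
        then show ?thesis by blast
      qed
      then obtain y where y: "\<And>k. y k \<in> R k" "\<And>k. T (y k) = x" by metis
      have "y p \<in> R k" if k: "p \<le> k" for k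
      proof -
        have yW: "y k \<in> W" "y p \<in> W" using y(1) RW by blast+
        have "y p - y k \<in> R p"
          using R_dec[OF k] y(1) by (intro complex_vector.subspace_diff[OF R_sub]) auto
        moreover have "T (y p - y k) = 0" using yW y(2) by (simp add: Tdiff)
        ultimately have "y p - y k \<in> Z p" using RW by (auto simp: Z_def)
        then have "y p - y k \<in> R k" using Z_stable[OF k] by (auto simp: Z_def)
        from complex_vector.subspace_add[OF R_sub y(1)[of k] this] show ?thesis by simp
      qed
      then have "y p \<in> N" by (rule RN)
      then show ?thesis using y(2) by blast
    qed
    then obtain f where f: "\<And>x. x \<in> N \<Longrightarrow> f x \<in> N \<and> T (f x) = x" by metis
    define x where "x n = (f ^^ n) z" for n
    have xN: "x n \<in> N" for n using f zN by (induction n) (simp_all add: x_def)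
    have "x n \<in> W" for n using xN[of n] RW[of 0] by (auto simp: N_def)
    moreover have "T (x (Suc n)) = x n" for n using f[OF xN[of n]] by (simp add: x_def)
    moreover have "x 0 \<noteq> 0" "T (x 0) = 0" using z by (auto simp: x_def Z_def)
    ultimately show False using no_chain by blast
  qed
  have vanish: "(T ^^ p) x = 0" if x: "x \<in> W" for x
  proof (rule ccontr)
    assume nz: "(T ^^ p) x \<noteq> 0"
    \<comment> \<open>The last nonzero iterate is a kernel vector in the range of a power not below
      \<open>p\<close>, hence in the trivial stable \<open>Z p\<close>.\<close>
    define m where "m = (LEAST n. (T ^^ n) x = 0)"
    have m0: "(T ^^ m) x = 0" unfolding m_def using LeastI_ex[OF nil[OF x]] .
    have zero_up: "(T ^^ n) x = 0" if "m \<le> n" for n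
      using that m0 T0 by (induction n rule: dec_induct) simp_all
    then have "p < m" using nz by (meson not_le)
    then obtain k where k: "m = Suc k" "p \<le> k" by (metis less_Suc_eq_le Suc_pred not_gr_zero not_less_zero)
    have "(T ^^ k) x \<noteq> 0" using not_less_Least[of k "\<lambda>n. (T ^^ n) x = 0"] k(1) by (simp add: m_def)
    moreover have "(T ^^ k) x \<in> Z k" using m0 x pow[OF x] k(1) by (auto simp: Z_def R_def)
    ultimately show False using Z_stable[OF k(2)] \<open>Z p \<subseteq> {0}\<close> by auto
  qed
  have "finite_dimensional {x\<in>W. (T ^^ k) x = 0}" for k
  proof (induction k)
    case 0
    have "{x\<in>W. (T ^^ 0) x = 0} \<subseteq> cspan {}" by auto
    then show ?case by (rule finite_dimensionalI[OF finite.emptyI])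
  next
    case (Suc k)
    let ?X = "{x\<in>W. (T ^^ Suc k) x = 0}"
    have X: "csubspace ?X"
      using csubspace_op_kernel[OF linpow[of "Suc k"], of 0] by (simp add: op_kernel_def)
    show ?case
    proof (rule finite_dimensional_extension[OF X])
      have "T ` ?X \<subseteq> {x\<in>W. (T ^^ k) x = 0}"
        using TW by (auto simp: funpow_Suc_right simp del: funpow.simps)
      then show "finite_dimensional (T ` ?X)" by (rule finite_dimensional_subset[OF Suc.IH])
      show "finite_dimensional {x\<in>?X. T x = 0}" by (rule finite_dimensional_subset[OF ker]) auto
    qed (auto simp: add scale)
  qed
  then have "finite_dimensional {x\<in>W. (T ^^ p) x = 0}" .
  moreover have "{x\<in>W. (T ^^ p) x = 0} = W" using vanish by auto
  ultimately show ?thesis by simp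
qed

section \<open>Shifted operators and spectral points of positive type\<close>

abbreviation shifted :: "('a::chilbert_space \<Rightarrow> 'a) \<Rightarrow> complex \<Rightarrow> 'a \<Rightarrow> 'a" where
  "shifted A \<mu> \<equiv> (\<lambda>x. A x - \<mu> *\<^sub>C x)"

lemma linear_operator_shifted:
  assumes "linear_operator D A" shows "linear_operator D (shifted A \<mu>)"
  using linear_operatorD[OF assms] by (simp add: linear_operator_def scaleC_add_right scaleC_scaleC
      complex_vector.scale_right_diff_distrib mult.commute)

lemma closed_operator_shifted:
  assumes "closed_operator D A" shows "closed_operator D (shifted A \<mu>)"
  unfolding closed_operator_def
proof
  show "linear_operator D (shifted A \<mu>)"
    using assms by (intro linear_operator_shifted) (simp add: closed_operator_def)
  show "closed ((\<lambda>x. (x, shifted A \<mu> x)) ` D)"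
    unfolding closed_sequential_limits
  proof (intro allI impI, elim conjE)
    fix f l assume f: "\<forall>n. f n \<in> (\<lambda>x. (x, shifted A \<mu> x)) ` D" "f \<longlonglongrightarrow> l"
    have fD: "fst (f n) \<in> D" "snd (f n) = shifted A \<mu> (fst (f n))" for n
      using f(1)[rule_format, of n] by auto
    have "(\<lambda>n. snd (f n) + \<mu> *\<^sub>C fst (f n)) \<longlonglongrightarrow> snd l + \<mu> *\<^sub>C fst l"
      by (intro tendsto_add tendsto_scaleC tendsto_fst tendsto_snd f(2))
    then have "(\<lambda>n. A (fst (f n))) \<longlonglongrightarrow> snd l + \<mu> *\<^sub>C fst l" by (simp add: fD(2))
    then have "fst l \<in> D" "A (fst l) = snd l + \<mu> *\<^sub>C fst l"
      using closed_operatorD[OF assms fD(1) tendsto_fst[OF f(2)]] by auto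
    then show "l \<in> (\<lambda>x. (x, shifted A \<mu> x)) ` D" by (intro image_eqI[of _ _ "fst l"]) (auto simp: prod_eq_iff)
  qed
qed

lemma op_kernel_shifted: "op_kernel D (shifted A \<mu>) \<nu> = op_kernel D A (\<mu> + \<nu>)"
  by (auto simp: op_kernel_def scaleC_add_left algebra_simps)

lemma infinite_jordan_chain_shifted:
  "infinite_jordan_chain D (shifted A \<mu>) \<nu> = infinite_jordan_chain D A (\<mu> + \<nu>)"
  by (auto simp: infinite_jordan_chain_def scaleC_add_left algebra_simps fun_eq_iff)

lemma eigenvector_sigma_ap:
  assumes "linear_operator D A" "x \<in> op_kernel D A \<mu>" "x \<noteq> 0"
  shows "\<mu> \<in> sigma_ap D A"
proof -
  let ?y = "(1 / norm x) *\<^sub>R x"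
  have "?y \<in> op_kernel D A \<mu>" by (rule scaleR_in_csubspace[OF csubspace_op_kernel[OF assms(1)] assms(2)])
  then have "approximate_eigensequence D A \<mu> (\<lambda>_. ?y)"
    using assms(3) by (auto simp: approximate_eigensequence_def op_kernel_def)
  then show ?thesis by (auto simp: sigma_ap_def)
qed

context indefinite begin

text \<open>Reality of \<mu> is what confines the local analysis to centres on the real axis;
  nonreal points enter as nearby eigenvalues only.\<close>

lemma G_symmetric_shifted:
  assumes "G_symmetric G D A" "Im \<mu> = 0" shows "G_symmetric G D (shifted A \<mu>)"
proof -
  have "cnj \<mu> = \<mu>" using assms(2) by (simp add: complex_eq_iff)
  then show ?thesis using assms(1) by (simp add: G_symmetric_def gip.diff_left gip.diff_right)
qed

text \<open>If the inequality fails, normalised near-kernel vectors with \<open>q\<close> at most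
  \<open>1 / (n + 1)\<close> form a sequence in \<open>H\<close> whose lower limit is not
  positive.\<close>

lemma plus_condition_iff:
  assumes lin: "linear_operator D A" and H: "csubspace H"
  shows "plus_condition G D A \<mu> H \<longleftrightarrow> (\<exists>\<epsilon>>0. \<exists>\<delta>>0. \<forall>x\<in>D \<inter> H.
    norm (shifted A \<mu> x) \<le> \<epsilon> * norm x \<longrightarrow> \<delta> * (norm x)\<^sup>2 \<le> q x)" (is "?L \<longleftrightarrow> ?R")
proof
  assume ?L
  show ?R
  proof (rule ccontr)
    assume contra: "\<not> ?R"
    have DH: "csubspace (D \<inter> H)" by (rule complex_vector.subspace_inter[OF linear_operatorD(1)[OF lin] H])
    have "linear_operator (D \<inter> H) (shifted A \<mu>)"
      using linear_operator_shifted[OF lin, of \<mu>] DH by (simp add: linear_operator_def)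
    from near_kernel_counterexample[OF this contra]
    obtain u where u: "\<And>n. u n \<in> D \<inter> H" "\<And>n. norm (u n) = 1" "(\<lambda>n. shifted A \<mu> (u n)) \<longlonglongrightarrow> 0"
      "\<And>n. q (u n) \<le> 1 / real (Suc n)" by metis
    have l1: "(\<lambda>n. 1 / real (Suc n)) \<longlonglongrightarrow> 0" by (rule LIMSEQ_Suc[OF lim_1_over_n])
    have "0 < liminf (\<lambda>n. ereal (q (u n)))"
      using \<open>?L\<close> u(1-3) by (auto simp: plus_condition_def approximate_eigensequence_def)
    also have "\<dots> \<le> liminf (\<lambda>n. ereal (1 / real (Suc n)))"
      using u(4) by (intro Liminf_mono) auto
    also have "\<dots> = ereal 0" by (rule lim_imp_Liminf) (use l1 in auto)
    finally show False by simp
  qed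
next
  assume ?R
  then obtain \<epsilon> \<delta> where ed: "\<epsilon> > 0" "\<delta> > 0"
    "\<And>x. x \<in> D \<Longrightarrow> x \<in> H \<Longrightarrow> norm (shifted A \<mu> x) \<le> \<epsilon> * norm x \<Longrightarrow> \<delta> * (norm x)\<^sup>2 \<le> q x"
    by blast
  show ?L unfolding plus_condition_def
  proof (intro allI impI, elim conjE)
    fix x assume x: "\<forall>n. x n \<in> H" "approximate_eigensequence D A \<mu> x"
    have "(\<lambda>n. norm (shifted A \<mu> (x n))) \<longlonglongrightarrow> 0"
      using x(2) tendsto_norm_zero by (auto simp: approximate_eigensequence_def)
    then have "\<forall>\<^sub>F n in sequentially. norm (shifted A \<mu> (x n)) < \<epsilon>" by (rule order_tendstoD) (rule ed)
    then have "\<forall>\<^sub>F n in sequentially. ereal \<delta> \<le> ereal (q (x n))"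
    proof eventually_elim
      case (elim n)
      then show ?case using ed(3)[of "x n"] x by (simp add: approximate_eigensequence_def)
    qed
    then have "ereal \<delta> \<le> liminf (\<lambda>n. ereal (q (x n)))" by (rule Liminf_bounded)
    then show "0 < liminf (\<lambda>n. ereal (q (x n)))" using ed(2) by (simp add: less_le_trans[of 0 "ereal \<delta>"])
  qed
qed

lemma pi_type_iff:
  assumes "linear_operator D A"
  shows "pi_type G D (shifted A \<mu>) \<longleftrightarrow>
    (\<exists>H. csubspace H \<and> finite_codim H UNIV \<and> plus_condition G D A \<mu> H)"
  unfolding pi_type_def using plus_condition_iff[OF assms] by (intro ex_cong1) blast

lemma finite_codim_UNIV: "finite_codim (UNIV :: 'a set) UNIV"
  by (auto simp: finite_codim_def complex_vector.span_UNIV intro!: exI[of _ "{}"])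

text \<open>Outside the approximate point spectrum the sequential condition holds vacuously on the
  whole space, so all points of \<open>[a,b]\<close> are treated alike.\<close>

lemma pi_type_of_sigma_pi_plus:
  assumes lin: "linear_operator D A" and "\<mu> \<in> sigma_ap D A \<Longrightarrow> \<mu> \<in> sigma_pi_plus G D A"
  shows "pi_type G D (shifted A \<mu>)"
proof (cases "\<mu> \<in> sigma_ap D A")
  case True
  then show ?thesis using assms(2) unfolding pi_type_iff[OF lin] sigma_pi_plus_def by blast
next
  case False
  then have "plus_condition G D A \<mu> UNIV" by (auto simp: plus_condition_def sigma_ap_def)
  then show ?thesis unfolding pi_type_iff[OF lin] using finite_codim_UNIV complex_vector.subspace_UNIV by blast
qed

text \<open>A shift by less than \<open>\<epsilon> / 2\<close> uses up half of the tolerance;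
  \<open>H\<close> and \<delta> stay the same.\<close>

lemma pi_type_open:
  assumes pi: "pi_type G D (shifted A \<mu>)"
  shows "\<exists>r>0. \<forall>\<nu>. cmod (\<nu> - \<mu>) < r \<longrightarrow> pi_type G D (shifted A \<nu>)"
proof -
  obtain H \<epsilon> \<delta> where H: "csubspace H" "finite_codim H UNIV" "\<epsilon> > 0" "\<delta> > 0"
    "\<And>x. x \<in> D \<inter> H \<Longrightarrow> norm (shifted A \<mu> x) \<le> \<epsilon> * norm x \<Longrightarrow> \<delta> * (norm x)\<^sup>2 \<le> q x"
    using pi by (auto simp: pi_type_def)
  have "pi_type G D (shifted A \<nu>)" if \<nu>: "cmod (\<nu> - \<mu>) < \<epsilon> / 2" for \<nu>
    unfolding pi_type_def
  proof (rule exI[of _ H], rule exI[of _ "\<epsilon> / 2"], rule exI[of _ \<delta>], intro conjI ballI impI)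
    fix x assume x: "x \<in> D \<inter> H" "norm (shifted A \<nu> x) \<le> \<epsilon> / 2 * norm x"
    have "shifted A \<mu> x = shifted A \<nu> x + (\<nu> - \<mu>) *\<^sub>C x"
      by (simp add: complex_vector.scale_left_diff_distrib)
    then have "norm (shifted A \<mu> x) \<le> norm (shifted A \<nu> x) + cmod (\<nu> - \<mu>) * norm x"
      by (metis norm_scaleC norm_triangle_ineq)
    also have "\<dots> \<le> \<epsilon> / 2 * norm x + \<epsilon> / 2 * norm x"
      using x(2) \<nu> by (intro add_mono mult_right_mono) auto
    finally show "\<delta> * (norm x)\<^sup>2 \<le> q x" using H(5)[OF x(1)] by simp
  qed (use H in auto)
  then show ?thesis using H(3) by (intro exI[of _ "\<epsilon> / 2"]) auto
qed

text \<open>At a point of type pi-plus, nonpositive eigenvectors are the only obstruction to taking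
  the whole space in place of \<open>H\<close>.\<close>

lemma sigma_plus_of_positive_kernel:
  assumes A: "closed_operator D A" and pi: "pi_type G D (shifted A \<mu>)"
    and pos: "\<And>x. x \<in> op_kernel D A \<mu> \<Longrightarrow> q x \<le> 0 \<Longrightarrow> x = 0"
  shows "plus_condition G D A \<mu> UNIV"
proof -
  have lin: "linear_operator D A" using A by (simp add: closed_operator_def)
  have "closed_csubspace (UNIV :: 'a set)" by (simp add: closed_csubspace_def complex_vector.subspace_UNIV)
  moreover have "0 < q x" if "x \<in> D" "shifted A \<mu> x = 0" "x \<noteq> 0" for x
    using pos[of x] that by (auto simp: op_kernel_def not_le[symmetric])
  ultimately obtain e d where "e > 0" "d > 0"
    "\<And>x. x \<in> D \<Longrightarrow> x \<in> UNIV \<Longrightarrow> norm (shifted A \<mu> x) \<le> e * norm x \<Longrightarrow> d * (norm x)\<^sup>2 \<le> q x"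
    using uniformly_positive_near_kernel_in[OF closed_operator_shifted[OF A] pi, of UNIV] by metis
  then show ?thesis unfolding plus_condition_iff[OF lin complex_vector.subspace_UNIV] by auto
qed

text \<open>Since \<open>[Ax,x]\<close> is real, the imaginary part of
  \<open>[(A - \<mu>)x,x]\<close> equals \<open>- Im \<mu>\<close> times \<open>[x,x]\<close>. Along
  an approximate eigensequence it tends to 0, and so does \<open>[x,x]\<close>, against the positive
  lower limit.\<close>

lemma plus_condition_nonreal:
  assumes sym: "G_symmetric G D A" and plus: "plus_condition G D A \<mu> UNIV" and im: "Im \<mu> \<noteq> 0"
  shows "\<mu> \<notin> sigma_ap D A"
proof
  assume "\<mu> \<in> sigma_ap D A"
  then obtain x where x: "approximate_eigensequence D A \<mu> x" by (auto simp: sigma_ap_def)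
  then have xD: "\<And>n. x n \<in> D" and nx: "\<And>n. norm (x n) = 1"
    and lim: "(\<lambda>n. shifted A \<mu> (x n)) \<longlonglongrightarrow> 0"
    by (auto simp: approximate_eigensequence_def)
  have Im_eq: "Im (gip G (shifted A \<mu> (x n)) (x n)) = - Im \<mu> * q (x n)" for n
  proof -
    have "gip G (A (x n)) (x n) = gip G (x n) (A (x n))"
      using sym xD by (auto simp: G_symmetric_def)
    then have "Im (gip G (A (x n)) (x n)) = 0"
      using gip_cnj[of "A (x n)" "x n"] by (simp add: complex_eq_iff)
    moreover have "Im (\<mu> * gip G (x n) (x n)) = Im \<mu> * q (x n)"
      by (subst gip_self) simp
    ultimately show ?thesis by (simp add: gip.diff_left)
  qed
  have "Bfun x sequentially" using nx by (intro BfunI[where K=1]) auto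
  then have "(\<lambda>n. gip G (shifted A \<mu> (x n)) (x n)) \<longlonglongrightarrow> 0"
    using gip.Zfun_prod_Bfun[of "\<lambda>n. shifted A \<mu> (x n)" sequentially x] lim by (simp add: tendsto_Zfun_iff)
  then have "(\<lambda>n. Im (gip G (shifted A \<mu> (x n)) (x n))) \<longlonglongrightarrow> Im 0" by (rule tendsto_Im)
  then have "(\<lambda>n. (- Im \<mu> * q (x n)) / (- Im \<mu>)) \<longlonglongrightarrow> 0 / (- Im \<mu>)"
    unfolding Im_eq using im by (intro tendsto_divide tendsto_const) auto
  then have "(\<lambda>n. q (x n)) \<longlonglongrightarrow> 0" using im by simp
  then have "liminf (\<lambda>n. ereal (q (x n))) = ereal 0" by (intro lim_imp_Liminf) auto
  then show False using plus x by (force simp: plus_condition_def)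
qed

lemma nonpositive_eigenvector_not_sigma_plus:
  assumes lin: "linear_operator D A" and x: "x \<in> op_kernel D A \<mu>" "x \<noteq> 0" "q x \<le> 0"
  shows "\<mu> \<notin> sigma_plus G D A"
proof
  assume "\<mu> \<in> sigma_plus G D A"
  then obtain \<epsilon> \<delta> where ed: "\<epsilon> > 0" "\<delta> > 0"
    "\<forall>x\<in>D \<inter> UNIV. norm (shifted A \<mu> x) \<le> \<epsilon> * norm x \<longrightarrow> \<delta> * (norm x)\<^sup>2 \<le> q x"
    unfolding sigma_plus_def mem_Collect_eq plus_condition_iff[OF lin complex_vector.subspace_UNIV] by blast
  have "norm (shifted A \<mu> x) \<le> \<epsilon> * norm x" "x \<in> D" using x(1) ed(1) by (auto simp: op_kernel_def)
  then have "\<delta> * (norm x)\<^sup>2 \<le> 0" using ed(3) x(3) by fastforce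
  then show False using ed(2) x(2) by (simp add: mult_le_0_iff)
qed

end

section \<open>Kernels and algebraic eigenspaces\<close>

lemma closed_csubspace_op_kernel:
  assumes "closed_operator D A" shows "closed_csubspace (op_kernel D A \<mu>)"
  unfolding closed_csubspace_def
proof
  show "csubspace (op_kernel D A \<mu>)"
    using assms by (intro csubspace_op_kernel) (simp add: closed_operator_def)
  show "closed (op_kernel D A \<mu>)"
    unfolding closed_sequential_limits
  proof (intro allI impI, elim conjE)
    fix f l assume f: "\<forall>n. f n \<in> op_kernel D A \<mu>" "f \<longlonglongrightarrow> l"
    have "(\<lambda>n. A (f n)) \<longlonglongrightarrow> \<mu> *\<^sub>C l"
      using tendsto_scaleC[OF f(2), of \<mu>] f(1) op_kernelD(2) by (simp add: op_kernel_def)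
    then show "l \<in> op_kernel D A \<mu>"
      using closed_operatorD[OF assms _ f(2)] f(1) by (simp add: op_kernel_def)
  qed
qed

text \<open>The domain conditions may be imposed on all iterates, since after the first zero they
  remain 0. This form does not mention a common exponent, which makes linearity and invariance
  easy.\<close>

lemma algebraic_eigenspace_iff:
  assumes "linear_operator D A"
  shows "x \<in> algebraic_eigenspace D A \<mu> \<longleftrightarrow>
    (\<forall>i. ((shifted A \<mu>) ^^ i) x \<in> D) \<and> (\<exists>n. ((shifted A \<mu>) ^^ n) x = 0)" (is "?L \<longleftrightarrow> ?R")
proof -
  let ?T = "shifted A \<mu>"
  note lin = linear_operator_shifted[OF assms, of \<mu>]
  have up: "(?T ^^ m) x = 0" if "(?T ^^ n) x = 0" "n \<le> m" for m n
    using that(2,1) linear_operatorD(4)[OF lin] by (induction m rule: dec_induct) simp_all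
  show ?thesis
  proof
    assume ?L
    then obtain n where n: "\<forall>i<n. (?T ^^ i) x \<in> D" "(?T ^^ n) x = 0"
      by (auto simp: algebraic_eigenspace_def kernel_power_def)
    have "(?T ^^ i) x \<in> D" for i
      using n up[OF n(2), of i] complex_vector.subspace_0[OF linear_operatorD(1)[OF assms]]
      by (cases "i < n") auto
    then show ?R using n(2) by blast
  next
    assume ?R
    then obtain n where n: "\<forall>i. (?T ^^ i) x \<in> D" "(?T ^^ n) x = 0" by blast
    \<comment> \<open>The exponent is raised by one because the union starts at exponent 1, while
      \<open>n\<close> may be 0.\<close>
    then have "x \<in> kernel_power D A \<mu> (Suc n)"
      using up[OF n(2), of "Suc n"] by (simp add: kernel_power_def del: funpow.simps)
    then show ?L unfolding algebraic_eigenspace_def by (intro UN_I[of "Suc n"]) auto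
  qed
qed

lemma csubspace_algebraic_eigenspace:
  assumes lin: "linear_operator D A"
  shows "csubspace (algebraic_eigenspace D A \<mu>)"
proof -
  let ?T = "shifted A \<mu>"
  note T = linear_operator_shifted[OF lin, of \<mu>]
  note D = linear_operatorD(1)[OF lin]
  have T0: "(?T ^^ i) 0 = 0" for i using linear_operatorD(4)[OF T] by (induction i) simp_all
  have add: "(?T ^^ i) (x + y) = (?T ^^ i) x + (?T ^^ i) y"
    if "\<forall>i. (?T ^^ i) x \<in> D" "\<forall>i. (?T ^^ i) y \<in> D" for x y i
  proof (induction i)
    case (Suc i)
    then show ?case using linear_operatorD(2)[OF T, of "(?T ^^ i) x" "(?T ^^ i) y"] that by simp
  qed simp
  have scale: "(?T ^^ i) (c *\<^sub>C x) = c *\<^sub>C (?T ^^ i) x" if "\<forall>i. (?T ^^ i) x \<in> D" for x c i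
  proof (induction i)
    case (Suc i)
    then show ?case using linear_operatorD(3)[OF T, of "(?T ^^ i) x" c] that by simp
  qed simp
  have up: "(?T ^^ m) x = 0" if "(?T ^^ n) x = 0" "n \<le> m" for m n x
    using that(2,1) linear_operatorD(4)[OF T] by (induction m rule: dec_induct) simp_all
  show ?thesis
    unfolding complex_vector.subspace_def algebraic_eigenspace_iff[OF lin]
  proof (intro conjI ballI allI)
    show "(?T ^^ i) 0 \<in> D" for i using T0 complex_vector.subspace_0[OF D] by simp
    show "\<exists>n. (?T ^^ n) 0 = 0" using T0 by blast
  next
    fix x y assume "x \<in> algebraic_eigenspace D A \<mu>" "y \<in> algebraic_eigenspace D A \<mu>"
    then obtain n m where x: "\<forall>i. (?T ^^ i) x \<in> D" "(?T ^^ n) x = 0"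
      and y: "\<forall>i. (?T ^^ i) y \<in> D" "(?T ^^ m) y = 0"
      unfolding algebraic_eigenspace_iff[OF lin] by blast
    show "(?T ^^ i) (x + y) \<in> D" for i
      unfolding add[OF x(1) y(1)] using x(1) y(1) by (intro complex_vector.subspace_add[OF D]) auto
    have "(?T ^^ max n m) (x + y) = 0"
      unfolding add[OF x(1) y(1)] using up[OF x(2), of "max n m"] up[OF y(2), of "max n m"] by simp
    then show "\<exists>n. (?T ^^ n) (x + y) = 0" by blast
  next
    fix c x assume "x \<in> algebraic_eigenspace D A \<mu>"
    then obtain n where x: "\<forall>i. (?T ^^ i) x \<in> D" "(?T ^^ n) x = 0"
      unfolding algebraic_eigenspace_iff[OF lin] by blast
    show "(?T ^^ i) (c *\<^sub>C x) \<in> D" for i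
      unfolding scale[OF x(1)] using x(1) by (intro complex_vector.subspace_scale[OF D]) auto
    show "\<exists>n. (?T ^^ n) (c *\<^sub>C x) = 0"
      using scale[OF x(1), of n c] x(2) by (intro exI[of _ n]) simp
  qed
qed

lemma op_kernel_subset_algebraic_eigenspace:
  "op_kernel D A \<mu> \<subseteq> algebraic_eigenspace D A \<mu>"
  by (auto simp: algebraic_eigenspace_def kernel_power_def op_kernel_def intro!: bexI[of _ 1])

lemma algebraic_eigenspace_invariant:
  assumes "linear_operator D A" "x \<in> algebraic_eigenspace D A \<mu>"
  shows "x \<in> D" "shifted A \<mu> x \<in> algebraic_eigenspace D A \<mu>"
proof -
  let ?T = "shifted A \<mu>"
  obtain n where x: "\<forall>i. (?T ^^ i) x \<in> D" "(?T ^^ n) x = 0"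
    using assms(2) unfolding algebraic_eigenspace_iff[OF assms(1)] by blast
  show "x \<in> D" using x(1)[rule_format, of 0] by simp
  have swap: "(?T ^^ i) (?T x) = (?T ^^ Suc i) x" for i by (simp only: funpow_Suc_right o_apply)
  have "(?T ^^ n) (?T x) = 0"
    unfolding swap using x(2) linear_operatorD(4)[OF linear_operator_shifted[OF assms(1), of \<mu>]] by simp
  then show "?T x \<in> algebraic_eigenspace D A \<mu>"
    unfolding algebraic_eigenspace_iff[OF assms(1)] using x(1) swap by metis
qed

section \<open>Fundamental decompositions and splitting of the algebraic eigenspace\<close>

lemma fundamental_decompositionD:
  assumes "fundamental_decomposition f L Lp Lm"
  shows "closed_csubspace Lp" "positive_set f Lp" "closed_csubspace Lm" "negative_set f Lm"
    "\<And>x y. x \<in> Lp \<Longrightarrow> y \<in> Lm \<Longrightarrow> f x y = 0"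
    "\<And>p m z. p \<in> Lp \<Longrightarrow> m \<in> Lm \<Longrightarrow> z \<in> isotropic_part f L \<Longrightarrow> p + m + z \<in> L"
    "\<And>x. x \<in> L \<Longrightarrow> \<exists>p\<in>Lp. \<exists>m\<in>Lm. \<exists>z\<in>isotropic_part f L. x = p + m + z"
proof -
  note fd = assms[unfolded fundamental_decomposition_def]
  note s1 = conjunct1[OF conjunct2[OF conjunct2[OF conjunct2[OF conjunct2[OF fd]]]], unfolded orth_direct_sum_def]
  note s2 = conjunct1[OF conjunct2[OF conjunct2[OF conjunct2[OF conjunct2[OF conjunct2[OF fd]]]]],
      unfolded orth_direct_sum_def]
  show "closed_csubspace Lp" using fd by (elim conjE)
  show "positive_set f Lp" using fd by (elim conjE)
  show "closed_csubspace Lm" using fd by (elim conjE)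
  show "negative_set f Lm" using fd by (elim conjE)
  show "f x y = 0" if "x \<in> Lp" "y \<in> Lm" for x y
    by (rule conjunct2[OF conjunct2[OF s1], rule_format, OF that])
  have sum: "L = Lp + Lm + isotropic_part f L" by (rule conjunct1[OF s2])
  show "p + m + z \<in> L" if "p \<in> Lp" "m \<in> Lm" "z \<in> isotropic_part f L" for p m z
    by (rule subsetD[OF equalityD2[OF sum]]) (intro set_plus_intro that)
  show "\<exists>p\<in>Lp. \<exists>m\<in>Lm. \<exists>z\<in>isotropic_part f L. x = p + m + z" if "x \<in> L" for x
    using subsetD[OF equalityD1[OF sum] that] by (elim set_plus_elim) blast
qed

context indefinite begin

lemma closed_companion: "closed_csubspace {x. \<forall>p\<in>P. gip G x p = 0}"
  unfolding closed_csubspace_def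
proof
  show "csubspace {x. \<forall>p\<in>P. gip G x p = 0}"
    by (auto simp: complex_vector.subspace_def gip.zero_left gip.add_left)
  have "{x. \<forall>p\<in>P. gip G x p = 0} = (\<Inter>p\<in>P. (\<lambda>x. gip G x p) -` {0})" by auto
  moreover have "closed ((\<lambda>x. gip G x p) -` {0})" for p
    by (intro continuous_closed_vimage closed_singleton)
      (auto intro!: linear_continuous_at gip.bounded_linear_left)
  ultimately show "closed {x. \<forall>p\<in>P. gip G x p = 0}" by auto
qed

lemma closed_csubspace_isotropic_part:
  assumes "closed_csubspace N" shows "closed_csubspace (isotropic_part (gip G) N)"
  using assms closed_companion[of N] complex_vector.subspace_inter
  by (auto simp: isotropic_part_def orth_companion_def closed_csubspace_def)

text \<open>On \<open>P\<close> the operator \<open>A - \<mu>\<close> vanishes, so the near-kernel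
  condition is automatic and pointwise positivity becomes uniform.\<close>

lemma uniformly_positive_kernel_part:
  assumes A: "closed_operator D A" and pi: "pi_type G D (shifted A \<mu>)"
    and P: "closed_csubspace P" "P \<subseteq> op_kernel D A \<mu>"
    and pos: "\<And>x. x \<in> P \<Longrightarrow> q x \<le> 0 \<Longrightarrow> x = 0"
  obtains d where "d > 0" "\<And>x. x \<in> P \<Longrightarrow> d * (norm x)\<^sup>2 \<le> q x"
proof -
  have "0 < q x" if "x \<in> D" "x \<in> P" "shifted A \<mu> x = 0" "x \<noteq> 0" for x
    using pos[of x] that by (auto simp: not_le[symmetric])
  then obtain e d where ed: "e > 0" "d > 0"
    "\<And>x. x \<in> D \<Longrightarrow> x \<in> P \<Longrightarrow> norm (shifted A \<mu> x) \<le> e * norm x \<Longrightarrow> d * (norm x)\<^sup>2 \<le> q x"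
    using uniformly_positive_near_kernel_in[OF closed_operator_shifted[OF A] pi P(1)] by metis
  have "d * (norm x)\<^sup>2 \<le> q x" if "x \<in> P" for x
  proof -
    have "x \<in> op_kernel D A \<mu>" using that P(2) by blast
    then show ?thesis using ed that by (auto simp: op_kernel_def)
  qed
  then show thesis using ed(2) that by blast
qed

text \<open>The lower bound makes sequences that are Cauchy for the form Cauchy in the ambient norm;
  the limit lies in the closed \<open>P\<close>, and \<open>q\<close> is continuous.\<close>

lemma hilbert_space_wrt_uniformly_positive:
  assumes P: "closed_csubspace P" and d: "d > 0" "\<And>x. x \<in> P \<Longrightarrow> d * (norm x)\<^sup>2 \<le> q x"
  shows "hilbert_space_wrt (gip G) P"
  unfolding hilbert_space_wrt_def
proof (intro conjI allI impI)
  show cP: "csubspace P" by (rule closed_csubspaceD(1)[OF P])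
  show "positive_set (gip G) P" unfolding positive_set_def
  proof (intro ballI impI)
    fix x assume "x \<in> P" "x \<noteq> 0"
    then have "0 < d * (norm x)\<^sup>2" using d(1) by simp
    then show "0 < q x" using d(2)[OF \<open>x \<in> P\<close>] by (rule less_le_trans)
  qed
  fix X :: "nat \<Rightarrow> 'a"
  assume X: "(\<forall>n. X n \<in> P) \<and> (\<forall>e>0. \<exists>N. \<forall>m\<ge>N. \<forall>n\<ge>N. sqrt (q (X m - X n)) < e)"
  have le: "sqrt d * norm (X m - X n) \<le> sqrt (q (X m - X n))" for m n
  proof -
    have "X m - X n \<in> P" using X cP by (simp add: complex_vector.subspace_diff)
    then have "sqrt (d * (norm (X m - X n))\<^sup>2) \<le> sqrt (q (X m - X n))"
      by (intro real_sqrt_le_mono d(2))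
    then show ?thesis by (simp add: real_sqrt_mult)
  qed
  have "Cauchy X"
  proof (rule metric_CauchyI)
    fix e :: real assume "0 < e"
    then have "0 < sqrt d * e" using d(1) by simp
    then obtain N where N: "\<forall>m\<ge>N. \<forall>n\<ge>N. sqrt (q (X m - X n)) < sqrt d * e" using X by blast
    have "dist (X m) (X n) < e" if "m \<ge> N" "n \<ge> N" for m n
    proof -
      have "sqrt d * norm (X m - X n) < sqrt d * e" using le[of m n] N that by (meson le_less_trans)
      then show ?thesis using d(1) by (simp add: dist_norm)
    qed
    then show "\<exists>M. \<forall>m\<ge>M. \<forall>n\<ge>M. dist (X m) (X n) < e" by blast
  qed
  then obtain l where l: "X \<longlonglongrightarrow> l" using Cauchy_convergent convergent_def by blast
  have "l \<in> P" using X by (intro closed_sequentially[OF closed_csubspaceD(2)[OF P] _ l]) simp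
  moreover have "(\<lambda>n. sqrt (q (X n - l))) \<longlonglongrightarrow> sqrt (q (l - l))"
    by (intro tendsto_real_sqrt tendsto_q tendsto_diff l tendsto_const)
  ultimately show "\<exists>l\<in>P. (\<lambda>n. sqrt (q (X n - l))) \<longlonglongrightarrow> 0" by (intro bexI[of _ l]) simp_all
qed

text \<open>Since \<open>kappa_minus\<close> is a definite description, one decomposition with
  trivial negative part is not enough: every fundamental decomposition must be shown to have
  one.\<close>

lemma kappa_minus_zero:
  assumes N: "closed_csubspace N"
    and iso: "\<And>x. x \<in> N \<Longrightarrow> q x \<le> 0 \<Longrightarrow> x \<in> isotropic_part (gip G) N"
  shows "kappa_minus (gip G) N = 0"
  unfolding kappa_minus_def
proof (rule the_equality)
  let ?I = "isotropic_part (gip G) N"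
  have cN: "csubspace N" by (rule closed_csubspaceD(1)[OF N])
  have I: "closed_csubspace ?I" by (rule closed_csubspace_isotropic_part[OF N])
  have IN: "?I \<subseteq> N" by (auto simp: isotropic_part_def)
  interpret id: indefinite "\<lambda>x::'a. x" by standard (rule bounded_selfadjoint_id)
  \<comment> \<open>Complementing the isotropic part orthogonally in the Hilbert space sense gives
    projections of norm at most 1, by Pythagoras, whence the constant 1.\<close>
  define Lp where "Lp = N \<inter> {x. \<forall>p\<in>?I. cinner x p = 0}"
  have Lp: "closed_csubspace Lp"
    using N id.closed_companion[of ?I] complex_vector.subspace_inter
    by (auto simp: Lp_def closed_csubspace_def gip_def)
  have pos: "positive_set (gip G) Lp" unfolding positive_set_def
  proof (intro ballI impI, rule ccontr)
    fix x assume x: "x \<in> Lp" "x \<noteq> 0" "\<not> 0 < q x"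
    then have "x \<in> ?I" using iso[of x] by (simp add: Lp_def)
    then have "cinner x x = 0" using x by (simp add: Lp_def)
    then show False using x by (simp add: cinner_self_real)
  qed
  have sum: "Lp + {0} = Lp" by (auto simp: set_plus_def)
  have zero: "0 \<in> Lp" "0 \<in> ?I" using Lp I by (auto dest!: closed_csubspaceD(1) intro: complex_vector.subspace_0)
  have "orth_direct_sum (gip G) N Lp ?I"
    unfolding orth_direct_sum_def
  proof (intro conjI ballI)
    show "N = Lp + ?I"
    proof
      show "N \<subseteq> Lp + ?I"
      proof
        fix x assume x: "x \<in> N"
        obtain p where p: "p \<in> ?I" "\<forall>n\<in>?I. cinner (x - p) n = 0" using orthogonal_projection[OF I] by blast
        have "x - p \<in> Lp" unfolding Lp_def using p x IN cN by (auto intro: complex_vector.subspace_diff)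
        then have "(x - p) + p \<in> Lp + ?I" using p(1) by (rule set_plus_intro)
        then show "x \<in> Lp + ?I" by simp
      qed
      show "Lp + ?I \<subseteq> N"
        using IN complex_vector.subspace_add[OF cN] by (auto simp: Lp_def elim!: set_plus_elim)
    qed
    have "x = 0" if "x \<in> Lp" "x \<in> ?I" for x
    proof -
      have "cinner x x = 0" using that by (simp add: Lp_def)
      then show ?thesis by (simp add: cinner_self_real)
    qed
    then show "Lp \<inter> ?I = {0}" using zero by blast
    fix x z assume "x \<in> Lp" "z \<in> ?I"
    then have "gip G z x = 0" by (simp add: Lp_def isotropic_part_def orth_companion_def)
    then show "gip G x z = 0" by (simp add: gip_zero_commute)
  qed
  moreover have "norm x \<le> 1 * norm (x + y + z) \<and> norm y \<le> 1 * norm (x + y + z) \<and> norm z \<le> 1 * norm (x + y + z)"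
    if "x \<in> Lp" "y \<in> {0}" "z \<in> ?I" for x y z
  proof -
    have "inner x z = 0" using that by (simp add: Lp_def Re_cinner[symmetric])
    then have eq: "(norm (x + z))\<^sup>2 = (norm x)\<^sup>2 + (norm z)\<^sup>2"
      by (simp add: power2_norm_eq_inner inner_simps inner_commute)
    have "norm x \<le> norm (x + z)" by (rule power2_le_imp_le) (simp_all add: eq)
    moreover have "norm z \<le> norm (x + z)" by (rule power2_le_imp_le) (simp_all add: eq)
    ultimately show ?thesis using that by simp
  qed
  then have "\<exists>C. \<forall>x\<in>Lp. \<forall>y\<in>{0}. \<forall>z\<in>?I. norm x \<le> C * norm (x + y + z) \<and>
      norm y \<le> C * norm (x + y + z) \<and> norm z \<le> C * norm (x + y + z)" by blast
  ultimately have "fundamental_decomposition (gip G) N Lp {0}"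
    unfolding fundamental_decomposition_def sum using Lp pos zero
    by (auto simp: closed_csubspace_def negative_set_def complex_vector.subspace_single_0
        orth_direct_sum_def sum gip.zero_right)
  then show "\<exists>Lp Lm. fundamental_decomposition (gip G) N Lp Lm \<and> 0 = edim Lm" by force
  fix k assume "\<exists>Lp Lm. fundamental_decomposition (gip G) N Lp Lm \<and> k = edim Lm"
  then obtain Lp' Lm where fd: "fundamental_decomposition (gip G) N Lp' Lm" and k: "k = edim Lm" by blast
  note fdD = fundamental_decompositionD[OF fd]
  have z0: "0 \<in> Lp'" "0 \<in> Lm"
    using fdD(1,3)[THEN closed_csubspaceD(1)] complex_vector.subspace_0 by blast+
  \<comment> \<open>A nonzero vector of the negative part would be isotropic by assumption and
    therefore neutral.\<close>
  have "y = 0" if y: "y \<in> Lm" for y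
  proof (rule ccontr)
    assume "y \<noteq> 0"
    then have neg: "q y < 0" using y fdD(4) by (simp add: negative_set_def)
    have "y \<in> N" using fdD(6)[OF z0(1) y zero(2)] by simp
    then have "y \<in> ?I" using iso neg by simp
    then show False using isotropic_neutral[of y N] neg by simp
  qed
  then have "Lm = {0}" using z0 by blast
  then show "k = 0" using k by simp
qed

text \<open>If \<open>T = A - \<mu>\<close> annihilates \<open>T y\<close>, then symmetry gives
  \<open>[Ty,Ty] = [y,TTy] = 0\<close>, and a neutral kernel vector is 0. Symmetry of
  \<open>T\<close> needs a real \<mu>; at a nonreal one the kernel itself is trivial by
  assumption.\<close>

lemma positive_kernel_no_jordan_chain:
  assumes lin: "linear_operator D A" and sym: "G_symmetric G D A"
    and real: "Im \<mu> = 0 \<or> op_kernel D A \<mu> = {0}"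
    and pos: "\<And>x. x \<in> op_kernel D A \<mu> \<Longrightarrow> q x \<le> 0 \<Longrightarrow> x = 0"
  shows "op_kernel D A \<mu> = algebraic_eigenspace D A \<mu>"
    "\<not> (\<exists>xs. jordan_chain D A \<mu> xs \<and> length xs > 1)"
proof -
  let ?T = "shifted A \<mu>"
  have collapse: "?T y = 0" if y: "y \<in> D" "?T y \<in> D" "?T (?T y) = 0" for y
  proof -
    have ker: "?T y \<in> op_kernel D A \<mu>" using y by (simp add: op_kernel_def)
    show ?thesis
    proof (cases "Im \<mu> = 0")
      case True
      have "gip G (?T y) (?T y) = gip G y (?T (?T y))"
        using G_symmetric_shifted[OF sym True] y(1,2) unfolding G_symmetric_def by blast
      then have "q (?T y) = 0" using y(3) by (simp add: gip.zero_right)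
      then show ?thesis using pos[OF ker] by simp
    next
      case False
      then show ?thesis using real ker by auto
    qed
  qed
  show "op_kernel D A \<mu> = algebraic_eigenspace D A \<mu>"
  proof (rule antisym[OF op_kernel_subset_algebraic_eigenspace], rule subsetI)
    fix x assume "x \<in> algebraic_eigenspace D A \<mu>"
    then obtain n where x: "\<forall>i. (?T ^^ i) x \<in> D" "(?T ^^ n) x = 0"
      unfolding algebraic_eigenspace_iff[OF lin] by blast
    have "(?T ^^ Suc n) x = 0 \<Longrightarrow> (?T ^^ 1) x = 0" for n
    proof (induction n)
      case (Suc n)
      have "?T ((?T ^^ n) x) = 0"
        using collapse[of "(?T ^^ n) x"] x(1)[rule_format, of n] x(1)[rule_format, of "Suc n"] Suc.prems by simp
      then show ?case using Suc.IH by simp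
    qed simp
    moreover have "(?T ^^ Suc n) x = 0"
      using x(2) linear_operatorD(4)[OF linear_operator_shifted[OF lin, of \<mu>]] by simp
    ultimately have "?T x = 0" by simp
    then show "x \<in> op_kernel D A \<mu>" using x(1)[rule_format, of 0] by (simp add: op_kernel_def)
  qed
  show "\<not> (\<exists>xs. jordan_chain D A \<mu> xs \<and> length xs > 1)"
  proof
    assume "\<exists>xs. jordan_chain D A \<mu> xs \<and> length xs > 1"
    then obtain xs where xs: "jordan_chain D A \<mu> xs" "length xs > 1" by blast
    then have "xs ! 0 \<in> D" "xs ! 0 \<noteq> 0" "xs ! 1 \<in> D" "?T (xs ! 0) = 0" "?T (xs ! 1) = xs ! 0"
      by (auto simp: jordan_chain_def)
    then show False using collapse[of "xs ! 1"] by simp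
  qed
qed

lemma almost_pontryaginI:
  assumes L: "closed_csubspace L" and P: "closed_csubspace P" "P \<subseteq> L"
    and d: "d > 0" "\<And>x. x \<in> P \<Longrightarrow> d * (norm x)\<^sup>2 \<le> q x"
    and F: "finite F" "F \<subseteq> L" "L \<subseteq> cspan (P \<union> F)"
  shows "almost_pontryagin (gip G) L"
  unfolding almost_pontryagin_def finite_codim_def using assms by blast

text \<open>\<open>T = A - \<mu>\<close> annihilates \<open>P\<close>, so by symmetry the orthogonal
  companion \<open>L1\<close> of \<open>P\<close> in the algebraic eigenspace is invariant under
  \<open>T\<close>. There \<open>T\<close> is nilpotent at each vector, has finite-dimensional
  kernel and admits no infinite chain, so \<open>L1\<close> is finite-dimensional. \<open>P\<close>
  is left arbitrary in order to serve two purposes: any given positive component, and an auxiliary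
  part of the kernel.\<close>

lemma algebraic_eigenspace_decomposition:
  assumes A: "closed_operator D A" and sym: "G_symmetric G D A" and im: "Im \<mu> = 0"
    and no_chain: "\<not> (\<exists>x. infinite_jordan_chain D A \<mu> x)"
    and P: "closed_csubspace P" "P \<subseteq> op_kernel D A \<mu>"
    and d: "d > 0" "\<And>x. x \<in> P \<Longrightarrow> d * (norm x)\<^sup>2 \<le> q x"
    and fd: "finite_dimensional {x \<in> op_kernel D A \<mu>. \<forall>p\<in>P. gip G x p = 0}"
  shows "\<exists>L1. closed_csubspace L1 \<and> finite_dimensional L1 \<and>
      orth_direct_sum (gip G) (algebraic_eigenspace D A \<mu>) P L1"
    "almost_pontryagin (gip G) (algebraic_eigenspace D A \<mu>)"
proof -
  let ?T = "shifted A \<mu>" and ?L = "algebraic_eigenspace D A \<mu>"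
  have lin: "linear_operator D A" using A by (simp add: closed_operator_def)
  note T = linear_operator_shifted[OF lin, of \<mu>]
  have cP: "csubspace P" by (rule closed_csubspaceD(1)[OF P(1)])
  have cL: "csubspace ?L" by (rule csubspace_algebraic_eigenspace[OF lin])
  have PL: "P \<subseteq> ?L" using P(2) op_kernel_subset_algebraic_eigenspace by blast
  define L1 where "L1 = ?L \<inter> {x. \<forall>p\<in>P. gip G x p = 0}"
  have cL1: "csubspace L1" unfolding L1_def
    by (rule complex_vector.subspace_inter[OF cL closed_csubspaceD(1)[OF closed_companion]])
  have LD: "x \<in> D" if "x \<in> ?L" for x by (rule algebraic_eigenspace_invariant(1)[OF lin that])
  have fd1: "finite_dimensional L1"
  proof (rule nilpotent_finite_dimensional[OF cL1, of ?T])
    fix x assume x: "x \<in> L1"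
    then have xL: "x \<in> ?L" and xD: "x \<in> D" using LD by (auto simp: L1_def)
    have "gip G (?T x) p = 0" if "p \<in> P" for p
    proof -
      have pk: "p \<in> D" "?T p = 0" using that P(2) by (auto simp: op_kernel_def)
      have "gip G (?T x) p = gip G x (?T p)"
        using G_symmetric_shifted[OF sym im] xD pk(1) unfolding G_symmetric_def by blast
      then show ?thesis using pk(2) by (simp add: gip.zero_right)
    qed
    then show "?T x \<in> L1" using algebraic_eigenspace_invariant(2)[OF lin xL] by (simp add: L1_def)
    show "\<exists>n. (?T ^^ n) x = 0" using xL unfolding algebraic_eigenspace_iff[OF lin] by blast
    show "?T (c *\<^sub>C x) = c *\<^sub>C ?T x" for c by (rule linear_operatorD(3)[OF T xD])
    show "?T (x + y) = ?T x + ?T y" if "y \<in> L1" for y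
      using that LD by (intro linear_operatorD(2)[OF T xD]) (auto simp: L1_def)
  next
    show "finite_dimensional {x \<in> L1. ?T x = 0}"
      by (rule finite_dimensional_subset[OF fd]) (auto simp: L1_def op_kernel_def LD)
    show "\<not> (\<exists>x. (\<forall>i. x i \<in> L1) \<and> x 0 \<noteq> 0 \<and> ?T (x 0) = 0 \<and> (\<forall>i. ?T (x (Suc i)) = x i))"
    proof
      assume "\<exists>x. (\<forall>i. x i \<in> L1) \<and> x 0 \<noteq> 0 \<and> ?T (x 0) = 0 \<and> (\<forall>i. ?T (x (Suc i)) = x i)"
      then obtain x where x: "\<And>i. x i \<in> L1" "x 0 \<noteq> 0" "?T (x 0) = 0" "\<And>i. ?T (x (Suc i)) = x i" by blast
      have "x i \<noteq> 0" for i
      proof (induction i)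
        case (Suc i)
        then show ?case using x(4)[of i] linear_operatorD(4)[OF T] by metis
      qed (rule x(2))
      moreover have "?T (x i) = x (i - 1)" if "1 \<le> i" for i using x(4)[of "i - 1"] that by simp
      ultimately have "infinite_jordan_chain D A \<mu> x"
        unfolding infinite_jordan_chain_def using x LD by (auto simp: L1_def)
      then show False using no_chain by blast
    qed
  qed
  have clL1: "closed L1" by (rule finite_dimensional_closed[OF cL1 fd1])
  have decomp: "\<exists>p\<in>P. x - p \<in> L1" if "x \<in> ?L" for x
  proof -
    obtain p where p: "p \<in> P" "\<forall>n\<in>P. gip G (x - p) n = 0" using gip_projection[OF P(1) d] by blast
    then show ?thesis using that PL cL by (auto simp: L1_def intro!: bexI[of _ p] complex_vector.subspace_diff)
  qed
  have sum: "?L = P + L1"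
  proof
    show "?L \<subseteq> P + L1"
    proof
      fix x assume "x \<in> ?L"
      then obtain p where p: "p \<in> P" "x - p \<in> L1" using decomp by blast
      then have "p + (x - p) \<in> P + L1" by (rule set_plus_intro)
      then show "x \<in> P + L1" by simp
    qed
    show "P + L1 \<subseteq> ?L"
      using PL complex_vector.subspace_add[OF cL] by (auto simp: L1_def elim!: set_plus_elim)
  qed
  have "x = 0" if "x \<in> P" "x \<in> L1" for x
  proof -
    have "d * (norm x)\<^sup>2 \<le> 0" using d(2)[OF that(1)] that by (simp add: L1_def)
    then show ?thesis using d(1) by (simp add: mult_le_0_iff)
  qed
  then have "P \<inter> L1 = {0}" using complex_vector.subspace_0[OF cP] complex_vector.subspace_0[OF cL1] by blast
  moreover have "gip G p x = 0" if "p \<in> P" "x \<in> L1" for p x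
    using that gip_zero_commute[of p x] by (simp add: L1_def)
  ultimately have "orth_direct_sum (gip G) ?L P L1"
    unfolding orth_direct_sum_def using sum by blast
  then show "\<exists>L1. closed_csubspace L1 \<and> finite_dimensional L1 \<and> orth_direct_sum (gip G) ?L P L1"
    using cL1 clL1 fd1 unfolding closed_csubspace_def by blast
  obtain K where K: "K > 0" "\<And>x y. cmod (gip G x y) \<le> norm x * norm y * K" using q_bound by metis
  \<comment> \<open>The projection onto \<open>P\<close> along \<open>L1\<close> is bounded: testing
    \<open>x - p\<close> with \<open>p\<close> expresses \<open>q p\<close> through
    \<open>x\<close>. Components in \<open>P\<close> of a convergent sequence thus converge, which
    makes the sum closed.\<close>
  have pbound: "norm p \<le> (K / d) * norm x" if p: "p \<in> P" "x - p \<in> L1" for p x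
  proof (cases "p = 0")
    case False
    have "gip G (x - p) p = 0" using p by (simp add: L1_def)
    then have "q p = Re (gip G x p)" by (simp add: gip.diff_left)
    then have "d * (norm p)\<^sup>2 \<le> norm x * norm p * K"
      using d(2)[OF p(1)] K(2)[of x p] abs_Re_le_cmod[of "gip G x p"] by linarith
    then have "(d * norm p) * norm p \<le> (norm x * K) * norm p" by (simp add: power2_eq_square mult_ac)
    then have "d * norm p \<le> norm x * K" using False by simp
    then show ?thesis using d(1) by (simp add: field_simps)
  qed (use K d in simp)
  have "closed ?L"
    unfolding closed_sequential_limits
  proof (intro allI impI, elim conjE)
    fix f l assume f: "\<forall>n. f n \<in> ?L" "f \<longlonglongrightarrow> l"
    have "\<forall>n. \<exists>p. p \<in> P \<and> f n - p \<in> L1" using decomp f(1) by blast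
    then obtain p where p: "\<And>n. p n \<in> P" "\<And>n. f n - p n \<in> L1" by metis
    have dist_p: "dist (p m) (p n) \<le> (K / d) * dist (f m) (f n)" for m n
    proof -
      have "(f m - p m) - (f n - p n) \<in> L1" by (intro complex_vector.subspace_diff cL1 p)
      then have "(f m - f n) - (p m - p n) \<in> L1" by (simp add: algebra_simps)
      then show ?thesis
        using pbound[of "p m - p n" "f m - f n"] complex_vector.subspace_diff[OF cP p(1) p(1)]
        by (simp add: dist_norm)
    qed
    have "0 < K / d" using K d by simp
    from convergent_if_dist_le[OF LIMSEQ_imp_Cauchy[OF f(2)] this dist_p]
    obtain l' where l': "p \<longlonglongrightarrow> l'" .
    have "l' \<in> P" by (rule closed_sequentially[OF closed_csubspaceD(2)[OF P(1)] p(1) l'])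
    moreover have "l - l' \<in> L1" by (rule closed_sequentially[OF clL1 p(2) tendsto_diff[OF f(2) l']])
    ultimately have "l' + (l - l') \<in> P + L1" by (rule set_plus_intro)
    then show "l \<in> ?L" using sum by simp
  qed
  then have L: "closed_csubspace ?L" using cL by (simp add: closed_csubspace_def)
  obtain F where F: "finite F" "F \<subseteq> L1" "L1 \<subseteq> cspan F" using finite_dimensional_basis[OF fd1] by metis
  have "P \<subseteq> cspan (P \<union> F)" using complex_vector.span_superset[of "P \<union> F"] by blast
  moreover have "L1 \<subseteq> cspan (P \<union> F)" using F(3) complex_vector.span_mono[of F "P \<union> F"] by blast
  ultimately have "?L \<subseteq> cspan (P \<union> F)"
    unfolding sum by (auto elim!: set_plus_elim intro!: complex_vector.span_add)
  moreover have "F \<subseteq> ?L" using F(2) by (auto simp: L1_def)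
  ultimately show "almost_pontryagin (gip G) ?L"
    using almost_pontryaginI[OF L P(1) PL d F(1)] by blast
qed

text \<open>Taking the closure of the trace of \<open>H\<close> on the kernel avoids presupposing
  that a fundamental decomposition exists; what is orthogonal to it meets \<open>H\<close> only in 0
  and is finite-dimensional.\<close>

lemma positive_part_of_kernel:
  assumes A: "closed_operator D A" and pi: "pi_type G D (shifted A \<mu>)"
  obtains P d where "closed_csubspace P" "P \<subseteq> op_kernel D A \<mu>" "d > 0"
    "\<And>x. x \<in> P \<Longrightarrow> d * (norm x)\<^sup>2 \<le> q x"
    "finite_dimensional {x \<in> op_kernel D A \<mu>. \<forall>p\<in>P. gip G x p = 0}"
proof -
  have lin: "linear_operator D A" using A by (simp add: closed_operator_def)
  let ?N = "op_kernel D A \<mu>"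
  have N: "closed_csubspace ?N" by (rule closed_csubspace_op_kernel[OF A])
  note cN = closed_csubspaceD[OF N]
  obtain H \<epsilon> \<delta> where H: "csubspace H" "finite_codim H UNIV" "\<epsilon> > 0" "\<delta> > 0"
    "\<And>x. x \<in> D \<inter> H \<Longrightarrow> norm (shifted A \<mu> x) \<le> \<epsilon> * norm x \<Longrightarrow> \<delta> * (norm x)\<^sup>2 \<le> q x"
    using pi by (auto simp: pi_type_def)
  have posH: "\<delta> * (norm x)\<^sup>2 \<le> q x" if "x \<in> ?N" "x \<in> H" for x
    using that H(3) by (intro H(5)) (auto simp: op_kernel_def)
  define P where "P = closure (?N \<inter> H)"
  have P: "closed_csubspace P" unfolding P_def closed_csubspace_def
    by (intro conjI csubspace_closure complex_vector.subspace_inter cN(1) H(1)) simp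
  have PN: "P \<subseteq> ?N" unfolding P_def using cN(2) by (intro closure_minimal) auto
  have posP: "\<delta> * (norm x)\<^sup>2 \<le> q x" if "x \<in> P" for x
  proof -
    from that[unfolded P_def closure_sequential]
    obtain f where f: "\<forall>n. f n \<in> ?N \<inter> H" "f \<longlonglongrightarrow> x" by (elim exE conjE)
    have "(\<lambda>n. \<delta> * (norm (f n))\<^sup>2) \<longlonglongrightarrow> \<delta> * (norm x)\<^sup>2" by (intro tendsto_intros f(2))
    then show ?thesis
      by (rule LIMSEQ_le[OF _ tendsto_q[OF f(2)]]) (use f(1) posH in blast)
  qed
  let ?K = "{x \<in> ?N. \<forall>p\<in>P. gip G x p = 0}"
  have K_eq: "?K = ?N \<inter> {x. \<forall>p\<in>P. gip G x p = 0}" by auto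
  have cK: "csubspace ?K" unfolding K_eq
    by (rule complex_vector.subspace_inter[OF cN(1) closed_csubspaceD(1)[OF closed_companion]])
  obtain B where B: "finite B" "UNIV \<subseteq> cspan (H \<union> B)" using H(2) by (auto simp: finite_codim_def)
  have "x = 0" if "x \<in> ?K" "x \<in> H" for x
  proof -
    have "x \<in> P" unfolding P_def using that by (intro subsetD[OF closure_subset]) auto
    then have "\<delta> * (norm x)\<^sup>2 \<le> 0" using posP[of x] that(1) by simp
    then show ?thesis using H(4) by (simp add: mult_le_0_iff)
  qed
  then have "?K \<inter> H \<subseteq> {0}" by blast
  then have "finite_dimensional ?K"
    using finite_dimensional_of_trivial_meet[OF B(1) H(1) cK] B(2) by blast
  then show thesis using that[OF P PN H(4) posP] by blast
qed

text \<open>The kernel vectors orthogonal to the positive component lie in the sum of the negative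
  and the isotropic one. This sum is nonpositive, hence finite-dimensional at a point of type
  pi-plus.\<close>

lemma fundamental_decomposition_positive_part:
  assumes A: "closed_operator D A" and pi: "pi_type G D (shifted A \<mu>)"
    and fd: "fundamental_decomposition (gip G) (op_kernel D A \<mu>) Np Nm"
  obtains d where "closed_csubspace Np" "Np \<subseteq> op_kernel D A \<mu>" "d > 0"
    "\<And>x. x \<in> Np \<Longrightarrow> d * (norm x)\<^sup>2 \<le> q x"
    "finite_dimensional {x \<in> op_kernel D A \<mu>. \<forall>p\<in>Np. gip G x p = 0}"
proof -
  have lin: "linear_operator D A" using A by (simp add: closed_operator_def)
  let ?N = "op_kernel D A \<mu>" and ?I = "isotropic_part (gip G) (op_kernel D A \<mu>)"
  note fdD = fundamental_decompositionD[OF fd]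
  note Np = fdD(1) and Nm = closed_csubspaceD(1)[OF fdD(3)] and pos = fdD(2) and neg = fdD(4)
    and orth = fdD(5) and mem = fdD(6)
  have cN: "csubspace ?N" by (rule csubspace_op_kernel[OF lin])
  have cI: "csubspace ?I" by (rule csubspace_isotropic_part[OF cN])
  have zero: "0 \<in> Np" "0 \<in> Nm" "0 \<in> ?I"
    using complex_vector.subspace_0[OF closed_csubspaceD(1)[OF Np]] complex_vector.subspace_0[OF Nm]
      complex_vector.subspace_0[OF cI] by auto
  have NpN: "Np \<subseteq> ?N" using mem[OF _ zero(2,3)] by auto
  obtain d where d: "d > 0" "\<And>x. x \<in> Np \<Longrightarrow> d * (norm x)\<^sup>2 \<le> q x"
    using uniformly_positive_kernel_part[OF A pi Np NpN] pos by (metis not_le positive_set_def)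
  define X where "X = {m + z | m z. m \<in> Nm \<and> z \<in> ?I}"
  have cX: "csubspace X" unfolding X_def by (rule complex_vector.subspace_sums[OF Nm cI])
  have XN: "X \<subseteq> ?N" using mem[OF zero(1)] by (auto simp: X_def)
  have Xneg: "q x \<le> 0" if x: "x \<in> X" for x
  proof -
    obtain m z where mz: "x = m + z" "m \<in> Nm" "z \<in> ?I" using x unfolding X_def by blast
    have "m \<in> ?N" using mem[OF zero(1) mz(2) zero(3)] by simp
    then have "gip G z m = 0" using mz(3) isotropic_part_op_kernel(2) by blast
    then have "q x = q m" using isotropic_neutral[OF mz(3)] gip_zero_commute[of m z] by (simp add: mz(1) q_add)
    then show ?thesis using neg mz(2) by (cases "m = 0") (auto simp: negative_set_def less_imp_le)
  qed
  have fdX: "finite_dimensional X"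
    using XN by (intro nonpositive_kernel_finite_dimensional[OF pi cX _ _ Xneg]) (auto simp: op_kernel_def)
  have "{x \<in> ?N. \<forall>p\<in>Np. gip G x p = 0} \<subseteq> X"
  proof
    fix x assume x: "x \<in> {x \<in> ?N. \<forall>p\<in>Np. gip G x p = 0}"
    then obtain p m z where pmz: "x = p + m + z" "p \<in> Np" "m \<in> Nm" "z \<in> ?I"
      using fdD(7)[of x] by auto
    have "gip G z p = 0" using pmz NpN isotropic_part_op_kernel(2) by blast
    moreover have "gip G m p = 0" using orth[OF pmz(2,3)] by (simp add: gip_zero_commute)
    ultimately have "gip G x p = gip G p p" by (simp add: pmz(1) gip.add_left)
    then have "q p = 0" using x pmz(2) by auto
    then have "p = 0" using pos pmz(2) by (auto simp: positive_set_def)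
    then show "x \<in> X" using pmz by (auto simp: X_def)
  qed
  then have "finite_dimensional {x \<in> ?N. \<forall>p\<in>Np. gip G x p = 0}" by (rule finite_dimensional_subset[OF fdX])
  then show thesis using that[OF Np NpN d] by blast
qed

end

section \<open>Globalization\<close>

context indefinite begin

text \<open>The value \<alpha> is determined by the punctured disc, and the centre satisfies only an
  inequality; this is what allows overlapping discs to be compared away from their centres.\<close>

definition structure_at :: "'a set \<Rightarrow> ('a \<Rightarrow> 'a) \<Rightarrow> complex \<Rightarrow> real \<Rightarrow> nat \<Rightarrow> bool" where
  "structure_at D A \<mu>\<^sub>0 r \<alpha> \<longleftrightarrow> r > 0 \<and>
    (\<forall>\<mu>. \<mu> \<noteq> \<mu>\<^sub>0 \<longrightarrow> cmod (\<mu> - \<mu>\<^sub>0) < r \<longrightarrow> kappa_zero (gip G) (op_kernel D A \<mu>) = enat \<alpha> \<and>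
      (\<forall>x\<in>op_kernel D A \<mu>. q x \<le> 0 \<longrightarrow> x \<in> isotropic_part (gip G) (op_kernel D A \<mu>))) \<and>
    enat \<alpha> \<le> kappa_zero (gip G) (op_kernel D A \<mu>\<^sub>0) \<and>
    (\<forall>\<mu>. cmod (\<mu> - \<mu>\<^sub>0) < r \<longrightarrow> pi_type G D (shifted A \<mu>) \<and>
      (\<exists>x. (\<forall>j<\<alpha>. infinite_jordan_chain D A \<mu> (x j)) \<and> independent_chains \<alpha> x)) \<and>
    (\<alpha> = 0 \<longrightarrow> \<not> (\<exists>x. infinite_jordan_chain D A \<mu>\<^sub>0 x))"

lemma structure_atD:
  assumes "structure_at D A \<mu>\<^sub>0 r \<alpha>"
  shows "r > 0"
    "\<And>\<mu>. \<mu> \<noteq> \<mu>\<^sub>0 \<Longrightarrow> cmod (\<mu> - \<mu>\<^sub>0) < r \<Longrightarrow> kappa_zero (gip G) (op_kernel D A \<mu>) = enat \<alpha>"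
    "\<And>\<mu>. \<mu> \<noteq> \<mu>\<^sub>0 \<Longrightarrow> cmod (\<mu> - \<mu>\<^sub>0) < r \<Longrightarrow>
      \<forall>x\<in>op_kernel D A \<mu>. q x \<le> 0 \<longrightarrow> x \<in> isotropic_part (gip G) (op_kernel D A \<mu>)"
    "enat \<alpha> \<le> kappa_zero (gip G) (op_kernel D A \<mu>\<^sub>0)"
    "\<And>\<mu>. cmod (\<mu> - \<mu>\<^sub>0) < r \<Longrightarrow> pi_type G D (shifted A \<mu>)"
    "\<And>\<mu>. cmod (\<mu> - \<mu>\<^sub>0) < r \<Longrightarrow>
      \<exists>x. (\<forall>j<\<alpha>. infinite_jordan_chain D A \<mu> (x j)) \<and> independent_chains \<alpha> x"
    "\<alpha> = 0 \<Longrightarrow> \<not> (\<exists>x. infinite_jordan_chain D A \<mu>\<^sub>0 x)"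
  using assms unfolding structure_at_def by blast+

lemma structure_at_exists:
  assumes A: "closed_operator D A" and sym: "G_symmetric G D A" and im: "Im \<mu>\<^sub>0 = 0"
    and pi: "pi_type G D (shifted A \<mu>\<^sub>0)"
  shows "\<exists>r \<alpha>. structure_at D A \<mu>\<^sub>0 r \<alpha>"
proof -
  obtain r\<^sub>1 where r1: "r\<^sub>1 > 0" "\<And>\<mu>. cmod (\<mu> - \<mu>\<^sub>0) < r\<^sub>1 \<Longrightarrow> pi_type G D (shifted A \<mu>)"
    using pi_type_open[OF pi] by blast
  obtain r\<^sub>2 \<alpha> where r2: "r\<^sub>2 > 0"
    and k: "\<And>\<mu>. \<mu> \<noteq> 0 \<Longrightarrow> cmod \<mu> < r\<^sub>2 \<Longrightarrow> kappa_zero (gip G) (op_kernel D A (\<mu>\<^sub>0 + \<mu>)) = enat \<alpha> \<and>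
      (\<forall>x\<in>op_kernel D A (\<mu>\<^sub>0 + \<mu>). q x \<le> 0 \<longrightarrow> x \<in> isotropic_part (gip G) (op_kernel D A (\<mu>\<^sub>0 + \<mu>)))"
    and le: "enat \<alpha> \<le> kappa_zero (gip G) (op_kernel D A \<mu>\<^sub>0)"
    and ch: "\<And>\<mu>. cmod \<mu> < r\<^sub>2 \<Longrightarrow>
      \<exists>x. (\<forall>j<\<alpha>. infinite_jordan_chain D A (\<mu>\<^sub>0 + \<mu>) (x j)) \<and> independent_chains \<alpha> x"
    and no: "\<alpha> = 0 \<Longrightarrow> \<not> (\<exists>x. infinite_jordan_chain D A \<mu>\<^sub>0 x)"
    using local_structure[OF closed_operator_shifted[OF A] G_symmetric_shifted[OF sym im] pi]
    unfolding op_kernel_shifted infinite_jordan_chain_shifted add_0_right by metis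
  have shift: "\<mu>\<^sub>0 + (\<mu> - \<mu>\<^sub>0) = \<mu>" for \<mu> by simp
  have "structure_at D A \<mu>\<^sub>0 (min r\<^sub>1 r\<^sub>2) \<alpha>"
    unfolding structure_at_def
  proof (intro conjI allI impI)
    show "0 < min r\<^sub>1 r\<^sub>2" using r1 r2 by simp
  next
    fix \<mu> assume \<mu>: "cmod (\<mu> - \<mu>\<^sub>0) < min r\<^sub>1 r\<^sub>2"
    show "pi_type G D (shifted A \<mu>)" using r1(2) \<mu> by simp
    show "\<exists>x. (\<forall>j<\<alpha>. infinite_jordan_chain D A \<mu> (x j)) \<and> independent_chains \<alpha> x"
      using ch[of "\<mu> - \<mu>\<^sub>0"] \<mu> unfolding shift by simp
  next
    fix \<mu> assume \<mu>: "\<mu> \<noteq> \<mu>\<^sub>0" "cmod (\<mu> - \<mu>\<^sub>0) < min r\<^sub>1 r\<^sub>2"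
    then have "\<mu> - \<mu>\<^sub>0 \<noteq> 0" "cmod (\<mu> - \<mu>\<^sub>0) < r\<^sub>2" by auto
    from k[OF this] show "kappa_zero (gip G) (op_kernel D A \<mu>) = enat \<alpha>"
      "\<forall>x\<in>op_kernel D A \<mu>. q x \<le> 0 \<longrightarrow> x \<in> isotropic_part (gip G) (op_kernel D A \<mu>)"
      unfolding shift by auto
  qed (use le no in auto)
  then show ?thesis by blast
qed

text \<open>The overlap of punctured neighbourhoods of nearby points forces one value of \<open>\<alpha>\<close> on all
  of \<open>[a,b]\<close>.\<close>

lemma uniform_structure:
  fixes a b :: real
  assumes A: "closed_operator D A" and sym: "G_symmetric G D A"
    and pi: "\<And>t. t \<in> {a..b} \<Longrightarrow> pi_type G D (shifted A (complex_of_real t))"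
  shows "\<exists>\<alpha> r. \<forall>t\<in>{a..b}. structure_at D A (complex_of_real t) (r t) \<alpha>"
proof -
  have "\<forall>t. \<exists>r \<alpha>. t \<in> {a..b} \<longrightarrow> structure_at D A (complex_of_real t) r \<alpha>"
    using structure_at_exists[OF A sym _ pi] by (metis Im_complex_of_real)
  then obtain r \<alpha> where str: "\<And>t. t \<in> {a..b} \<Longrightarrow> structure_at D A (complex_of_real t) (r t) (\<alpha> t)"
    by metis
  note r = structure_atD(1)[OF str] and k = structure_atD(2)[OF str]
  have loc: "\<alpha> s = \<alpha> t" if s: "s \<in> {a..b}" and t: "t \<in> {a..b}" and st: "dist s t < r t" for s t
  proof -
    define e where "e = min (r s) (r t - dist s t)"
    have e: "e > 0" using r[OF s] st by (simp add: e_def)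
    \<comment> \<open>A nonreal point differs from both real centres, and by the choice of
      \<open>e\<close> it lies in both discs.\<close>
    define \<mu> where "\<mu> = complex_of_real s + \<i> * complex_of_real (e / 2)"
    have "\<mu> - complex_of_real s = \<i> * complex_of_real (e / 2)" by (simp add: \<mu>_def)
    then have 1: "cmod (\<mu> - complex_of_real s) = e / 2" using e by (simp add: norm_mult del: of_real_divide)
    have "cmod (complex_of_real s - complex_of_real t) = dist s t"
      unfolding of_real_diff[symmetric] norm_of_real by (simp add: dist_real_def)
    then have "cmod (\<mu> - complex_of_real t) \<le> e / 2 + dist s t"
      using norm_triangle_ineq[of "\<mu> - complex_of_real s" "complex_of_real s - complex_of_real t"] 1 by simp
    moreover have "e / 2 < e" "e \<le> r s" "e \<le> r t - dist s t" using e by (auto simp: e_def)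
    ultimately have 2: "cmod (\<mu> - complex_of_real t) < r t" "cmod (\<mu> - complex_of_real s) < r s"
      using 1 by linarith+
    have "Im \<mu> \<noteq> 0" using e by (simp add: \<mu>_def)
    then have "\<mu> \<noteq> complex_of_real s" "\<mu> \<noteq> complex_of_real t" by auto
    then have "enat (\<alpha> s) = enat (\<alpha> t)" using k[OF s _ 2(2)] k[OF t _ 2(1)] by simp
    then show ?thesis by simp
  qed
  have const: "\<alpha> s = \<alpha> t" if "s \<in> {a..b}" "t \<in> {a..b}" for s t
  proof (rule connected_local_const[of "{a..b}" s t \<alpha>])
    show "connected {a..b}" by (rule connected_Icc)
    show "\<forall>t\<in>{a..b}. \<forall>\<^sub>F s in at t within {a..b}. \<alpha> t = \<alpha> s"
    proof
      fix t assume t: "t \<in> {a..b}"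
      show "\<forall>\<^sub>F s in at t within {a..b}. \<alpha> t = \<alpha> s"
        unfolding eventually_at using loc[OF _ t] r[OF t] by (intro exI[of _ "r t"]) auto
    qed
  qed (use that in auto)
  have "structure_at D A (complex_of_real t) (r t) (\<alpha> a)" if "t \<in> {a..b}" for t
  proof -
    have "\<alpha> a = \<alpha> t" using that by (intro const) auto
    then show ?thesis using str[OF that] by simp
  qed
  then show ?thesis by blast
qed

text \<open>Compactness leaves finitely many centres as candidates for \<sigma>. For
  \<open>\<alpha> > 0\<close> all of them are taken, since every point of \<open>U\<close> carries a
  nonzero isotropic eigenvector and thus qualifies; for \<open>\<alpha> = 0\<close> only those
  outside \<open>sigma_plus\<close> but in the approximate point spectrum may remain.\<close>

lemma plus_case:
  fixes a b :: real
  assumes A: "closed_operator D A" and sym: "G_symmetric G D A"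
    and sub: "complex_of_real ` {a..b} \<inter> sigma_ap D A \<subseteq> sigma_pi_plus G D A"
  shows "\<exists>U \<sigma> \<alpha>.
         open U \<and> complex_of_real ` {a..b} \<subseteq> U \<and>
         finite \<sigma> \<and>
         \<sigma> \<subseteq> complex_of_real ` {a..b} \<inter> (sigma_pi_plus G D A - sigma_plus G D A) \<and>
         (\<forall>\<mu>\<in>U - \<sigma>. kappa_zero (gip G) (op_kernel D A \<mu>) = enat \<alpha>) \<and>
         (\<sigma> \<noteq> {} \<longrightarrow> enat \<alpha> \<le> Min ((\<lambda>\<mu>. kappa_zero (gip G) (op_kernel D A \<mu>)) ` \<sigma>)) \<and>
         (\<forall>\<mu>\<in>U - \<sigma>. kappa_minus (gip G) (op_kernel D A \<mu>) = 0) \<and>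
         (\<alpha> = 0 \<longrightarrow>
            (\<forall>\<mu>\<in>U. almost_pontryagin (gip G) (algebraic_eigenspace D A \<mu>)) \<and>
            (\<forall>\<mu>\<in>U - \<sigma>.
               op_kernel D A \<mu> = algebraic_eigenspace D A \<mu> \<and>
               hilbert_space_wrt (gip G) (algebraic_eigenspace D A \<mu>) \<and>
               \<not> (\<exists>xs. jordan_chain D A \<mu> xs \<and> length xs > 1)) \<and>
            (\<forall>\<mu>\<in>\<sigma>.
               \<not> (\<exists>x. infinite_jordan_chain D A \<mu> x) \<and>
               (\<forall>Np Nm. fundamental_decomposition (gip G) (op_kernel D A \<mu>) Np Nm \<longrightarrow>
                  (\<exists>L1. closed_csubspace L1 \<and> finite_dimensional L1 \<and>
                     orth_direct_sum (gip G) (algebraic_eigenspace D A \<mu>) Np L1))) \<and>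
            \<sigma> = (complex_of_real ` {a..b} \<inter> sigma_ap D A) - sigma_plus G D A \<and>
            U - \<real> \<subseteq> r_set D A \<and>
            U \<inter> sigma_ap D A \<subseteq> sigma_plus G D A \<union> \<sigma>) \<and>
         (\<alpha> > 0 \<longrightarrow>
            U \<subseteq> point_spectrum D A \<and>
            (\<forall>\<mu>\<in>U. isotropic_part (gip G) (op_kernel D A \<mu>) \<noteq> {0}) \<and>
            (\<forall>\<mu>\<in>U. \<exists>x. (\<forall>j<\<alpha>. infinite_jordan_chain D A \<mu> (x j)) \<and> independent_chains \<alpha> x) \<and>
            U \<subseteq> sigma_pi_plus G D A - sigma_plus G D A)"
proof -
  have lin: "linear_operator D A" using A by (simp add: closed_operator_def)
  let ?N = "op_kernel D A" and ?I = "\<lambda>\<mu>. isotropic_part (gip G) (op_kernel D A \<mu>)"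
  have cN: "csubspace (?N \<mu>)" for \<mu> by (rule csubspace_op_kernel[OF lin])
  have clN: "closed_csubspace (?N \<mu>)" for \<mu> by (rule closed_csubspace_op_kernel[OF A])
  have cI: "csubspace (?I \<mu>)" for \<mu> by (rule csubspace_isotropic_part[OF cN])
  have pi0: "pi_type G D (shifted A (complex_of_real t))" if "t \<in> {a..b}" for t
    using sub that by (intro pi_type_of_sigma_pi_plus[OF lin]) auto
  obtain \<alpha> r where "\<forall>t\<in>{a..b}. structure_at D A (complex_of_real t) (r t) \<alpha>"
    using uniform_structure[OF A sym pi0] by blast
  then have str: "structure_at D A (complex_of_real t) (r t) \<alpha>" if "t \<in> {a..b}" for t
    using that by blast
  note r = structure_atD(1)[OF str] and le = structure_atD(4)[OF str] and no = structure_atD(7)[OF str]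
  have cpt: "compact (complex_of_real ` {a..b})"
    by (intro compact_continuous_image compact_Icc continuous_intros)
  have "complex_of_real ` {a..b} \<subseteq> (\<Union>t\<in>{a..b}. ball (complex_of_real t) (r t))" using r by fastforce
  then obtain C where C: "C \<subseteq> {a..b}" "finite C"
    and cover: "complex_of_real ` {a..b} \<subseteq> (\<Union>t\<in>C. ball (complex_of_real t) (r t))"
    using compactE_image[OF cpt, of "{a..b}" "\<lambda>t. ball (complex_of_real t) (r t)"] open_ball by metis
  define U where "U = (\<Union>t\<in>C. ball (complex_of_real t) (r t))"
  have U: "open U" "complex_of_real ` {a..b} \<subseteq> U" using cover by (auto simp: U_def)
  have inU: "\<exists>t\<in>C. t \<in> {a..b} \<and> cmod (\<mu> - complex_of_real t) < r t" if \<mu>: "\<mu> \<in> U" for \<mu>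
  proof -
    obtain t where "t \<in> C" "cmod (\<mu> - complex_of_real t) < r t"
      using \<mu> by (auto simp: U_def dist_norm norm_minus_commute)
    then show ?thesis using C(1) by blast
  qed
  have piU: "pi_type G D (shifted A \<mu>)"
    and chU: "\<exists>x. (\<forall>j<\<alpha>. infinite_jordan_chain D A \<mu> (x j)) \<and> independent_chains \<alpha> x"
    if "\<mu> \<in> U" for \<mu>
    using inU[OF that] structure_atD(5,6)[OF str] by blast+
  have punctU: "kappa_zero (gip G) (?N \<mu>) = enat \<alpha> \<and> (\<forall>x\<in>?N \<mu>. q x \<le> 0 \<longrightarrow> x \<in> ?I \<mu>)"
    if "\<mu> \<in> U" "\<mu> \<notin> complex_of_real ` C" for \<mu>
    using inU[OF that(1)] structure_atD(2,3)[OF str] that(2) by blast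
  have leU: "enat \<alpha> \<le> kappa_zero (gip G) (?N \<mu>)" if "\<mu> \<in> U" for \<mu>
  proof (cases "\<mu> \<in> complex_of_real ` C")
    case True
    then show ?thesis using le C(1) by blast
  qed (use punctU[OF that] in simp)
  have kappa_minus: "kappa_minus (gip G) (?N \<mu>) = 0" if "\<forall>x\<in>?N \<mu>. q x \<le> 0 \<longrightarrow> x \<in> ?I \<mu>" for \<mu>
    using that by (intro kappa_minus_zero clN) blast
  show ?thesis
  proof (cases "\<alpha> = 0")
    case False
    define \<sigma> where "\<sigma> = complex_of_real ` C"
    have isoU: "?I \<mu> \<noteq> {0}" if "\<mu> \<in> U" for \<mu>
    proof
      assume "?I \<mu> = {0}"
      then show False using leU[OF that] False by (simp add: kappa_zero_def zero_enat_def)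
    qed
    have eigU: "\<exists>x. x \<in> ?I \<mu> \<and> x \<noteq> 0" if "\<mu> \<in> U" for \<mu>
      using isoU[OF that] complex_vector.subspace_0[OF cI] by blast
    have sU: "\<mu> \<in> sigma_pi_plus G D A - sigma_plus G D A" "\<mu> \<in> point_spectrum D A" if \<mu>: "\<mu> \<in> U" for \<mu>
    proof -
      obtain x where x: "x \<in> ?I \<mu>" "x \<noteq> 0" using eigU[OF \<mu>] by blast
      have xN: "x \<in> ?N \<mu>" by (rule isotropic_part_op_kernel(1)[OF x(1)])
      have "\<mu> \<notin> sigma_plus G D A"
        using isotropic_neutral[OF x(1)] by (intro nonpositive_eigenvector_not_sigma_plus[OF lin xN x(2)]) simp
      moreover have "\<mu> \<in> sigma_pi_plus G D A"
        using eigenvector_sigma_ap[OF lin xN x(2)] piU[OF \<mu>]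
        unfolding pi_type_iff[OF lin] sigma_pi_plus_def by blast
      ultimately show "\<mu> \<in> sigma_pi_plus G D A - sigma_plus G D A" by blast
      show "\<mu> \<in> point_spectrum D A" using xN x(2) op_kernelD[OF xN] by (auto simp: point_spectrum_def)
    qed
    have CU: "\<sigma> \<subseteq> complex_of_real ` {a..b}" "\<sigma> \<subseteq> U" using C(1) U(2) by (auto simp: \<sigma>_def)
    have fin: "finite \<sigma>" using C(2) by (simp add: \<sigma>_def)
    have min: "enat \<alpha> \<le> Min ((\<lambda>\<mu>. kappa_zero (gip G) (?N \<mu>)) ` \<sigma>)" if "\<sigma> \<noteq> {}"
      using fin that leU CU(2) by (subst Min_ge_iff) auto
    have out: "kappa_zero (gip G) (?N \<mu>) = enat \<alpha>" "kappa_minus (gip G) (?N \<mu>) = 0" if "\<mu> \<in> U - \<sigma>" for \<mu>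
      using punctU[of \<mu>] that kappa_minus[of \<mu>] by (auto simp: \<sigma>_def)
    have 1: "\<sigma> \<subseteq> complex_of_real ` {a..b} \<inter> (sigma_pi_plus G D A - sigma_plus G D A)"
      using CU sU(1) by blast
    have 2: "\<forall>\<mu>\<in>U - \<sigma>. kappa_zero (gip G) (?N \<mu>) = enat \<alpha>"
      "\<forall>\<mu>\<in>U - \<sigma>. kappa_minus (gip G) (?N \<mu>) = 0"
      using out by blast+
    have 3: "\<sigma> \<noteq> {} \<longrightarrow> enat \<alpha> \<le> Min ((\<lambda>\<mu>. kappa_zero (gip G) (?N \<mu>)) ` \<sigma>)"
      using min by blast
    have 4: "U \<subseteq> point_spectrum D A" "U \<subseteq> sigma_pi_plus G D A - sigma_plus G D A"
      using sU by blast+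
    have 5: "\<forall>\<mu>\<in>U. ?I \<mu> \<noteq> {0}"
      "\<forall>\<mu>\<in>U. \<exists>x. (\<forall>j<\<alpha>. infinite_jordan_chain D A \<mu> (x j)) \<and> independent_chains \<alpha> x"
      using isoU chU by blast+
    show ?thesis
      by (rule exI[of _ U], rule exI[of _ \<sigma>], rule exI[of _ \<alpha>], intro conjI;
        (rule U fin 1 2 3 | (rule impI, erule notE[OF False]) | (rule impI, intro conjI; rule 4 5)))
  next
    case True
    define \<sigma> where "\<sigma> = (complex_of_real ` {a..b} \<inter> sigma_ap D A) - sigma_plus G D A"
    have zeroI: "x = 0" if "\<mu> \<in> U" "\<mu> \<notin> complex_of_real ` C" "x \<in> ?N \<mu>" "q x \<le> 0" for \<mu> x
    proof -
      have "edim (?I \<mu>) = 0" using punctU[OF that(1,2)] True by (simp add: kappa_zero_def zero_enat_def)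
      then have "?I \<mu> = {0}" using edim_eq_0_iff[OF cI] by blast
      then show ?thesis using punctU[OF that(1,2)] that(3,4) by blast
    qed
    have plusU: "plus_condition G D A \<mu> UNIV" if "\<mu> \<in> U" "\<mu> \<notin> complex_of_real ` C" for \<mu>
      using zeroI[OF that] by (intro sigma_plus_of_positive_kernel[OF A piU[OF that(1)]])
    \<comment> \<open>At the centres this is the definition of \<sigma>; elsewhere in
      \<open>U\<close> it follows from the absence of nonpositive eigenvectors.\<close>
    have ap: "\<mu> \<in> sigma_plus G D A" if "\<mu> \<in> U - \<sigma>" "\<mu> \<in> sigma_ap D A" for \<mu>
    proof (cases "\<mu> \<in> complex_of_real ` C")
      case True
      then have "\<mu> \<in> complex_of_real ` {a..b}" using C(1) by blast
      then show ?thesis using that by (auto simp: \<sigma>_def)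
    next
      case False
      then show ?thesis using plusU[of \<mu>] that by (simp add: sigma_plus_def)
    qed
    \<comment> \<open>\<open>zeroI\<close> says nothing at the centres. There an eigenvector puts
      \<mu> into \<open>sigma_ap\<close>, hence into \<open>sigma_plus\<close> by \<open>ap\<close>,
      where eigenvectors cannot be nonpositive.\<close>
    have pos: "x = 0" if \<mu>: "\<mu> \<in> U - \<sigma>" and x: "x \<in> ?N \<mu>" "q x \<le> 0" for \<mu> x
    proof (rule ccontr)
      assume "x \<noteq> 0"
      then have "\<mu> \<in> sigma_plus G D A" using ap[OF \<mu>] eigenvector_sigma_ap[OF lin x(1)] by blast
      then show False using nonpositive_eigenvector_not_sigma_plus[OF lin x(1) \<open>x \<noteq> 0\<close> x(2)] by blast
    qed
    have \<sigma>sub: "\<sigma> \<subseteq> complex_of_real ` C"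
    proof
      fix \<mu> assume \<mu>: "\<mu> \<in> \<sigma>"
      then have "\<mu> \<in> U" using U(2) by (auto simp: \<sigma>_def)
      then show "\<mu> \<in> complex_of_real ` C" using plusU[of \<mu>] \<mu> by (auto simp: \<sigma>_def sigma_plus_def)
    qed
    have fin: "finite \<sigma>" using \<sigma>sub C(2) finite_subset by blast
    have \<sigma>pi: "\<sigma> \<subseteq> complex_of_real ` {a..b} \<inter> (sigma_pi_plus G D A - sigma_plus G D A)"
      using sub by (auto simp: \<sigma>_def)
    have iso0: "?I \<mu> = {0}" if "\<mu> \<in> U - \<sigma>" for \<mu>
    proof -
      have "x = 0" if "x \<in> ?I \<mu>" for x
        using pos[OF \<open>\<mu> \<in> U - \<sigma>\<close> isotropic_part_op_kernel(1)[OF that]] isotropic_neutral[OF that] by simp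
      then show ?thesis using complex_vector.subspace_0[OF cI] by blast
    qed
    have kz: "kappa_zero (gip G) (?N \<mu>) = enat \<alpha>" if "\<mu> \<in> U - \<sigma>" for \<mu>
      using iso0[OF that] True by (simp add: kappa_zero_def zero_enat_def)
    have km: "kappa_minus (gip G) (?N \<mu>) = 0" if "\<mu> \<in> U - \<sigma>" for \<mu>
      using pos[OF that] complex_vector.subspace_0[OF cI] by (intro kappa_minus) metis
    have min: "enat \<alpha> \<le> Min ((\<lambda>\<mu>. kappa_zero (gip G) (?N \<mu>)) ` \<sigma>)" if "\<sigma> \<noteq> {}"
      using fin that True by (subst Min_ge_iff) (auto simp: zero_enat_def[symmetric])
    have nonreal: "\<mu> \<notin> sigma_ap D A" if "\<mu> \<in> U" "Im \<mu> \<noteq> 0" for \<mu>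
    proof -
      have "\<mu> \<notin> complex_of_real ` C" using that(2) by auto
      then show ?thesis using plus_condition_nonreal[OF sym plusU[OF that(1)] that(2)] by blast
    qed
    have real_or_trivial: "Im \<mu> = 0 \<or> ?N \<mu> = {0}" if "\<mu> \<in> U" for \<mu>
    proof (cases "Im \<mu> = 0")
      case False
      then have "x = 0" if "x \<in> ?N \<mu>" for x
        using nonreal[OF \<open>\<mu> \<in> U\<close> False] eigenvector_sigma_ap[OF lin that] by blast
      then show ?thesis using complex_vector.subspace_0[OF cN] by blast
    qed simp
    have outside: "?N \<mu> = algebraic_eigenspace D A \<mu>" "hilbert_space_wrt (gip G) (algebraic_eigenspace D A \<mu>)"
      "\<not> (\<exists>xs. jordan_chain D A \<mu> xs \<and> length xs > 1)"
      "almost_pontryagin (gip G) (algebraic_eigenspace D A \<mu>)" if \<mu>: "\<mu> \<in> U - \<sigma>" for \<mu>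
    proof -
      have \<mu>U: "\<mu> \<in> U" using \<mu> by blast
      note J = positive_kernel_no_jordan_chain[OF lin sym real_or_trivial[OF \<mu>U] pos[OF \<mu>]]
      show eq: "?N \<mu> = algebraic_eigenspace D A \<mu>" by (rule J(1))
      show "\<not> (\<exists>xs. jordan_chain D A \<mu> xs \<and> length xs > 1)" by (rule J(2))
      obtain d where d: "d > 0" "\<And>x. x \<in> ?N \<mu> \<Longrightarrow> d * (norm x)\<^sup>2 \<le> q x"
        using uniformly_positive_kernel_part[OF A piU[OF \<mu>U] clN order_refl pos[OF \<mu>]] by blast
      show "hilbert_space_wrt (gip G) (algebraic_eigenspace D A \<mu>)"
        unfolding eq[symmetric] by (rule hilbert_space_wrt_uniformly_positive[OF clN d])
      show "almost_pontryagin (gip G) (algebraic_eigenspace D A \<mu>)"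
        unfolding eq[symmetric]
        by (rule almost_pontryaginI[OF clN clN order_refl d finite.emptyI empty_subsetI])
          (simp_all add: complex_vector.span_superset)
    qed
    have inside: "\<not> (\<exists>x. infinite_jordan_chain D A \<mu> x)"
      "almost_pontryagin (gip G) (algebraic_eigenspace D A \<mu>)"
      "\<And>Np Nm. fundamental_decomposition (gip G) (?N \<mu>) Np Nm \<Longrightarrow>
        \<exists>L1. closed_csubspace L1 \<and> finite_dimensional L1 \<and>
          orth_direct_sum (gip G) (algebraic_eigenspace D A \<mu>) Np L1" if \<mu>: "\<mu> \<in> \<sigma>" for \<mu>
    proof -
      have \<mu>U: "\<mu> \<in> U" and im: "Im \<mu> = 0" using \<mu> U(2) by (auto simp: \<sigma>_def)
      show nc: "\<not> (\<exists>x. infinite_jordan_chain D A \<mu> x)" using \<mu> no True by (auto simp: \<sigma>_def)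
      obtain P d where P: "closed_csubspace P" "P \<subseteq> ?N \<mu>" "d > 0"
        "\<And>x. x \<in> P \<Longrightarrow> d * (norm x)\<^sup>2 \<le> q x"
        "finite_dimensional {x \<in> ?N \<mu>. \<forall>p\<in>P. gip G x p = 0}"
        using positive_part_of_kernel[OF A piU[OF \<mu>U]] by blast
      show "almost_pontryagin (gip G) (algebraic_eigenspace D A \<mu>)"
        by (rule algebraic_eigenspace_decomposition(2)[OF A sym im nc P])
      fix Np Nm assume fd: "fundamental_decomposition (gip G) (?N \<mu>) Np Nm"
      obtain d where P: "closed_csubspace Np" "Np \<subseteq> ?N \<mu>" "d > 0"
        "\<And>x. x \<in> Np \<Longrightarrow> d * (norm x)\<^sup>2 \<le> q x"
        "finite_dimensional {x \<in> ?N \<mu>. \<forall>p\<in>Np. gip G x p = 0}"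
        using fundamental_decomposition_positive_part[OF A piU[OF \<mu>U] fd] by blast
      show "\<exists>L1. closed_csubspace L1 \<and> finite_dimensional L1 \<and>
          orth_direct_sum (gip G) (algebraic_eigenspace D A \<mu>) Np L1"
        by (rule algebraic_eigenspace_decomposition(1)[OF A sym im nc P])
    qed
    have ap_all: "almost_pontryagin (gip G) (algebraic_eigenspace D A \<mu>)" if "\<mu> \<in> U" for \<mu>
      using outside(4) inside(2) that by (cases "\<mu> \<in> \<sigma>") auto
    have 1: "\<forall>\<mu>\<in>U - \<sigma>. kappa_zero (gip G) (?N \<mu>) = enat \<alpha>"
      "\<forall>\<mu>\<in>U - \<sigma>. kappa_minus (gip G) (?N \<mu>) = 0"
      using kz km by blast+
    have 2: "\<sigma> \<noteq> {} \<longrightarrow> enat \<alpha> \<le> Min ((\<lambda>\<mu>. kappa_zero (gip G) (?N \<mu>)) ` \<sigma>)"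
      using min by blast
    have 3: "\<forall>\<mu>\<in>U. almost_pontryagin (gip G) (algebraic_eigenspace D A \<mu>)"
      using ap_all by blast
    have 4: "\<forall>\<mu>\<in>U - \<sigma>. ?N \<mu> = algebraic_eigenspace D A \<mu> \<and>
        hilbert_space_wrt (gip G) (algebraic_eigenspace D A \<mu>) \<and>
        \<not> (\<exists>xs. jordan_chain D A \<mu> xs \<and> length xs > 1)"
      by (intro ballI conjI outside(1-3))
    have 5: "\<forall>\<mu>\<in>\<sigma>. \<not> (\<exists>x. infinite_jordan_chain D A \<mu> x) \<and>
        (\<forall>Np Nm. fundamental_decomposition (gip G) (?N \<mu>) Np Nm \<longrightarrow>
          (\<exists>L1. closed_csubspace L1 \<and> finite_dimensional L1 \<and>
            orth_direct_sum (gip G) (algebraic_eigenspace D A \<mu>) Np L1))"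
      by (intro ballI conjI allI impI; (rule inside(1) | rule inside(3)); assumption)
    have 6: "U - \<real> \<subseteq> r_set D A"
      using nonreal by (auto simp: r_set_def complex_is_Real_iff)
    have 7: "U \<inter> sigma_ap D A \<subseteq> sigma_plus G D A \<union> \<sigma>" using ap by blast
    show ?thesis
      by (rule exI[of _ U], rule exI[of _ \<sigma>], rule exI[of _ \<alpha>], intro conjI;
        (rule U fin \<sigma>pi 1 2 | (rule impI, simp add: True; fail)
          | (rule impI, intro conjI; rule 3 4 5 6 7 \<sigma>_def)))
  qed
qed

end

section \<open>Reversing the sign of the form\<close>

lemma gip_uminus: "gip (\<lambda>x. - G x) = (\<lambda>x y. - gip G x y)"
  by (intro ext) (simp add: gip_def bounded_bilinear.minus_left[OF bounded_bilinear_cinner])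

lemma bounded_selfadjoint_uminus: "bounded_selfadjoint G \<Longrightarrow> bounded_selfadjoint (\<lambda>x. - G x)"
  by (simp add: bounded_selfadjoint_def bounded_linear_minus complex_vector.scale_minus_right
      bounded_bilinear.minus_left[OF bounded_bilinear_cinner] bounded_bilinear.minus_right[OF bounded_bilinear_cinner])

lemma G_symmetric_uminus: "G_symmetric (\<lambda>x. - G x) D A = G_symmetric G D A"
  by (simp add: G_symmetric_def gip_uminus)

lemma plus_condition_uminus: "plus_condition (\<lambda>x. - G x) D A \<mu> H = minus_condition G D A \<mu> H"
proof -
  have "liminf (\<lambda>n. ereal (Re (- gip G (x n) (x n)))) = - limsup (\<lambda>n. ereal (Re (gip G (x n) (x n))))" for x
    by (simp add: ereal_Liminf_uminus[symmetric])
  moreover have "0 < - (s :: ereal) \<longleftrightarrow> s < 0" for s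
    using ereal_uminus_less_reorder[of s 0] ereal_less_uminus_reorder[of 0 s] by simp
  ultimately show ?thesis by (simp only: plus_condition_def minus_condition_def gip_uminus)
qed

lemma sigma_plus_uminus: "sigma_plus (\<lambda>x. - G x) D A = sigma_minus G D A"
  by (simp add: sigma_plus_def sigma_minus_def plus_condition_uminus)

lemma sigma_pi_plus_uminus: "sigma_pi_plus (\<lambda>x. - G x) D A = sigma_pi_minus G D A"
  by (simp add: sigma_pi_plus_def sigma_pi_minus_def plus_condition_uminus)

lemma isotropic_part_uminus: "isotropic_part (\<lambda>x y. - f x y) L = isotropic_part f L"
  by (simp add: isotropic_part_def orth_companion_def)

lemma kappa_zero_uminus: "kappa_zero (\<lambda>x y. - f x y) L = kappa_zero f L"
  by (simp add: kappa_zero_def isotropic_part_uminus)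

lemma orth_direct_sum_uminus: "orth_direct_sum (\<lambda>x y. - f x y) L M N = orth_direct_sum f L M N"
  by (simp add: orth_direct_sum_def)

lemma almost_pontryagin_uminus: "almost_pontryagin (\<lambda>x y. - f x y) L = almost_pontryagin f L"
  by (auto simp: almost_pontryagin_def)

text \<open>The sign change exchanges the two definite components; \<open>herm\<close> allows their
  orthogonality to be read in the exchanged order.\<close>

lemma fundamental_decomposition_uminus_imp:
  assumes herm: "\<And>x y. f x y = 0 \<longleftrightarrow> f y x = 0"
    and fd: "fundamental_decomposition f L Lp Lm"
  shows "fundamental_decomposition (\<lambda>x y. - f x y) L Lm Lp"
proof -
  let ?I = "isotropic_part f L"
  have comm: "Lm + Lp = Lp + Lm" by (rule add.commute)
  note fd' = fd[unfolded fundamental_decomposition_def]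
  have "positive_set (\<lambda>x y. - f x y) Lm" "negative_set (\<lambda>x y. - f x y) Lp"
    using fd' by (simp_all add: positive_set_def negative_set_def)
  moreover have "orth_direct_sum f (Lp + Lm) Lm Lp"
    using conjunct1[OF conjunct2[OF conjunct2[OF conjunct2[OF conjunct2[OF fd']]]]] herm
    unfolding orth_direct_sum_def comm Int_commute[of Lm Lp] by blast
  moreover obtain C where C: "\<forall>x\<in>Lp. \<forall>y\<in>Lm. \<forall>z\<in>?I. norm x \<le> C * norm (x + y + z) \<and>
      norm y \<le> C * norm (x + y + z) \<and> norm z \<le> C * norm (x + y + z)"
    using fd' by (elim conjE exE)
  have "norm y \<le> C * norm (y + x + z) \<and> norm x \<le> C * norm (y + x + z) \<and> norm z \<le> C * norm (y + x + z)"
    if "y \<in> Lm" "x \<in> Lp" "z \<in> ?I" for x y z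
    using C[rule_format, OF that(2,1,3)] by (simp add: add.commute[of y x])
  then have "\<exists>C. \<forall>y\<in>Lm. \<forall>x\<in>Lp. \<forall>z\<in>?I. norm y \<le> C * norm (y + x + z) \<and>
      norm x \<le> C * norm (y + x + z) \<and> norm z \<le> C * norm (y + x + z)" by blast
  ultimately show ?thesis
    using fd' unfolding fundamental_decomposition_def isotropic_part_uminus orth_direct_sum_uminus comm
    by (elim conjE) (intro conjI)
qed

lemma fundamental_decomposition_uminus:
  assumes herm: "\<And>x y. f x y = 0 \<longleftrightarrow> f y x = 0"
  shows "fundamental_decomposition (\<lambda>x y. - f x y) L Lp Lm = fundamental_decomposition f L Lm Lp"
proof
  assume fd: "fundamental_decomposition (\<lambda>x y. - f x y) L Lp Lm"
  have "- f x y = 0 \<longleftrightarrow> - f y x = 0" for x y using herm[of x y] by simp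
  from fundamental_decomposition_uminus_imp[OF this fd]
  show "fundamental_decomposition f L Lm Lp" by simp
qed (rule fundamental_decomposition_uminus_imp[OF herm])

text \<open>The predicate \<open>R\<close> stands for the conclusion about \<open>\<L>\<close>-type
  splittings, so that the quantified claim can be rewritten as a whole, with the definite component
  exchanged.\<close>

lemma all_fundamental_decomposition_uminus:
  assumes herm: "\<And>x y. f x y = 0 \<longleftrightarrow> f y x = 0"
  shows "(\<forall>Np Nm. fundamental_decomposition (\<lambda>x y. - f x y) L Np Nm \<longrightarrow> R Np) \<longleftrightarrow>
    (\<forall>Np Nm. fundamental_decomposition f L Np Nm \<longrightarrow> R Nm)"
  unfolding fundamental_decomposition_uminus[OF herm] by blast

lemma kappa_minus_uminus:
  assumes herm: "\<And>x y. f x y = 0 \<longleftrightarrow> f y x = 0"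
  shows "kappa_minus (\<lambda>x y. - f x y) L = kappa_plus f L"
proof -
  have "(\<exists>Lp Lm. fundamental_decomposition (\<lambda>x y. - f x y) L Lp Lm \<and> k = edim Lm) \<longleftrightarrow>
      (\<exists>Lp Lm. fundamental_decomposition f L Lp Lm \<and> k = edim Lp)" for k
    unfolding fundamental_decomposition_uminus[OF herm] by blast
  then show ?thesis by (simp only: kappa_minus_def kappa_plus_def)
qed

theorem theorem4p2:
  fixes G A :: "'a::chilbert_space \<Rightarrow> 'a" and D :: "'a set" and a b :: real
  assumes "bounded_selfadjoint G"
    and "closed_operator D A" and "densely_defined D" and "G_symmetric G D A"
    and "a \<le> b"
  shows
    "(complex_of_real ` {a..b} \<inter> sigma_ap D A \<subseteq> sigma_pi_plus G D A \<longrightarrow>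
      (\<exists>U \<sigma> \<alpha>.
         open U \<and> complex_of_real ` {a..b} \<subseteq> U \<and>
         finite \<sigma> \<and>
         \<sigma> \<subseteq> complex_of_real ` {a..b} \<inter> (sigma_pi_plus G D A - sigma_plus G D A) \<and>
         (\<forall>\<mu>\<in>U - \<sigma>. kappa_zero (gip G) (op_kernel D A \<mu>) = enat \<alpha>) \<and>
         (\<sigma> \<noteq> {} \<longrightarrow> enat \<alpha> \<le> Min ((\<lambda>\<mu>. kappa_zero (gip G) (op_kernel D A \<mu>)) ` \<sigma>)) \<and>
         (\<forall>\<mu>\<in>U - \<sigma>. kappa_minus (gip G) (op_kernel D A \<mu>) = 0) \<and>
         (\<alpha> = 0 \<longrightarrow>
            (\<forall>\<mu>\<in>U. almost_pontryagin (gip G) (algebraic_eigenspace D A \<mu>)) \<and>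
            (\<forall>\<mu>\<in>U - \<sigma>.
               op_kernel D A \<mu> = algebraic_eigenspace D A \<mu> \<and>
               hilbert_space_wrt (gip G) (algebraic_eigenspace D A \<mu>) \<and>
               \<not> (\<exists>xs. jordan_chain D A \<mu> xs \<and> length xs > 1)) \<and>
            (\<forall>\<mu>\<in>\<sigma>.
               \<not> (\<exists>x. infinite_jordan_chain D A \<mu> x) \<and>
               (\<forall>Np Nm. fundamental_decomposition (gip G) (op_kernel D A \<mu>) Np Nm \<longrightarrow>
                  (\<exists>L1. closed_csubspace L1 \<and> finite_dimensional L1 \<and>
                     orth_direct_sum (gip G) (algebraic_eigenspace D A \<mu>) Np L1))) \<and>
            \<sigma> = (complex_of_real ` {a..b} \<inter> sigma_ap D A) - sigma_plus G D A \<and>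
            U - \<real> \<subseteq> r_set D A \<and>
            U \<inter> sigma_ap D A \<subseteq> sigma_plus G D A \<union> \<sigma>) \<and>
         (\<alpha> > 0 \<longrightarrow>
            U \<subseteq> point_spectrum D A \<and>
            (\<forall>\<mu>\<in>U. isotropic_part (gip G) (op_kernel D A \<mu>) \<noteq> {0}) \<and>
            (\<forall>\<mu>\<in>U. \<exists>x. (\<forall>j<\<alpha>. infinite_jordan_chain D A \<mu> (x j)) \<and> independent_chains \<alpha> x) \<and>
            U \<subseteq> sigma_pi_plus G D A - sigma_plus G D A))) \<and>
     (complex_of_real ` {a..b} \<inter> sigma_ap D A \<subseteq> sigma_pi_minus G D A \<longrightarrow>
      (\<exists>U \<sigma> \<alpha>.
         open U \<and> complex_of_real ` {a..b} \<subseteq> U \<and>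
         finite \<sigma> \<and>
         \<sigma> \<subseteq> complex_of_real ` {a..b} \<inter> (sigma_pi_minus G D A - sigma_minus G D A) \<and>
         (\<forall>\<mu>\<in>U - \<sigma>. kappa_zero (gip G) (op_kernel D A \<mu>) = enat \<alpha>) \<and>
         (\<sigma> \<noteq> {} \<longrightarrow> enat \<alpha> \<le> Min ((\<lambda>\<mu>. kappa_zero (gip G) (op_kernel D A \<mu>)) ` \<sigma>)) \<and>
         (\<forall>\<mu>\<in>U - \<sigma>. kappa_plus (gip G) (op_kernel D A \<mu>) = 0) \<and>
         (\<alpha> = 0 \<longrightarrow>
            (\<forall>\<mu>\<in>U. almost_pontryagin (gip G) (algebraic_eigenspace D A \<mu>)) \<and>
            (\<forall>\<mu>\<in>U - \<sigma>.
               op_kernel D A \<mu> = algebraic_eigenspace D A \<mu> \<and>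
               anti_hilbert_space_wrt (gip G) (algebraic_eigenspace D A \<mu>) \<and>
               \<not> (\<exists>xs. jordan_chain D A \<mu> xs \<and> length xs > 1)) \<and>
            (\<forall>\<mu>\<in>\<sigma>.
               \<not> (\<exists>x. infinite_jordan_chain D A \<mu> x) \<and>
               (\<forall>Np Nm. fundamental_decomposition (gip G) (op_kernel D A \<mu>) Np Nm \<longrightarrow>
                  (\<exists>L1. closed_csubspace L1 \<and> finite_dimensional L1 \<and>
                     orth_direct_sum (gip G) (algebraic_eigenspace D A \<mu>) Nm L1))) \<and>
            \<sigma> = (complex_of_real ` {a..b} \<inter> sigma_ap D A) - sigma_minus G D A \<and>
            U - \<real> \<subseteq> r_set D A \<and>
            U \<inter> sigma_ap D A \<subseteq> sigma_minus G D A \<union> \<sigma>) \<and>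
         (\<alpha> > 0 \<longrightarrow>
            U \<subseteq> point_spectrum D A \<and>
            (\<forall>\<mu>\<in>U. isotropic_part (gip G) (op_kernel D A \<mu>) \<noteq> {0}) \<and>
            (\<forall>\<mu>\<in>U. \<exists>x. (\<forall>j<\<alpha>. infinite_jordan_chain D A \<mu> (x j)) \<and> independent_chains \<alpha> x) \<and>
            U \<subseteq> sigma_pi_minus G D A - sigma_minus G D A)))"
proof -
  interpret P: indefinite G by standard (rule assms(1))
  interpret N: indefinite "\<lambda>x. - G x" by standard (rule bounded_selfadjoint_uminus[OF assms(1)])
  note plus = P.plus_case[OF assms(2,4)]
  \<comment> \<open>The statement with minus signs is the one with plus signs for
    \<open>- G\<close>, rewritten notion by notion.\<close>
  note minus = N.plus_case[OF assms(2), unfolded G_symmetric_uminus, OF assms(4),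
      unfolded sigma_plus_uminus sigma_pi_plus_uminus gip_uminus kappa_zero_uminus
      kappa_minus_uminus[of "gip G", OF P.gip_zero_commute] almost_pontryagin_uminus
      anti_hilbert_space_wrt_def[symmetric] isotropic_part_uminus orth_direct_sum_uminus
      all_fundamental_decomposition_uminus[of "gip G", OF P.gip_zero_commute]]
  show ?thesis by (intro conjI impI) (erule plus, erule minus)
qed

end
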